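(* Let $(\alpha,\beta,\gamma)\in R_2$ and let $(G,w)\in\mathbf{Tri}(\alpha,\beta,\gamma)$ be extremal and vertex minimal. Then $G$ is strongly-isomorphic to $H_7$, $H_7'$ or $H_9$.
   Context: A tripartite graph is a graph $G=(V,E)$ with a fixed partition $V=A\dot\cup B\dot\cup C$ into three nonempty independent sets. A weighted tripartite graph $(G,w)$ is a tripartite graph with $w:V\to[0,1]$ such that the weights in each class sum to $1$. Its edge densities are $\alpha(G,w)=\sum_{bc\in E,\,b\in B,c\in C}w(b)w(c)$, $\beta(G,w)=\sum_{ac\in E,\,a\in A,c\in C}w(a)w(c)$, $\gamma(G,w)=\sum_{ab\in E,\,a\in A,b\in B}w(a)w(b)$; the triangle density is $t(G,w)=\sum w(a)w(b)w(c)$ over pairwise adjacent triples $a\in A,b\in B,c\in C$. $\mathbf{Tri}(\alpha,\beta,\gamma)$ is the set of weighted tripartite graphs with edge densities $\alpha,\beta,\gamma$, and $T_{\min}(\alpha,\beta,\gamma)=\min_{(G,w)\in\mathbf{Tri}(\alpha,\beta,\gamma)}t(G,w)$. $(G,w)\in\mathbf{Tri}(\alpha,\beta,\gamma)$ is extremal if $t(G,w)=T_{\min}(\alpha,\beta,\gamma)$, and vertex minimal if there is no $(G',w')\in\mathbf{Tri}(\alpha,\beta,\gamma)$ with $t(G',w')=t(G,w)$ and $|V(G')|<|V(G)|$. Two tripartite graphs are strongly-isomorphic if there is a graph isomorphism between them mapping each vertex class onto a vertex class. Let $R=\{(\alpha,\beta,\gamma)\in[0,1]^3:\alpha\beta+\gamma>1,\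 \alpha\gamma+\beta>1,\ \beta\gamma+\alpha>1\}$, $\Delta(\alpha,\beta,\gamma)=\alpha^2+\beta^2+\gamma^2-2\alpha\beta-2\alpha\gamma-2\beta\gamma+4\alpha\beta\gamma$, and $R_2=\{(\alpha,\beta,\gamma)\in R:\Delta(\alpha,\beta,\gamma)<0\}$. The graphs: $H_7$ has classes $A=\{a_1,a_2\}$, $B=\{b_1,b_2\}$, $C=\{c_1,c_2,c_3\}$ and is $K_{2,2,3}$ minus the edges $a_2b_1,a_1c_2,a_1c_3,b_2c_1,b_2c_2$. $H_7'$ has classes $A=\{a_1,a_2\}$, $B=\{b_1,b_2,b_3\}$, $C=\{c_1,c_2\}$ and is $K_{2,3,2}$ minus the edges $a_2b_1,a_1c_2,b_2c_1,b_3c_1,b_3c_2$. $H_9$ has classes $A=\{a_1,a_2,a_3\}$, $B=\{b_1,b_2,b_3\}$, $C=\{c_1,c_2,c_3\}$ and is $K_{3,3,3}$ minus the edges of the $9$-cycle $a_2b_1a_3c_3a_1c_2b_2c_1b_3a_2$. *)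

theory Defs
  imports Complex_Main
begin

record 'a tripartition_graph =
  cls_A :: "'a set"
  cls_B :: "'a set"
  cls_C :: "'a set"
  edges :: "'a set set"

definition verts :: "'a tripartition_graph \<Rightarrow> 'a set" where
  "verts G = cls_A G \<union> cls_B G \<union> cls_C G"

definition independent :: "'a set set \<Rightarrow> 'a set \<Rightarrow> bool" where
  "independent E S \<longleftrightarrow> (\<forall>u\<in>S. \<forall>v\<in>S. {u, v} \<notin> E)"

definition tripartite :: "'a tripartition_graph \<Rightarrow> bool" where
  "tripartite G \<longleftrightarrow>
     finite (verts G) \<and>
     edges G \<subseteq> {e. e \<subseteq> verts G \<and> card e = 2} \<and>
     cls_A G \<noteq> {} \<and> cls_B G \<noteq> {} \<and> cls_C G \<noteq> {} \<and>
     cls_A G \<inter> cls_B G = {} \<and> cls_A G \<inter> cls_C G = {} \<and> cls_B G \<inter> cls_C G = {} \<and>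
     independent (edges G) (cls_A G) \<and>
     independent (edges G) (cls_B G) \<and>
     independent (edges G) (cls_C G)"

text \<open>Weights are total functions; only their values on the vertex set matter.\<close>

type_synonym 'a wgraph = "'a tripartition_graph \<times> ('a \<Rightarrow> real)"

definition weighted_tripartite :: "'a wgraph \<Rightarrow> bool" where
  "weighted_tripartite = (\<lambda>(G, w).
     tripartite G \<and>
     (\<forall>v\<in>verts G. w v \<in> {0..1}) \<and>
     (\<Sum>a\<in>cls_A G. w a) = 1 \<and>
     (\<Sum>b\<in>cls_B G. w b) = 1 \<and>
     (\<Sum>c\<in>cls_C G. w c) = 1)"

definition alpha_density :: "'a wgraph \<Rightarrow> real" where
  "alpha_density = (\<lambda>(G, w).
     \<Sum>(b, c) \<in> {(b, c) \<in> cls_B G \<times> cls_C G. {b, c} \<in> edges G}. w b * w c)"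

definition beta_density :: "'a wgraph \<Rightarrow> real" where
  "beta_density = (\<lambda>(G, w).
     \<Sum>(a, c) \<in> {(a, c) \<in> cls_A G \<times> cls_C G. {a, c} \<in> edges G}. w a * w c)"

definition gamma_density :: "'a wgraph \<Rightarrow> real" where
  "gamma_density = (\<lambda>(G, w).
     \<Sum>(a, b) \<in> {(a, b) \<in> cls_A G \<times> cls_B G. {a, b} \<in> edges G}. w a * w b)"

definition triangle_density :: "'a wgraph \<Rightarrow> real" where
  "triangle_density = (\<lambda>(G, w).
     \<Sum>(a, b, c) \<in> {(a, b, c) \<in> cls_A G \<times> cls_B G \<times> cls_C G.
                      {a, b} \<in> edges G \<and> {a, c} \<in> edges G \<and> {b, c} \<in> edges G}.
       w a * w b * w c)"

definition Tri :: "real \<Rightarrow> real \<Rightarrow> real \<Rightarrow> 'a wgraph set" where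
  "Tri \<alpha> \<beta> \<gamma> = {Gw. weighted_tripartite Gw \<and>
     alpha_density Gw = \<alpha> \<and> beta_density Gw = \<beta> \<and> gamma_density Gw = \<gamma>}"

text \<open>
  Quantification over all weighted tripartite graphs is rendered by graphs with
  vertices in \<open>nat\<close>: every finite graph, on any vertex type, has an isomorphic copy
  there.  The minimum is written as an infimum; a member of \<open>Tri \<alpha> \<beta> \<gamma>\<close> whose
  triangle density equals it attains it, so for such a member it is the minimum.
\<close>

definition T_min :: "real \<Rightarrow> real \<Rightarrow> real \<Rightarrow> real" where
  "T_min \<alpha> \<beta> \<gamma> = (INF Gw \<in> (Tri \<alpha> \<beta> \<gamma> :: nat wgraph set). triangle_density Gw)"

definition extremal :: "real \<Rightarrow> real \<Rightarrow> real \<Rightarrow> 'a wgraph \<Rightarrow> bool" where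
  "extremal \<alpha> \<beta> \<gamma> Gw \<longleftrightarrow> Gw \<in> Tri \<alpha> \<beta> \<gamma> \<and> triangle_density Gw = T_min \<alpha> \<beta> \<gamma>"

definition vertex_minimal :: "real \<Rightarrow> real \<Rightarrow> real \<Rightarrow> 'a wgraph \<Rightarrow> bool" where
  "vertex_minimal \<alpha> \<beta> \<gamma> Gw \<longleftrightarrow> Gw \<in> Tri \<alpha> \<beta> \<gamma> \<and>
     \<not> (\<exists>Gw' \<in> (Tri \<alpha> \<beta> \<gamma> :: nat wgraph set).
          triangle_density Gw' = triangle_density Gw \<and>
          card (verts (fst Gw')) < card (verts (fst Gw)))"

definition strongly_isomorphic ::
  "'a tripartition_graph \<Rightarrow> 'b tripartition_graph \<Rightarrow> bool" where
  "strongly_isomorphic G H \<longleftrightarrow>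
     (\<exists>f. bij_betw f (verts G) (verts H) \<and>
          (\<forall>u\<in>verts G. \<forall>v\<in>verts G. {u, v} \<in> edges G \<longleftrightarrow> {f u, f v} \<in> edges H) \<and>
          (\<forall>X\<in>{cls_A G, cls_B G, cls_C G}. f ` X \<in> {cls_A H, cls_B H, cls_C H}))"

definition R_region :: "(real \<times> real \<times> real) set" where
  "R_region = {(\<alpha>, \<beta>, \<gamma>). \<alpha> \<in> {0..1} \<and> \<beta> \<in> {0..1} \<and> \<gamma> \<in> {0..1} \<and>
     \<alpha> * \<beta> + \<gamma> > 1 \<and> \<alpha> * \<gamma> + \<beta> > 1 \<and> \<beta> * \<gamma> + \<alpha> > 1}"

definition Delta :: "real \<Rightarrow> real \<Rightarrow> real \<Rightarrow> real" where
  "Delta \<alpha> \<beta> \<gamma> = \<alpha>\<^sup>2 + \<beta>\<^sup>2 + \<gamma>\<^sup>2 - 2 * \<alpha> * \<beta> - 2 * \<alpha> * \<gamma> - 2 * \<beta> * \<gamma> + 4 * \<alpha> * \<beta> * \<gamma>"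

definition R2_region :: "(real \<times> real \<times> real) set" where
  "R2_region = {(\<alpha>, \<beta>, \<gamma>). (\<alpha>, \<beta>, \<gamma>) \<in> R_region \<and> Delta \<alpha> \<beta> \<gamma> < 0}"

datatype hvert = VA nat | VB nat | VC nat

definition complete_tripartite_edges :: "'a set \<Rightarrow> 'a set \<Rightarrow> 'a set \<Rightarrow> 'a set set" where
  "complete_tripartite_edges A B C =
     {{a, b} | a b. a \<in> A \<and> b \<in> B} \<union> {{a, c} | a c. a \<in> A \<and> c \<in> C} \<union>
     {{b, c} | b c. b \<in> B \<and> c \<in> C}"

definition complete_minus :: "'a set \<Rightarrow> 'a set \<Rightarrow> 'a set \<Rightarrow> 'a set set \<Rightarrow> 'a tripartition_graph" where
  "complete_minus A B C M =
     \<lparr>cls_A = A, cls_B = B, cls_C = C, edges = complete_tripartite_edges A B C - M\<rparr>"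

definition H7 :: "hvert tripartition_graph" where
  "H7 = complete_minus {VA 1, VA 2} {VB 1, VB 2} {VC 1, VC 2, VC 3}
     {{VA 2, VB 1}, {VA 1, VC 2}, {VA 1, VC 3}, {VB 2, VC 1}, {VB 2, VC 2}}"

definition H7' :: "hvert tripartition_graph" where
  "H7' = complete_minus {VA 1, VA 2} {VB 1, VB 2, VB 3} {VC 1, VC 2}
     {{VA 2, VB 1}, {VA 1, VC 2}, {VB 2, VC 1}, {VB 3, VC 1}, {VB 3, VC 2}}"

definition H9 :: "hvert tripartition_graph" where
  "H9 = complete_minus {VA 1, VA 2, VA 3} {VB 1, VB 2, VB 3} {VC 1, VC 2, VC 3}
     {{VA 2, VB 1}, {VB 1, VA 3}, {VA 3, VC 3}, {VC 3, VA 1}, {VA 1, VC 2},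
      {VC 2, VB 2}, {VB 2, VC 1}, {VC 1, VB 3}, {VB 3, VA 2}}"

end

theory Submission
  imports Defs "HOL-Analysis.Analysis"
begin

text \<open>
  Fixing two of the classes, the densities are linear in the weights of the third one. Hence an
  extremal vertex-minimal graph has at most three vertices in each class, and adjacencies of one
  class may be taken fractional without changing \<open>T_min\<close>. Three kinds of exchange then restrict the
  graph. Two vertices with neighbourhoods \<open>(X\<^sub>1, Y\<^sub>1)\<close> and \<open>(X\<^sub>2, Y\<^sub>2)\<close> in the other classes can be
  uncrossed into \<open>(X\<^sub>1 \<inter> X\<^sub>2, Y\<^sub>1 \<union> Y\<^sub>2)\<close> and \<open>(X\<^sub>1 \<union> X\<^sub>2, Y\<^sub>1 \<inter> Y\<^sub>2)\<close>; doing this twice shows that if \<open>ab\<close> lies in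
  a triangle and \<open>ab'\<close> is not an edge, then the neighbourhood of \<open>b\<close> in the third class is contained in that
  of \<open>b'\<close>. A non-edge without a common neighbour could be added for free, which is impossible since
  \<open>T_min > 0\<close> on \<open>R\<close>. Vertices of one class agreeing on a second class can be merged at the expense of
  the third. Finally \<open>T_min < \<alpha> + \<beta> \<gamma> - 1\<close>, so neighbourhood sizes are not constant on a class, and
  \<open>\<Delta> < 0\<close> forces some vertex to have non-neighbours in both other classes. These conditions are
  propositional on at most nine vertices and leave only \<open>H\<^sub>7\<close>, \<open>H\<^sub>7'\<close>, \<open>H\<^sub>9\<close> and three graphs excluded by the
  bounds on \<open>T_min\<close>.
\<close>

subsection \<open>Linear programs over vertex weights\<close>

text \<open>The bound three has one source: with everything else fixed, the weights of one class
  obey three linear equations (total weight and the two edge densities touching the class), so a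
  basic solution has at most three vertices. This makes fractional competitors as good as graphs: a
  vertex with fractional adjacencies is a mixture of vertices with 0-1 adjacencies, and the linear
  program shrinks the mixture to three again. The obstacle is that exchanges add vertices, so their
  results are extremal but need not be vertex minimal. Hence the exchange lemmas assume only
  extremality, over arbitrary index types and for vertices of positive weight; minimality enters
  afterwards, through positive weights, class sizes and merging. Merging compresses two classes by
  their mutual neighbourhoods while the third is rebuilt with at most three vertices; a third class
  of size two leaves a slack of one, a class of size three leaves none. The bound
  \<open>\<alpha> + \<beta> * \<gamma> - 1\<close> is a lower bound for the triangle density when
  one class has constant neighbourhoods in another.\<close>

lemma exists_linear_relation:
  fixes F :: "'i \<Rightarrow> 'e::euclidean_space"
  assumes "finite T" "DIM('e) < card T"
  obtains v :: "'i \<Rightarrow> real" where "\<exists>i\<in>T. v i \<noteq> 0" "(\<Sum>i\<in>T. v i *\<^sub>R F i) = 0"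
\<comment> \<open>\<open>dependent\<close> concerns sets of vectors, so a family that takes a value
  twice is treated apart; its relation is \<open>F i - F j = 0\<close>.\<close>
proof (cases "inj_on F T")
  case True
  then have "dependent (F ` T)"
    using assms by (intro dependent_biggerset) (auto simp: card_image)
  then obtain u where u: "\<exists>e\<in>F ` T. u e \<noteq> 0" "(\<Sum>e\<in>F ` T. u e *\<^sub>R e) = 0"
    using assms(1) by (subst (asm) dependent_finite) auto
  show thesis
    using u True by (intro that[of "u \<circ> F"]) (auto simp: sum.reindex)
next
  case False
  then obtain i j where ij: "i \<in> T" "j \<in> T" "i \<noteq> j" "F i = F j"
    by (auto simp: inj_on_def)
  let ?v = "\<lambda>k. if k = i then 1 else if k = j then - 1 else (0::real)"
  have "(\<Sum>k\<in>T. ?v k *\<^sub>R F k) = (\<Sum>k\<in>{i, j}. ?v k *\<^sub>R F k)"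
    using ij assms(1) by (intro sum.mono_neutral_right) auto
  also have "\<dots> = 0" using ij by simp
  finally show thesis using ij by (intro that[of ?v]) auto
qed

text \<open>The ratio test of the simplex method: \<open>s\<close> is the least step at which some
  decreasing coordinate reaches zero.\<close>

lemma move_weight_to_boundary:
  fixes x v :: "'i \<Rightarrow> real"
  assumes "finite S" "\<And>i. i \<in> S \<Longrightarrow> 0 \<le> x i" "\<exists>i\<in>S. v i < 0" "\<And>i. i \<in> S \<Longrightarrow> x i = 0 \<Longrightarrow> v i = 0"
  obtains s i where "0 \<le> s" "\<And>i. i \<in> S \<Longrightarrow> 0 \<le> x i + s * v i" "i \<in> S" "v i < 0" "x i + s * v i = 0"
proof -
  define N where "N = {i \<in> S. v i < 0}"
  define s where "s = Min ((\<lambda>i. x i / (- v i)) ` N)"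
  have N: "finite N" "N \<noteq> {}" using assms by (auto simp: N_def)
  then have "s \<in> (\<lambda>i. x i / (- v i)) ` N" unfolding s_def by (intro Min_in) auto
  then obtain i where i: "i \<in> N" "s = x i / (- v i)" by auto
  have s0: "0 \<le> s" using i assms(2)[of i] by (auto simp: N_def intro!: divide_nonneg_neg)
  have "0 \<le> x k + s * v k" if "k \<in> S" for k
  proof (cases "v k < 0")
    case True
    then have "s \<le> x k / (- v k)" using N that unfolding s_def by (intro Min_le) (auto simp: N_def)
    then show ?thesis using True by (simp add: field_simps)
  next
    case False
    then show ?thesis using s0 assms(2)[OF that] by (simp add: mult_nonneg_nonneg)
  qed
  moreover have "x i + s * v i = 0" "i \<in> S" "v i < 0" using i by (auto simp: N_def field_simps)
  ultimately show thesis using s0 that by blast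
qed

text \<open>Caratheodory's reduction for a linear program. While the support exceeds the dimension,
  the vectors \<open>F i\<close> on it are dependent; moving along a relation keeps the constraints
  and, with the right sign, does not raise the cost \<open>c\<close>. The vector \<open>e\<close>
  reads the total weight off the constraints, so the relation sums to zero, some coordinate
  decreases, and one more weight is driven to zero.\<close>

lemma reduce_support:
  fixes F :: "'i \<Rightarrow> 'e::euclidean_space" and c x :: "'i \<Rightarrow> real"
  assumes "finite S" "\<And>i. i \<in> S \<Longrightarrow> 0 \<le> x i" and e: "\<And>i. i \<in> S \<Longrightarrow> F i \<bullet> e = 1"
  shows "\<exists>x'. (\<forall>i\<in>S. 0 \<le> x' i) \<and> (\<Sum>i\<in>S. x' i *\<^sub>R F i) = (\<Sum>i\<in>S. x i *\<^sub>R F i) \<and>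
    (\<Sum>i\<in>S. x' i * c i) \<le> (\<Sum>i\<in>S. x i * c i) \<and> card {i \<in> S. x' i \<noteq> 0} \<le> DIM('e)"
  using assms(2)
proof (induction "card {i \<in> S. x i \<noteq> 0}" arbitrary: x rule: less_induct)
  case less
  define T where "T = {i \<in> S. x i \<noteq> 0}"
  have finT: "finite T" and TS: "T \<subseteq> S" using assms(1) by (auto simp: T_def)
  show ?case
  proof (cases "card T \<le> DIM('e)")
    case True
    then show ?thesis using less.prems unfolding T_def by (intro exI[of _ x]) auto
  next
    case False
    then obtain u where u: "\<exists>i\<in>T. u i \<noteq> 0" "(\<Sum>i\<in>T. u i *\<^sub>R F i) = 0"
      using exists_linear_relation[OF finT, of F] by (metis not_le)
    define \<sigma> where "\<sigma> = (if (\<Sum>i\<in>T. u i * c i) \<le> 0 then 1 else - 1 :: real)"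
    define v where "v i = (if i \<in> T then \<sigma> * u i else 0)" for i
    have \<sigma>: "\<sigma> \<noteq> 0" "\<sigma> * (\<Sum>i\<in>T. u i * c i) \<le> 0" by (auto simp: \<sigma>_def)
    have sumS: "(\<Sum>i\<in>S. v i *\<^sub>R f i) = \<sigma> *\<^sub>R (\<Sum>i\<in>T. u i *\<^sub>R f i)" for f :: "'i \<Rightarrow> 'b::real_vector"
    proof -
      have "(\<Sum>i\<in>S. v i *\<^sub>R f i) = (\<Sum>i\<in>T. v i *\<^sub>R f i)"
        using TS assms(1) by (intro sum.mono_neutral_right) (simp_all add: v_def)
      then show ?thesis by (simp add: v_def scaleR_sum_right)
    qed
    have vF: "(\<Sum>i\<in>S. v i *\<^sub>R F i) = 0" using sumS[of F] u by simp
    have vc: "(\<Sum>i\<in>S. v i * c i) \<le> 0" using sumS[of c] \<sigma> by simp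
    have "(\<Sum>i\<in>S. v i) = (\<Sum>i\<in>S. v i *\<^sub>R F i) \<bullet> e"
      unfolding inner_sum_left using e by (intro sum.cong) auto
    then have v0: "(\<Sum>i\<in>S. v i) = 0" using vF by simp
    have "\<exists>i\<in>S. v i < 0"
    proof (rule ccontr)
      assume "\<not> ?thesis"
      then have "\<forall>i\<in>S. v i = 0" using v0 assms(1) sum_nonneg_eq_0_iff[of S v] by (simp add: not_less)
      then have "\<sigma> * u i = 0" if "i \<in> T" for i using that TS by (metis v_def subsetD)
      then show False using u(1) \<sigma>(1) by auto
    qed
    then obtain s i where s: "0 \<le> s" "\<And>i. i \<in> S \<Longrightarrow> 0 \<le> x i + s * v i" "i \<in> S" "v i < 0" "x i + s * v i = 0"
      using move_weight_to_boundary[of S x v] assms(1) less.prems by (auto simp: v_def T_def)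
    let ?y = "\<lambda>i. x i + s * v i"
    have "{i \<in> S. ?y i \<noteq> 0} \<subset> T" using s by (auto simp: T_def v_def split: if_splits)
    then have "card {i \<in> S. ?y i \<noteq> 0} < card {i \<in> S. x i \<noteq> 0}"
      using finT psubset_card_mono unfolding T_def by blast
    from less.hyps[OF this] s(2) obtain x' where x': "\<forall>i\<in>S. 0 \<le> x' i"
      "(\<Sum>i\<in>S. x' i *\<^sub>R F i) = (\<Sum>i\<in>S. ?y i *\<^sub>R F i)"
      "(\<Sum>i\<in>S. x' i * c i) \<le> (\<Sum>i\<in>S. ?y i * c i)" "card {i \<in> S. x' i \<noteq> 0} \<le> DIM('e)"
      by blast
    have "(\<Sum>i\<in>S. ?y i *\<^sub>R F i) = (\<Sum>i\<in>S. x i *\<^sub>R F i) + s *\<^sub>R (\<Sum>i\<in>S. v i *\<^sub>R F i)"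
      by (simp add: scaleR_add_left sum.distrib scaleR_sum_right)
    moreover have "(\<Sum>i\<in>S. ?y i * c i) = (\<Sum>i\<in>S. x i * c i) + s * (\<Sum>i\<in>S. v i * c i)"
      by (simp add: algebra_simps sum.distrib sum_distrib_left)
    moreover have "s * (\<Sum>i\<in>S. v i * c i) \<le> 0" using s(1) vc by (simp add: mult_nonneg_nonpos)
    ultimately show ?thesis using x' vF by (intro exI[of _ x']) auto
  qed
qed

section \<open>Densities with kernels on arbitrary index sets\<close>

definition prob :: "'i set \<Rightarrow> ('i \<Rightarrow> real) \<Rightarrow> bool" where
  "prob I x \<longleftrightarrow> finite I \<and> (\<forall>i\<in>I. 0 \<le> x i) \<and> sum x I = 1"

text \<open>Adjacency is a real kernel, so that 0-1 and fractional adjacencies share one notation.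
  The classes have separate index types, so that vertices can later be replaced by pairs of subsets
  or by elements of a sum type without renaming.\<close>

definition dens :: "'i set \<Rightarrow> 'j set \<Rightarrow> ('i \<Rightarrow> real) \<Rightarrow> ('j \<Rightarrow> real) \<Rightarrow> ('i \<Rightarrow> 'j \<Rightarrow> real) \<Rightarrow> real" where
  "dens I J x y p = (\<Sum>i\<in>I. \<Sum>j\<in>J. x i * y j * p i j)"

definition tdens :: "'i set \<Rightarrow> 'j set \<Rightarrow> 'k set \<Rightarrow> ('i \<Rightarrow> real) \<Rightarrow> ('j \<Rightarrow> real) \<Rightarrow> ('k \<Rightarrow> real) \<Rightarrow>
    ('i \<Rightarrow> 'j \<Rightarrow> real) \<Rightarrow> ('i \<Rightarrow> 'k \<Rightarrow> real) \<Rightarrow> ('j \<Rightarrow> 'k \<Rightarrow> real) \<Rightarrow> real" where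
  "tdens I J K x y z p q r =
    (\<Sum>i\<in>I. \<Sum>j\<in>J. \<Sum>k\<in>K. x i * y j * z k * (p i j * q i k * r j k))"

abbreviation ind :: "('i \<Rightarrow> 'j \<Rightarrow> bool) \<Rightarrow> 'i \<Rightarrow> 'j \<Rightarrow> real" where
  "ind P \<equiv> \<lambda>i j. of_bool (P i j)"

abbreviation adj :: "'a tripartition_graph \<Rightarrow> 'a \<Rightarrow> 'a \<Rightarrow> bool" where
  "adj G \<equiv> \<lambda>u v. {u, v} \<in> edges G"

lemma dens_filter:
  assumes "finite B" "finite C"
  shows "(\<Sum>(b, c) \<in> {(b, c) \<in> B \<times> C. E b c}. w b * w c) = dens B C w w (ind E)"
proof -
  have "(\<Sum>(b, c) \<in> {(b, c) \<in> B \<times> C. E b c}. w b * w c) =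
      (\<Sum>(b, c) \<in> B \<times> C. w b * w c * of_bool (E b c))"
    using assms by (intro sum.mono_neutral_cong_left) auto
  then show ?thesis by (simp add: dens_def sum.cartesian_product)
qed

lemma tripartite_finite:
  assumes "tripartite G"
  shows "finite (cls_A G)" "finite (cls_B G)" "finite (cls_C G)"
  using assms by (auto simp: tripartite_def verts_def)

lemma densities_eq_dens:
  assumes "tripartite G"
  shows "alpha_density (G, w) = dens (cls_B G) (cls_C G) w w (ind (adj G))"
    "beta_density (G, w) = dens (cls_A G) (cls_C G) w w (ind (adj G))"
    "gamma_density (G, w) = dens (cls_A G) (cls_B G) w w (ind (adj G))"
  using tripartite_finite[OF assms]
  by (simp_all only: alpha_density_def beta_density_def gamma_density_def prod.case dens_filter)

lemma triangle_density_eq_tdens: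
  assumes "tripartite G"
  shows "triangle_density (G, w) =
    tdens (cls_A G) (cls_B G) (cls_C G) w w w (ind (adj G)) (ind (adj G)) (ind (adj G))"
proof -
  let ?A = "cls_A G" and ?B = "cls_B G" and ?C = "cls_C G"
  have "triangle_density (G, w) = (\<Sum>(a, b, c) \<in> ?A \<times> ?B \<times> ?C.
      w a * w b * w c * (ind (adj G) a b * ind (adj G) a c * ind (adj G) b c))"
    unfolding triangle_density_def prod.case using tripartite_finite[OF assms]
    by (intro sum.mono_neutral_cong_left) auto
  then show ?thesis by (simp add: tdens_def sum.cartesian_product)
qed

lemma dens_reindex:
  assumes "inj_on f I" "inj_on g J"
  shows "dens (f ` I) (g ` J) x y p = dens I J (x \<circ> f) (y \<circ> g) (\<lambda>i j. p (f i) (g j))"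
  using assms by (simp add: dens_def sum.reindex)

lemma tdens_reindex:
  assumes "inj_on f I" "inj_on g J" "inj_on h K"
  shows "tdens (f ` I) (g ` J) (h ` K) x y z p q r =
    tdens I J K (x \<circ> f) (y \<circ> g) (z \<circ> h) (\<lambda>i j. p (f i) (g j)) (\<lambda>i k. q (f i) (h k)) (\<lambda>j k. r (g j) (h k))"
  using assms by (simp add: tdens_def sum.reindex)

lemma dens_cong:
  assumes "\<And>i. i \<in> I \<Longrightarrow> x i = x' i" "\<And>j. j \<in> J \<Longrightarrow> y j = y' j" "\<And>i j. i \<in> I \<Longrightarrow> j \<in> J \<Longrightarrow> p i j = p' i j"
  shows "dens I J x y p = dens I J x' y' p'"
  using assms by (simp add: dens_def)

lemma tdens_cong:
  assumes "\<And>i. i \<in> I \<Longrightarrow> x i = x' i" "\<And>j. j \<in> J \<Longrightarrow> y j = y' j" "\<And>k. k \<in> K \<Longrightarrow> z k = z' k"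
    "\<And>i j. i \<in> I \<Longrightarrow> j \<in> J \<Longrightarrow> p i j = p' i j" "\<And>i k. i \<in> I \<Longrightarrow> k \<in> K \<Longrightarrow> q i k = q' i k"
    "\<And>j k. j \<in> J \<Longrightarrow> k \<in> K \<Longrightarrow> r j k = r' j k"
  shows "tdens I J K x y z p q r = tdens I J K x' y' z' p' q' r'"
  using assms by (simp add: tdens_def)

lemma prob_le_1: "prob I x \<Longrightarrow> i \<in> I \<Longrightarrow> x i \<le> 1"
  using member_le_sum[of i I x] by (simp add: prob_def)

text \<open>Transport to the vertex type over which \<open>T_min\<close> and
  \<open>vertex_minimal\<close> quantify: the disjoint sum of the index sets is finite and so
  injects into \<open>nat\<close>.\<close>

lemma realise:
  fixes I :: "'i set" and J :: "'j set" and K :: "'k set"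
  assumes "prob I x" "prob J y" "prob K z"
  shows "\<exists>(G :: nat tripartition_graph) w.
    (G, w) \<in> Tri (dens J K y z (ind R)) (dens I K x z (ind Q)) (dens I J x y (ind P)) \<and>
    triangle_density (G, w) = tdens I J K x y z (ind P) (ind Q) (ind R) \<and>
    card (verts G) = card I + card J + card K"
proof -
  let ?U = "Inl ` I \<union> Inr ` Inl ` J \<union> Inr ` Inr ` K :: ('i + 'j + 'k) set"
  have fin: "finite I" "finite J" "finite K" using assms by (auto simp: prob_def)
  have ne: "I \<noteq> {}" "J \<noteq> {}" "K \<noteq> {}" using assms by (auto simp: prob_def)
  have "finite ?U" using fin by blast
  then obtain F :: "'i + 'j + 'k \<Rightarrow> nat" where F: "inj_on F ?U"
    using finite_imp_inj_to_nat_seg by metis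
  define f where "f = F \<circ> Inl"
  define g where "g = F \<circ> Inr \<circ> Inl"
  define h where "h = F \<circ> Inr \<circ> Inr"
  have F_iff: "F u = F v \<longleftrightarrow> u = v" if "u \<in> ?U" "v \<in> ?U" for u v
    using F that by (rule inj_on_eq_iff)
  have f: "f i = f i' \<longleftrightarrow> i = i'" if "i \<in> I" "i' \<in> I" for i i'
    using F_iff[of "Inl i" "Inl i'"] that by (simp add: f_def)
  have g: "g j = g j' \<longleftrightarrow> j = j'" if "j \<in> J" "j' \<in> J" for j j'
    using F_iff[of "Inr (Inl j)" "Inr (Inl j')"] that by (simp add: g_def)
  have h: "h k = h k' \<longleftrightarrow> k = k'" if "k \<in> K" "k' \<in> K" for k k'
    using F_iff[of "Inr (Inr k)" "Inr (Inr k')"] that by (simp add: h_def)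
  have fg: "f i \<noteq> g j" "g j \<noteq> f i" if "i \<in> I" "j \<in> J" for i j
    using F_iff[of "Inl i" "Inr (Inl j)"] that by (auto simp: f_def g_def)
  have fh: "f i \<noteq> h k" "h k \<noteq> f i" if "i \<in> I" "k \<in> K" for i k
    using F_iff[of "Inl i" "Inr (Inr k)"] that by (auto simp: f_def h_def)
  have gh: "g j \<noteq> h k" "h k \<noteq> g j" if "j \<in> J" "k \<in> K" for j k
    using F_iff[of "Inr (Inl j)" "Inr (Inr k)"] that by (auto simp: g_def h_def)
  have injs: "inj_on f I" "inj_on g J" "inj_on h K" by (simp_all add: inj_on_def f g h)
  have disj: "f ` I \<inter> g ` J = {}" "f ` I \<inter> h ` K = {}" "g ` J \<inter> h ` K = {}"
    using fg fh gh by auto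
  define w where "w n = (if n \<in> f ` I then x (the_inv_into I f n)
    else if n \<in> g ` J then y (the_inv_into J g n) else z (the_inv_into K h n))" for n
  have w: "i \<in> I \<Longrightarrow> w (f i) = x i" "j \<in> J \<Longrightarrow> w (g j) = y j" "k \<in> K \<Longrightarrow> w (h k) = z k" for i j k
    using injs disj by (auto simp: w_def the_inv_into_f_f)
  define G where "G = \<lparr>cls_A = f ` I, cls_B = g ` J, cls_C = h ` K,
    edges = {{f i, g j} |i j. i \<in> I \<and> j \<in> J \<and> P i j} \<union> {{f i, h k} |i k. i \<in> I \<and> k \<in> K \<and> Q i k} \<union>
      {{g j, h k} |j k. j \<in> J \<and> k \<in> K \<and> R j k}\<rparr>"
  have sel: "cls_A G = f ` I" "cls_B G = g ` J" "cls_C G = h ` K" by (simp_all add: G_def)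
  have "tripartite G"
    unfolding tripartite_def independent_def
  proof (intro conjI)
    show "edges G \<subseteq> {e. e \<subseteq> verts G \<and> card e = 2}"
      by (auto simp: G_def verts_def card_insert_if fg fh gh)
    show "\<forall>u\<in>cls_A G. \<forall>v\<in>cls_A G. {u, v} \<notin> edges G"
      by (auto simp: G_def doubleton_eq_iff fg fh gh)
    show "\<forall>u\<in>cls_B G. \<forall>v\<in>cls_B G. {u, v} \<notin> edges G"
      by (auto simp: G_def doubleton_eq_iff fg fh gh)
    show "\<forall>u\<in>cls_C G. \<forall>v\<in>cls_C G. {u, v} \<notin> edges G"
      by (auto simp: G_def doubleton_eq_iff fg fh gh)
  qed (use fin ne disj in \<open>auto simp: sel verts_def\<close>)
  have adj: "i \<in> I \<Longrightarrow> j \<in> J \<Longrightarrow> adj G (f i) (g j) \<longleftrightarrow> P i j"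
    "i \<in> I \<Longrightarrow> k \<in> K \<Longrightarrow> adj G (f i) (h k) \<longleftrightarrow> Q i k"
    "j \<in> J \<Longrightarrow> k \<in> K \<Longrightarrow> adj G (g j) (h k) \<longleftrightarrow> R j k" for i j k
    by (auto simp: G_def doubleton_eq_iff f g h fg fh gh)
  have "weighted_tripartite (G, w)"
    unfolding weighted_tripartite_def prod.case sel
  proof (intro conjI)
    show "\<forall>v\<in>verts G. w v \<in> {0..1}"
      using assms prob_le_1[OF assms(1)] prob_le_1[OF assms(2)] prob_le_1[OF assms(3)]
      by (auto simp: verts_def sel w prob_def)
  qed (use \<open>tripartite G\<close> assms injs in \<open>simp_all add: sum.reindex w prob_def\<close>)
  moreover have "alpha_density (G, w) = dens J K y z (ind R)" "beta_density (G, w) = dens I K x z (ind Q)"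
    "gamma_density (G, w) = dens I J x y (ind P)"
    unfolding densities_eq_dens[OF \<open>tripartite G\<close>] sel
      dens_reindex[OF injs(2,3)] dens_reindex[OF injs(1,3)] dens_reindex[OF injs(1,2)]
    by (rule dens_cong; simp add: w adj)+
  moreover have "triangle_density (G, w) = tdens I J K x y z (ind P) (ind Q) (ind R)"
    unfolding triangle_density_eq_tdens[OF \<open>tripartite G\<close>] sel tdens_reindex[OF injs]
    by (rule tdens_cong; simp add: w adj)
  moreover have "card (verts G) = card I + card J + card K"
    unfolding verts_def sel using fin injs disj by (simp add: card_Un_disjoint card_image Int_Un_distrib2)
  ultimately show ?thesis unfolding Tri_def by blast
qed

subsection \<open>Realising fractional adjacencies\<close>

text \<open>These simp rules would turn sums with \<open>of_bool\<close> factors into sums over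
  filtered index sets, and the densities would lose the shape shared with general kernels.\<close>

declare sum_mult_of_bool_eq [simp del] sum_of_bool_mult_eq [simp del]

lemma dens_eq: "dens I J x y p = (\<Sum>i\<in>I. x i * (\<Sum>j\<in>J. y j * p i j))"
  by (simp add: dens_def sum_distrib_left mult.assoc)

lemma dens_eq': "dens I J x y p = (\<Sum>j\<in>J. y j * (\<Sum>i\<in>I. x i * p i j))"
  unfolding dens_def by (subst sum.swap) (simp add: sum_distrib_left mult_ac)

lemma tdens_eq:
  "tdens I J K x y z p q r = (\<Sum>i\<in>I. x i * (\<Sum>j\<in>J. \<Sum>k\<in>K. y j * z k * (p i j * q i k * r j k)))"
  by (simp add: tdens_def sum_distrib_left mult.assoc)

text \<open>The first class enters only through the weighted number of common neighbours of each
  pair \<open>(j, k)\<close>, so it may be exchanged for any class with the same numbers.\<close>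

lemma tdens_eq':
  "tdens I J K x y z p q r = (\<Sum>j\<in>J. \<Sum>k\<in>K. y j * z k * r j k * (\<Sum>i\<in>I. x i * (p i j * q i k)))"
proof -
  have "tdens I J K x y z p q r = (\<Sum>j\<in>J. \<Sum>i\<in>I. \<Sum>k\<in>K. x i * y j * z k * (p i j * q i k * r j k))"
    unfolding tdens_def by (rule sum.swap)
  also have "\<dots> = (\<Sum>j\<in>J. \<Sum>k\<in>K. \<Sum>i\<in>I. x i * y j * z k * (p i j * q i k * r j k))"
    by (intro sum.cong refl sum.swap)
  finally show ?thesis by (simp add: sum_distrib_left mult_ac)
qed

lemma sum_Times_product:
  fixes f :: "'a \<Rightarrow> real"
  shows "(\<Sum>s\<in>A \<times> B. f (fst s) * g (snd s)) = sum f A * sum g B"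
  by (simp add: sum_product sum.cartesian_product case_prod_beta)

text \<open>The probability of drawing exactly \<open>X\<close> when each \<open>j\<close> is chosen
  independently with probability \<open>f j\<close>.\<close>

definition random_subset :: "'j set \<Rightarrow> ('j \<Rightarrow> real) \<Rightarrow> 'j set \<Rightarrow> real" where
  "random_subset J f X = (\<Prod>j\<in>X. f j) * (\<Prod>j\<in>J - X. 1 - f j)"

lemma random_subset_sum:
  assumes "finite J"
  shows "(\<Sum>X\<in>Pow J. random_subset J f X) = 1"
  using prod_add[OF assms, of f "\<lambda>j. 1 - f j"] by (simp add: random_subset_def)

lemma random_subset_mem:
  assumes "finite J" "j \<in> J"
  shows "(\<Sum>X\<in>Pow J. random_subset J f X * of_bool (j \<in> X)) = f j"
proof -
  \<comment> \<open>Putting 0 in place of \<open>1 - f j\<close> removes the sets that avoid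
    \<open>j\<close>, so the sum over all subsets factors again.\<close>
  let ?g = "\<lambda>k. if k = j then 0 else 1 - f k"
  have "random_subset J f X * of_bool (j \<in> X) = (\<Prod>k\<in>X. f k) * (\<Prod>k\<in>J - X. ?g k)" if "X \<in> Pow J" for X
  proof (cases "j \<in> X")
    case True
    then have "(\<Prod>k\<in>J - X. ?g k) = (\<Prod>k\<in>J - X. 1 - f k)" by (intro prod.cong) auto
    then show ?thesis using True by (simp add: random_subset_def)
  next
    case False
    then have "(\<Prod>k\<in>J - X. ?g k) = 0" using assms by (intro prod_zero) auto
    then show ?thesis using False by simp
  qed
  then have "(\<Sum>X\<in>Pow J. random_subset J f X * of_bool (j \<in> X)) = (\<Prod>k\<in>J. f k + ?g k)"
    using prod_add[OF assms(1), of f ?g] by simp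
  also have "\<dots> = (\<Prod>k\<in>J. if k = j then f j else 1)" by (intro prod.cong) auto
  finally show ?thesis using assms by simp
qed

lemma random_subset_nonneg:
  assumes "\<And>j. j \<in> J \<Longrightarrow> 0 \<le> f j \<and> f j \<le> 1" "X \<subseteq> J"
  shows "0 \<le> random_subset J f X"
  using assms unfolding random_subset_def by (intro mult_nonneg_nonneg prod_nonneg) auto

text \<open>Fractional adjacencies of the first class are simulated by splitting each of its vertices
  into independent random neighbourhoods in the other two classes.\<close>

lemma random_neighbourhoods:
  fixes p :: "'i \<Rightarrow> 'j \<Rightarrow> real" and q :: "'i \<Rightarrow> 'k \<Rightarrow> real"
  assumes I: "prob I x" and fin: "finite J" "finite K"
    and p: "\<And>i j. i \<in> I \<Longrightarrow> j \<in> J \<Longrightarrow> 0 \<le> p i j \<and> p i j \<le> 1"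
    and q: "\<And>i k. i \<in> I \<Longrightarrow> k \<in> K \<Longrightarrow> 0 \<le> q i k \<and> q i k \<le> 1"
  obtains u :: "'j set \<times> 'k set \<Rightarrow> real" where "prob (Pow J \<times> Pow K) u"
    "\<And>j. j \<in> J \<Longrightarrow> (\<Sum>s\<in>Pow J \<times> Pow K. u s * of_bool (j \<in> fst s)) = (\<Sum>i\<in>I. x i * p i j)"
    "\<And>k. k \<in> K \<Longrightarrow> (\<Sum>s\<in>Pow J \<times> Pow K. u s * of_bool (k \<in> snd s)) = (\<Sum>i\<in>I. x i * q i k)"
    "\<And>j k. j \<in> J \<Longrightarrow> k \<in> K \<Longrightarrow>
      (\<Sum>s\<in>Pow J \<times> Pow K. u s * (of_bool (j \<in> fst s) * of_bool (k \<in> snd s))) = (\<Sum>i\<in>I. x i * (p i j * q i k))"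
proof -
  \<comment> \<open>A mixture over \<open>i\<close> of product distributions. Given
    \<open>i\<close>, the two neighbourhoods are independent, so a pair \<open>(j, k)\<close> is hit
    with probability \<open>p i j * q i k\<close>, as the triangle density requires.\<close>
  define u where "u s = (\<Sum>i\<in>I. x i * (random_subset J (p i) (fst s) * random_subset K (q i) (snd s)))" for s
  have sum_u: "(\<Sum>s\<in>Pow J \<times> Pow K. u s * (f (fst s) * g (snd s))) =
      (\<Sum>i\<in>I. x i * ((\<Sum>X\<in>Pow J. random_subset J (p i) X * f X) * (\<Sum>Y\<in>Pow K. random_subset K (q i) Y * g Y)))"
    for f :: "'j set \<Rightarrow> real" and g :: "'k set \<Rightarrow> real"
  proof -
    have "(\<Sum>s\<in>Pow J \<times> Pow K. u s * (f (fst s) * g (snd s))) =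
        (\<Sum>s\<in>Pow J \<times> Pow K. \<Sum>i\<in>I. x i * (random_subset J (p i) (fst s) * f (fst s) * (random_subset K (q i) (snd s) * g (snd s))))"
      by (simp add: u_def sum_distrib_right sum_distrib_left mult_ac)
    also have "\<dots> = (\<Sum>i\<in>I. \<Sum>s\<in>Pow J \<times> Pow K. x i * (random_subset J (p i) (fst s) * f (fst s) * (random_subset K (q i) (snd s) * g (snd s))))"
      by (rule sum.swap)
    also have "\<dots> = (\<Sum>i\<in>I. x i * ((\<Sum>X\<in>Pow J. random_subset J (p i) X * f X) * (\<Sum>Y\<in>Pow K. random_subset K (q i) Y * g Y)))"
      unfolding sum_distrib_left[symmetric]
      using sum_Times_product[of "\<lambda>X. random_subset J (p _) X * f X" "\<lambda>Y. random_subset K (q _) Y * g Y"]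
      by (intro sum.cong refl) simp
    finally show ?thesis .
  qed
  show thesis
  proof (rule that[of u])
    have "0 \<le> u s" if "s \<in> Pow J \<times> Pow K" for s
      unfolding u_def using that I p q
      by (intro sum_nonneg mult_nonneg_nonneg random_subset_nonneg) (auto simp: prob_def)
    moreover have "sum u (Pow J \<times> Pow K) = 1"
      using sum_u[of "\<lambda>_. 1" "\<lambda>_. 1"] I fin by (simp add: random_subset_sum prob_def)
    ultimately show "prob (Pow J \<times> Pow K) u" using fin by (simp add: prob_def)
  next
    fix j assume "j \<in> J"
    then show "(\<Sum>s\<in>Pow J \<times> Pow K. u s * of_bool (j \<in> fst s)) = (\<Sum>i\<in>I. x i * p i j)"
      using sum_u[of "\<lambda>X. of_bool (j \<in> X)" "\<lambda>_. 1"] fin by (simp add: random_subset_sum random_subset_mem)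
  next
    fix k assume "k \<in> K"
    then show "(\<Sum>s\<in>Pow J \<times> Pow K. u s * of_bool (k \<in> snd s)) = (\<Sum>i\<in>I. x i * q i k)"
      using sum_u[of "\<lambda>_. 1" "\<lambda>Y. of_bool (k \<in> Y)"] fin by (simp add: random_subset_sum random_subset_mem)
  next
    fix j k assume "j \<in> J" "k \<in> K"
    then show "(\<Sum>s\<in>Pow J \<times> Pow K. u s * (of_bool (j \<in> fst s) * of_bool (k \<in> snd s))) = (\<Sum>i\<in>I. x i * (p i j * q i k))"
      using sum_u[of "\<lambda>X. of_bool (j \<in> X)" "\<lambda>Y. of_bool (k \<in> Y)"] fin by (simp add: random_subset_mem)
  qed
qed

text \<open>Splitting into random neighbourhoods creates exponentially many vertices; the linear
  program cuts them back to three. Its constraints are total weight, \<open>\<gamma>\<close> and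
  \<open>\<beta>\<close>, and its cost is the triangle density. The kernel \<open>R\<close> does not
  involve the first class and stays 0-1.\<close>

lemma realise_fractional:
  fixes I :: "'i set" and J :: "'j set" and K :: "'k set"
  assumes I: "prob I x" and J: "prob J y" and K: "prob K z"
    and p: "\<And>i j. i \<in> I \<Longrightarrow> j \<in> J \<Longrightarrow> 0 \<le> p i j \<and> p i j \<le> 1"
    and q: "\<And>i k. i \<in> I \<Longrightarrow> k \<in> K \<Longrightarrow> 0 \<le> q i k \<and> q i k \<le> 1"
  shows "\<exists>(G :: nat tripartition_graph) w.
    (G, w) \<in> Tri (dens J K y z (ind R)) (dens I K x z q) (dens I J x y p) \<and>
    triangle_density (G, w) \<le> tdens I J K x y z p q (ind R) \<and>
    card (verts G) \<le> 3 + card J + card K"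
proof -
  let ?T = "Pow J \<times> Pow K"
  let ?P = "\<lambda>(s :: 'j set \<times> 'k set) j. j \<in> fst s" and ?Q = "\<lambda>(s :: 'j set \<times> 'k set) k. k \<in> snd s"
  have fin: "finite J" "finite K" using J K by (auto simp: prob_def)
  obtain u where u: "prob ?T u"
    "\<And>j. j \<in> J \<Longrightarrow> (\<Sum>s\<in>?T. u s * ind ?P s j) = (\<Sum>i\<in>I. x i * p i j)"
    "\<And>k. k \<in> K \<Longrightarrow> (\<Sum>s\<in>?T. u s * ind ?Q s k) = (\<Sum>i\<in>I. x i * q i k)"
    "\<And>j k. j \<in> J \<Longrightarrow> k \<in> K \<Longrightarrow> (\<Sum>s\<in>?T. u s * (ind ?P s j * ind ?Q s k)) = (\<Sum>i\<in>I. x i * (p i j * q i k))"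
    by (rule random_neighbourhoods[OF I fin p q]) blast+
  have finT: "finite ?T" using fin by simp
  have du: "dens ?T J u y (ind ?P) = dens I J x y p" "dens ?T K u z (ind ?Q) = dens I K x z q"
    "tdens ?T J K u y z (ind ?P) (ind ?Q) (ind R) = tdens I J K x y z p q (ind R)"
    using u by (simp_all add: dens_eq' tdens_eq')
  define F where "F s = (1::real, \<Sum>j\<in>J. y j * ind ?P s j, \<Sum>k\<in>K. z k * ind ?Q s k)" for s
  define c where "c s = (\<Sum>j\<in>J. \<Sum>k\<in>K. y j * z k * (ind ?P s j * ind ?Q s k * ind R j k))" for s
  have F: "(\<Sum>s\<in>S. v s *\<^sub>R F s) = (sum v S, dens S J v y (ind ?P), dens S K v z (ind ?Q))" for v S
    by (simp add: F_def dens_eq sum_prod scaleR_conv_of_real)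
  have c: "(\<Sum>s\<in>S. v s * c s) = tdens S J K v y z (ind ?P) (ind ?Q) (ind R)" for v S
    by (simp add: c_def tdens_eq)
  have "\<And>s. s \<in> ?T \<Longrightarrow> 0 \<le> u s" using u(1) by (auto simp: prob_def)
  then obtain v where v: "\<forall>s\<in>?T. 0 \<le> v s" "(\<Sum>s\<in>?T. v s *\<^sub>R F s) = (\<Sum>s\<in>?T. u s *\<^sub>R F s)"
    "(\<Sum>s\<in>?T. v s * c s) \<le> (\<Sum>s\<in>?T. u s * c s)" "card {s \<in> ?T. v s \<noteq> 0} \<le> DIM(real \<times> real \<times> real)"
    using reduce_support[OF finT, of u F "(1, 0, 0)" c] by (auto simp: F_def)
  let ?S = "{s \<in> ?T. v s \<noteq> 0}"
  have restrict: "(\<Sum>s\<in>?S. v s * f s) = (\<Sum>s\<in>?T. v s * f s)" for f :: "_ \<Rightarrow> real"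
    using finT by (intro sum.mono_neutral_left) auto
  have "sum v ?S = sum v ?T" using restrict[of "\<lambda>_. 1"] by simp
  then have vS: "prob ?S v" using v F[of v ?T] F[of u ?T] u(1) finT by (auto simp: prob_def)
  have "dens ?S J v y (ind ?P) = dens I J x y p" "dens ?S K v z (ind ?Q) = dens I K x z q"
    using v(2) F[of v ?T] F[of u ?T] du restrict by (simp_all add: dens_eq)
  moreover have "tdens ?S J K v y z (ind ?P) (ind ?Q) (ind R) \<le> tdens I J K x y z p q (ind R)"
    using v(3) unfolding c du(3) by (simp add: tdens_eq restrict)
  ultimately show ?thesis
    using realise[OF vS J K, of R ?Q ?P] v(4) by fastforce
qed

lemma triangle_density_nonneg:
  assumes "(G, w) \<in> Tri \<alpha> \<beta> \<gamma>"
  shows "0 \<le> triangle_density (G, w)"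
  using assms unfolding triangle_density_def prod.case
  by (intro sum_nonneg) (auto simp: Tri_def weighted_tripartite_def verts_def)

lemma T_min_le_triangle_density:
  fixes G :: "nat tripartition_graph"
  assumes "(G, w) \<in> Tri \<alpha> \<beta> \<gamma>"
  shows "T_min \<alpha> \<beta> \<gamma> \<le> triangle_density (G, w)"
  unfolding T_min_def
proof (rule cINF_lower[OF _ assms])
  show "bdd_below (triangle_density ` (Tri \<alpha> \<beta> \<gamma> :: nat wgraph set))"
    using triangle_density_nonneg by (intro bdd_belowI[of _ 0]) force
qed

lemma T_min_le_tdens:
  assumes "prob I x" "prob J y" "prob K z"
    "\<And>i j. i \<in> I \<Longrightarrow> j \<in> J \<Longrightarrow> 0 \<le> p i j \<and> p i j \<le> 1" "\<And>i k. i \<in> I \<Longrightarrow> k \<in> K \<Longrightarrow> 0 \<le> q i k \<and> q i k \<le> 1"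
  shows "T_min (dens J K y z (ind R)) (dens I K x z q) (dens I J x y p) \<le> tdens I J K x y z p q (ind R)"
proof -
  obtain G :: "nat tripartition_graph" and w where
    "(G, w) \<in> Tri (dens J K y z (ind R)) (dens I K x z q) (dens I J x y p)"
    "triangle_density (G, w) \<le> tdens I J K x y z p q (ind R)"
    using realise_fractional[of I x J y K z p q R] assms by blast
  then show ?thesis using T_min_le_triangle_density by fastforce
qed

section \<open>Symmetry under exchanging classes\<close>

definition swap_AB :: "'a tripartition_graph \<Rightarrow> 'a tripartition_graph" where
  "swap_AB G = \<lparr>cls_A = cls_B G, cls_B = cls_A G, cls_C = cls_C G, edges = edges G\<rparr>"

definition swap_BC :: "'a tripartition_graph \<Rightarrow> 'a tripartition_graph" where
  "swap_BC G = \<lparr>cls_A = cls_A G, cls_B = cls_C G, cls_C = cls_B G, edges = edges G\<rparr>"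

lemma verts_swap: "verts (swap_AB G) = verts G" "verts (swap_BC G) = verts G"
  by (auto simp: verts_def swap_AB_def swap_BC_def)

lemma dens_swap: "dens I J x y p = dens J I y x (\<lambda>j i. p i j)"
  unfolding dens_def by (subst sum.swap) (simp add: mult_ac)

lemma tdens_swap_AB: "tdens I J K x y z p q r = tdens J I K y x z (\<lambda>j i. p i j) r q"
  unfolding tdens_def by (subst sum.swap) (simp add: mult_ac)

lemma tdens_swap_BC: "tdens I J K x y z p q r = tdens I K J x z y q p (\<lambda>k j. r j k)"
  unfolding tdens_def by (intro sum.cong refl, subst sum.swap) (simp add: mult_ac)

lemma tripartite_swap:
  assumes "tripartite G"
  shows "tripartite (swap_AB G)" "tripartite (swap_BC G)"
  using assms unfolding tripartite_def verts_swap by (auto simp: swap_AB_def swap_BC_def)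

lemma triangle_density_swap:
  assumes "tripartite G"
  shows "triangle_density (swap_AB G, w) = triangle_density (G, w)"
    "triangle_density (swap_BC G, w) = triangle_density (G, w)"
proof -
  let ?t = "\<lambda>A B C. tdens A B C w w w (ind (adj G)) (ind (adj G)) (ind (adj G))"
  have "?t (cls_A G) (cls_B G) (cls_C G) = ?t (cls_B G) (cls_A G) (cls_C G)"
    "?t (cls_A G) (cls_B G) (cls_C G) = ?t (cls_A G) (cls_C G) (cls_B G)"
    using tdens_swap_AB[of "cls_A G" "cls_B G" "cls_C G" w w w "ind (adj G)" "ind (adj G)" "ind (adj G)"]
      tdens_swap_BC[of "cls_A G" "cls_B G" "cls_C G" w w w "ind (adj G)" "ind (adj G)" "ind (adj G)"]
    by (simp_all add: insert_commute)
  then show "triangle_density (swap_AB G, w) = triangle_density (G, w)"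
    "triangle_density (swap_BC G, w) = triangle_density (G, w)"
    using triangle_density_eq_tdens[OF assms] tripartite_swap[OF assms, THEN triangle_density_eq_tdens]
    by (simp_all add: swap_AB_def swap_BC_def)
qed

lemma Tri_swap:
  assumes "(G, w) \<in> Tri \<alpha> \<beta> \<gamma>"
  shows "(swap_AB G, w) \<in> Tri \<beta> \<alpha> \<gamma>" "(swap_BC G, w) \<in> Tri \<alpha> \<gamma> \<beta>"
proof -
  have tri: "tripartite G" using assms by (simp add: Tri_def weighted_tripartite_def)
  have "dens X Y w w (ind (adj G)) = dens Y X w w (ind (adj G))" for X Y
    using dens_swap[of X Y w w "ind (adj G)"] by (simp add: insert_commute)
  then show "(swap_AB G, w) \<in> Tri \<beta> \<alpha> \<gamma>" "(swap_BC G, w) \<in> Tri \<alpha> \<gamma> \<beta>"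
    using assms tripartite_swap[OF tri] densities_eq_dens[OF tri]
      densities_eq_dens[OF tripartite_swap(1)[OF tri]] densities_eq_dens[OF tripartite_swap(2)[OF tri]]
    by (auto simp: Tri_def weighted_tripartite_def verts_swap) (auto simp: swap_AB_def swap_BC_def)
qed

lemma T_min_swap: "T_min \<beta> \<alpha> \<gamma> = T_min \<alpha> \<beta> \<gamma>" "T_min \<alpha> \<gamma> \<beta> = T_min \<alpha> \<beta> \<gamma>"
proof -
  have AB: "triangle_density ` (Tri \<alpha> \<beta> \<gamma> :: nat wgraph set) \<subseteq> triangle_density ` (Tri \<beta> \<alpha> \<gamma> :: nat wgraph set)" for \<alpha> \<beta> \<gamma>
  proof
    fix t assume "t \<in> triangle_density ` (Tri \<alpha> \<beta> \<gamma> :: nat wgraph set)"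
    then obtain G :: "nat tripartition_graph" and w where G: "(G, w) \<in> Tri \<alpha> \<beta> \<gamma>" "t = triangle_density (G, w)" by auto
    then have "tripartite G" by (simp add: Tri_def weighted_tripartite_def)
    then have "t = triangle_density (swap_AB G, w)" using G(2) by (simp add: triangle_density_swap)
    then show "t \<in> triangle_density ` (Tri \<beta> \<alpha> \<gamma> :: nat wgraph set)" using Tri_swap(1)[OF G(1)] by (rule image_eqI)
  qed
  have BC: "triangle_density ` (Tri \<alpha> \<beta> \<gamma> :: nat wgraph set) \<subseteq> triangle_density ` (Tri \<alpha> \<gamma> \<beta> :: nat wgraph set)" for \<alpha> \<beta> \<gamma>
  proof
    fix t assume "t \<in> triangle_density ` (Tri \<alpha> \<beta> \<gamma> :: nat wgraph set)"
    then obtain G :: "nat tripartition_graph" and w where G: "(G, w) \<in> Tri \<alpha> \<beta> \<gamma>" "t = triangle_density (G, w)" by auto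
    then have "tripartite G" by (simp add: Tri_def weighted_tripartite_def)
    then have "t = triangle_density (swap_BC G, w)" using G(2) by (simp add: triangle_density_swap)
    then show "t \<in> triangle_density ` (Tri \<alpha> \<gamma> \<beta> :: nat wgraph set)" using Tri_swap(2)[OF G(1)] by (rule image_eqI)
  qed
  show "T_min \<beta> \<alpha> \<gamma> = T_min \<alpha> \<beta> \<gamma>" "T_min \<alpha> \<gamma> \<beta> = T_min \<alpha> \<beta> \<gamma>"
    unfolding T_min_def
    using equalityI[OF AB AB, of \<beta> \<alpha> \<gamma>] equalityI[OF BC BC, of \<alpha> \<gamma> \<beta>] by simp_all
qed

subsection \<open>Bounds on densities\<close>

lemma triangle_free_real_aux1:
  fixes \<alpha> \<beta> \<gamma> p r x :: real
  assumes "0 < x" "x < 1" "0 \<le> p" "p \<le> 1" "0 \<le> r" "\<alpha> \<le> 1 - p * r" "\<gamma> = x * p" "\<beta> \<le> x * r + 1 - x"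
    and "1 < \<alpha> * \<gamma> + \<beta>" "1 < \<beta> * \<gamma> + \<alpha>"
  shows False
proof -
  have \<gamma>: "0 \<le> \<gamma>" using assms by simp
  \<comment> \<open>The two inequalities bound \<open>r\<close> from opposite sides: this one gives
    \<open>r > 1 / (1 + p)\<close>, hence \<open>r > 1/2\<close>, and the other gives
    \<open>r < x / (1 + x)\<close>, hence \<open>r < 1/2\<close>.\<close>
  have "1 < (1 - p * r) * (x * p) + (x * r + 1 - x)"
    using assms(8,9) mult_right_mono[OF assms(6) \<gamma>] unfolding assms(7) by linarith
  then have "0 < x * ((1 - p) * (r * (1 + p) - 1))" by (simp add: algebra_simps)
  then have "0 < (1 - p) * (r * (1 + p) - 1)" using assms(1) by (simp add: zero_less_mult_iff)
  then have "1 < r * (1 + p)" using assms by (simp add: zero_less_mult_iff)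
  moreover have "r * (1 + p) \<le> r * 2" using assms by (intro mult_left_mono) auto
  ultimately have r: "1 < 2 * r" by simp
  have "1 < (x * r + 1 - x) * (x * p) + (1 - p * r)"
    using assms(6,10) mult_right_mono[OF assms(8) \<gamma>] unfolding assms(7) by linarith
  then have "0 < p * ((1 - x) * (x - r * (1 + x)))" by (simp add: algebra_simps)
  then have "0 < (1 - x) * (x - r * (1 + x))" using assms(3) by (simp add: zero_less_mult_iff)
  then have "r * (1 + x) < x" using assms by (simp add: zero_less_mult_iff)
  moreover have "1 / 2 * (1 + x) \<le> r * (1 + x)" using r assms by (intro mult_right_mono) auto
  ultimately have "1 / 2 * (1 + x) < x" by linarith
  then show False using assms(2) by simp
qed

text \<open>Reduction to \<open>q = 0\<close> and \<open>s = 1\<close>: all of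
  \<open>\<gamma>\<close> is put on the first vertex, whose size becomes
  \<open>\<gamma> / x\<close>, at most 1. Because \<open>r < x * s\<close> this does not lower
  \<open>\<alpha>\<close>, and \<open>\<beta>\<close> can only grow.\<close>

lemma triangle_free_real_aux2:
  fixes \<alpha> \<beta> \<gamma> p q r s x :: real
  assumes "0 \<le> q" "q \<le> p" "p \<le> 1" "0 \<le> r" "r \<le> s" "s \<le> 1" "0 < x" "x < 1"
    and \<gamma>: "\<gamma> = x * p + (1 - x) * q" and \<beta>: "\<beta> = x * r + (1 - x) * s" and \<alpha>: "\<alpha> = 1 - p * r - q * s + q * r"
    and "1 < \<alpha> * \<gamma> + \<beta>" "1 < \<beta> * \<gamma> + \<alpha>" "r < x * s" "\<gamma> \<le> x"
  shows False
proof (rule triangle_free_real_aux1[of x "\<gamma> / x" r \<alpha> \<gamma> \<beta>])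
  have "q * r \<le> q * (x * s)" using assms by (intro mult_left_mono) auto
  then have "x * \<alpha> \<le> x - \<gamma> * r" unfolding \<alpha> \<gamma> by (simp add: algebra_simps)
  then show "\<alpha> \<le> 1 - \<gamma> / x * r" using assms(7) by (simp add: field_simps)
  have "(1 - x) * s \<le> (1 - x) * 1" using assms by (intro mult_left_mono) auto
  then show "\<beta> \<le> x * r + 1 - x" unfolding \<beta> by simp
  show "0 \<le> \<gamma> / x" unfolding \<gamma> using assms by simp
qed (use assms in auto)

lemma triangle_free_real_aux3:
  fixes u x \<beta> :: real
  assumes "0 < x" "x < 1" "u < 1" "0 \<le> u" "1 - x < u * \<beta>" "\<beta> = 1 - x * u"
  shows "1 < 2 * x"
proof -
  have "0 < (1 - u) * (x * (1 + u) - 1)" using assms by (simp add: algebra_simps)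
  then have "1 < x * (1 + u)" using assms by (simp add: zero_less_mult_iff)
  also have "\<dots> \<le> x * 2" using assms by (intro mult_left_mono) auto
  finally show ?thesis by simp
qed

text \<open>If \<open>r \<ge> x * s\<close> or \<open>q \<ge> (1 - x) * p\<close>, then
  \<open>\<alpha> \<le> 1 - \<beta> * \<gamma>\<close> at once. Otherwise the preceding reduction,
  applied from both sides, gives \<open>\<gamma> > x\<close> and \<open>\<beta> > 1 - x\<close>.
  Then \<open>\<alpha> \<le> u * v\<close>, and the two inequalities with a factor
  \<open>\<alpha>\<close> force both \<open>x\<close> and \<open>1 - x\<close> above 1/2.\<close>

lemma triangle_free_real:
  fixes \<alpha> \<beta> \<gamma> p q r s x :: real
  assumes "0 \<le> q" "q \<le> p" "p \<le> 1" "0 \<le> r" "r \<le> s" "s \<le> 1" "0 \<le> x" "x \<le> 1"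
    and \<gamma>: "\<gamma> = x * p + (1 - x) * q" and \<beta>: "\<beta> = x * r + (1 - x) * s" and \<alpha>: "\<alpha> = 1 - p * r - q * s + q * r"
    and R: "1 < \<alpha> * \<beta> + \<gamma>" "1 < \<alpha> * \<gamma> + \<beta>" "1 < \<beta> * \<gamma> + \<alpha>"
  shows False
proof -
  have nonneg: "0 \<le> \<gamma>" "0 \<le> \<beta>" using assms by simp_all
  have r: "r < x * s"
  proof (rule ccontr)
    assume "\<not> r < x * s"
    then have "x * s * (p - q) \<le> r * (p - q)" using assms by (intro mult_right_mono) auto
    then have "\<alpha> \<le> 1 - s * \<gamma>" unfolding \<alpha> \<gamma> by (simp add: algebra_simps)
    moreover have "x * r \<le> x * s" using assms by (intro mult_left_mono) auto
    then have "\<beta> \<le> s" unfolding \<beta> by (simp add: algebra_simps)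
    then have "\<beta> * \<gamma> \<le> s * \<gamma>" using nonneg by (intro mult_right_mono) auto
    ultimately show False using R by simp
  qed
  have q: "q < (1 - x) * p"
  proof (rule ccontr)
    assume "\<not> q < (1 - x) * p"
    then have "(1 - x) * p * (s - r) \<le> q * (s - r)" using assms by (intro mult_right_mono) auto
    then have "\<alpha> \<le> 1 - p * \<beta>" unfolding \<alpha> \<beta> by (simp add: algebra_simps)
    moreover have "(1 - x) * q \<le> (1 - x) * p" using assms by (intro mult_left_mono) auto
    then have "\<gamma> \<le> p" unfolding \<gamma> by (simp add: algebra_simps)
    then have "\<beta> * \<gamma> \<le> p * \<beta>" using nonneg by (subst mult.commute, intro mult_right_mono) auto
    ultimately show False using R by simp
  qed
  have x: "0 < x" "x < 1" using r q assms by (auto simp: less_le)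
  have "x < \<gamma>"
    using triangle_free_real_aux2[of q p r s x \<gamma> \<beta> \<alpha>] assms r x by force
  have "1 - x < \<beta>"
    using triangle_free_real_aux2[of r s q p "1 - x" \<beta> \<gamma> \<alpha>] assms q x by (force simp: algebra_simps)
  \<comment> \<open>These are the values of \<open>1 - q\<close> and \<open>1 - r\<close> once
    \<open>p\<close> and \<open>s\<close> are raised to 1 with \<open>\<gamma>\<close> and
    \<open>\<beta>\<close> fixed. After that change \<open>\<alpha>\<close> would equal
    \<open>u * v\<close>; the computation below shows that it was at most that.\<close>
  define v where "v = (1 - \<gamma>) / (1 - x)"
  define u where "u = (1 - \<beta>) / x"
  have "\<gamma> \<le> x * 1 + (1 - x) * 1" "\<beta> \<le> x * 1 + (1 - x) * 1"
    unfolding \<gamma> \<beta> using assms by (intro add_mono mult_left_mono; simp)+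
  then have uv: "0 \<le> v" "v < 1" "0 \<le> u" "u < 1"
    using x \<open>x < \<gamma>\<close> \<open>1 - x < \<beta>\<close> by (auto simp: v_def u_def field_simps)
  have v: "\<gamma> = 1 - (1 - x) * v" and u: "\<beta> = 1 - x * u" using x by (simp_all add: u_def v_def)
  define a where "a = x / (1 - x)"
  define b where "b = (1 - x) / x"
  have ab: "a * b = 1" using x by (simp add: a_def b_def)
  have "v = (1 - q) + a * (1 - p)" "u = (1 - r) + b * (1 - s)"
    using x unfolding v_def u_def \<gamma> \<beta> a_def b_def by (simp_all add: field_simps)
  then have "u * v - \<alpha> = ((1 - r) + b * (1 - s)) * ((1 - q) + a * (1 - p)) - \<alpha>" by simp
  also have "\<dots> = (1 - p) * ((1 - r) * a - r) + (1 - s) * ((1 - q) * b - q) + (1 - p) * (1 - s) * (a * b)"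
    unfolding \<alpha> by (simp add: algebra_simps)
  finally have "u * v - \<alpha> = (1 - p) * ((1 - r) * a - r) + (1 - s) * ((1 - q) * b - q) + (1 - p) * (1 - s) * (a * b)" .
  moreover have "x * s \<le> x" "(1 - x) * p \<le> 1 - x" using assms by (simp_all add: mult_left_le)
  then have "r \<le> x" "q \<le> 1 - x" using r q by linarith+
  then have "0 \<le> (1 - r) * a - r" "0 \<le> (1 - q) * b - q"
    using x by (simp_all add: a_def b_def field_simps)
  moreover note ab
  ultimately have "\<alpha> \<le> u * v" using assms(3,6) by (smt (verit) mult_nonneg_nonneg)
  then have "\<alpha> * \<beta> \<le> u * v * \<beta>" "\<alpha> * \<gamma> \<le> u * v * \<gamma>" using nonneg by (auto intro: mult_right_mono)
  then have "(1 - x) * v < u * \<beta> * v" "x * u < v * \<gamma> * u" using R u v by (simp_all add: mult_ac)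
  then have "1 - x < u * \<beta>" "x < v * \<gamma>" using uv by (auto simp: mult_less_cancel_right)
  then have "1 < 2 * x" "1 < 2 * (1 - x)"
    using triangle_free_real_aux3[of x u \<beta>] triangle_free_real_aux3[of "1 - x" v \<gamma>] x uv u v by auto
  then show False by simp
qed

text \<open>Inclusion-exclusion: an edge of positive weight avoids both rectangles,
  \<open>P1\<close> times \<open>Q1\<close> and \<open>P2\<close> times \<open>Q2\<close>, and the
  last summand is the measure of their intersection.\<close>

lemma dens_le_one_minus:
  assumes "prob J y" "prob K z"
    and R: "\<And>j k. j \<in> J \<Longrightarrow> k \<in> K \<Longrightarrow> 0 < y j \<Longrightarrow> 0 < z k \<Longrightarrow> R j k \<Longrightarrow> \<not> (P1 j \<and> Q1 k) \<and> \<not> (P2 j \<and> Q2 k)"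
  shows "dens J K y z (ind R) \<le> 1 - (\<Sum>j\<in>J. y j * of_bool (P1 j)) * (\<Sum>k\<in>K. z k * of_bool (Q1 k))
    - (\<Sum>j\<in>J. y j * of_bool (P2 j)) * (\<Sum>k\<in>K. z k * of_bool (Q2 k))
    + (\<Sum>j\<in>J. y j * of_bool (P1 j \<and> P2 j)) * (\<Sum>k\<in>K. z k * of_bool (Q1 k \<and> Q2 k))"
proof -
  have "dens J K y z (ind R) \<le> (\<Sum>j\<in>J. \<Sum>k\<in>K. y j * z k
      - (y j * of_bool (P1 j)) * (z k * of_bool (Q1 k)) - (y j * of_bool (P2 j)) * (z k * of_bool (Q2 k))
      + (y j * of_bool (P1 j \<and> P2 j)) * (z k * of_bool (Q1 k \<and> Q2 k)))"
    unfolding dens_def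
  proof (intro sum_mono)
    fix j k assume jk: "j \<in> J" "k \<in> K"
    then have "0 \<le> y j" "0 \<le> z k" using assms by (auto simp: prob_def)
    then consider "y j = 0" | "z k = 0" | "0 < y j" "0 < z k" by force
    then show "y j * z k * ind R j k \<le> y j * z k
      - (y j * of_bool (P1 j)) * (z k * of_bool (Q1 k)) - (y j * of_bool (P2 j)) * (z k * of_bool (Q2 k))
      + (y j * of_bool (P1 j \<and> P2 j)) * (z k * of_bool (Q1 k \<and> Q2 k))"
      using R[OF jk] by cases (auto simp: of_bool_def)
  qed
  also have "\<dots> = (\<Sum>j\<in>J. y j) * (\<Sum>k\<in>K. z k)
    - (\<Sum>j\<in>J. y j * of_bool (P1 j)) * (\<Sum>k\<in>K. z k * of_bool (Q1 k))
    - (\<Sum>j\<in>J. y j * of_bool (P2 j)) * (\<Sum>k\<in>K. z k * of_bool (Q2 k))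
    + (\<Sum>j\<in>J. y j * of_bool (P1 j \<and> P2 j)) * (\<Sum>k\<in>K. z k * of_bool (Q1 k \<and> Q2 k))"
    by (simp only: sum_product sum.distrib sum_subtractf)
  finally show ?thesis using assms by (simp add: prob_def)
qed

lemma weighted_subset_bounds:
  assumes "prob J y"
  shows "0 \<le> (\<Sum>j\<in>J. y j * of_bool (A j))" "(\<Sum>j\<in>J. y j * of_bool (A j)) \<le> 1"
    "(\<And>j. j \<in> J \<Longrightarrow> A j \<Longrightarrow> B j) \<Longrightarrow> (\<Sum>j\<in>J. y j * of_bool (A j)) \<le> (\<Sum>j\<in>J. y j * of_bool (B j))"
proof -
  show "0 \<le> (\<Sum>j\<in>J. y j * of_bool (A j))"
    using assms by (intro sum_nonneg) (auto simp: prob_def)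
  have "(\<Sum>j\<in>J. y j * of_bool (A j)) \<le> (\<Sum>j\<in>J. y j)"
    using assms by (intro sum_mono) (auto simp: prob_def)
  then show "(\<Sum>j\<in>J. y j * of_bool (A j)) \<le> 1" using assms by (simp add: prob_def)
  show "(\<Sum>j\<in>J. y j * of_bool (A j)) \<le> (\<Sum>j\<in>J. y j * of_bool (B j))" if "\<And>j. j \<in> J \<Longrightarrow> A j \<Longrightarrow> B j"
    using assms that by (intro sum_mono) (auto simp: prob_def)
qed

text \<open>The constraints are total weight and the average of \<open>b\<close>, so two points
  suffice; the cost is \<open>- c\<close>, so the average of \<open>c\<close> cannot drop. The
  program runs over the indices of positive weight only, which keeps both points in the support of
  \<open>x\<close>.\<close>

lemma two_point_support:
  fixes b c :: "'i \<Rightarrow> real"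
  assumes "prob I x"
  obtains i1 i2 s where "i1 \<in> I" "i2 \<in> I" "0 < x i1" "0 < x i2" "0 \<le> s" "s \<le> 1"
    "(\<Sum>i\<in>I. x i * b i) = s * b i1 + (1 - s) * b i2" "(\<Sum>i\<in>I. x i * c i) \<le> s * c i1 + (1 - s) * c i2"
proof -
  define S where "S = {i \<in> I. 0 < x i}"
  have fin: "finite S" using assms by (simp add: S_def prob_def)
  have restrict: "(\<Sum>i\<in>S. x i * f i) = (\<Sum>i\<in>I. x i * f i)" for f :: "'i \<Rightarrow> real"
    using assms by (intro sum.mono_neutral_left) (auto simp: S_def prob_def less_le)
  let ?F = "\<lambda>i. (1::real, b i)"
  obtain v where v: "\<forall>i\<in>S. 0 \<le> v i" "(\<Sum>i\<in>S. v i *\<^sub>R ?F i) = (\<Sum>i\<in>S. x i *\<^sub>R ?F i)"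
    "(\<Sum>i\<in>S. v i * (- c i)) \<le> (\<Sum>i\<in>S. x i * (- c i))" "card {i \<in> S. v i \<noteq> 0} \<le> DIM(real \<times> real)"
    using reduce_support[OF fin, of x ?F "(1, 0)" "\<lambda>i. - c i"] by (auto simp: S_def)
  define T where "T = {i \<in> S. v i \<noteq> 0}"
  have restrict': "(\<Sum>i\<in>T. v i * f i) = (\<Sum>i\<in>S. v i * f i)" for f :: "'i \<Rightarrow> real"
    using fin by (intro sum.mono_neutral_left) (auto simp: T_def)
  have sums: "(\<Sum>i\<in>T. v i) = 1" "(\<Sum>i\<in>I. x i * b i) = (\<Sum>i\<in>T. v i * b i)" "(\<Sum>i\<in>I. x i * c i) \<le> (\<Sum>i\<in>T. v i * c i)"
    using v(2,3) restrict[of b] restrict[of c] restrict[of "\<lambda>_. 1"] restrict'[of b] restrict'[of c] restrict'[of "\<lambda>_. 1"] assms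
    by (simp_all add: sum_prod sum_negf prob_def)
  have finT: "finite T" using fin by (simp add: T_def)
  have "T \<noteq> {}" using sums(1) by auto
  then have "0 < card T" "card T \<le> 2" using v(4) finT unfolding T_def[symmetric] by (simp_all add: card_gt_0_iff)
  then have "card T = 1 \<or> card T = 2" by linarith
  then consider i where "T = {i}" | i1 i2 where "T = {i1, i2}" "i1 \<noteq> i2"
    by (auto simp: card_1_singleton_iff card_2_iff)
  then show thesis
  proof cases
    case 1
    then show thesis using that[of i i 1] sums by (auto simp: T_def S_def)
  next
    case 2
    then have "v i2 = 1 - v i1" "0 \<le> v i1" "0 \<le> v i2" "i1 \<in> S" "i2 \<in> S" using sums(1) v(1) by (auto simp: T_def)
    then show thesis using that[of i1 i2 "v i1"] sums 2 by (auto simp: S_def)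
  qed
qed

text \<open>The theorem of Bondy, Shen, Thomasse and Thomasse on triangle-free tripartite graphs. Linear
  programming leaves two vertices in the first class, with neighbourhood sizes \<open>(p, r)\<close> and
  \<open>(q, s)\<close> in the notation of \<open>triangle_free_real\<close>.\<close>

lemma triangle_free_not_in_R:
  assumes I: "prob I x" and J: "prob J y" and K: "prob K z"
    and t: "tdens I J K x y z (ind P) (ind Q) (ind R) = 0"
    and \<alpha>: "\<alpha> = dens J K y z (ind R)" and \<beta>: "\<beta> = dens I K x z (ind Q)" and \<gamma>: "\<gamma> = dens I J x y (ind P)"
  shows "(\<alpha>, \<beta>, \<gamma>) \<notin> R_region"
proof
  assume "(\<alpha>, \<beta>, \<gamma>) \<in> R_region"
  then have R: "1 < \<alpha> * \<beta> + \<gamma>" "1 < \<alpha> * \<gamma> + \<beta>" "1 < \<beta> * \<gamma> + \<alpha>" and nn: "0 \<le> \<alpha>" "0 \<le> \<beta>" "0 \<le> \<gamma>"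
    by (auto simp: R_region_def)
  define b where "b i = (\<Sum>j\<in>J. y j * ind P i j)" for i
  define c where "c i = (\<Sum>k\<in>K. z k * ind Q i k)" for i
  obtain i1 i2 s where i: "i1 \<in> I" "i2 \<in> I" "0 < x i1" "0 < x i2" "0 \<le> s" "s \<le> 1"
    "(\<Sum>i\<in>I. x i * b i) = s * b i1 + (1 - s) * b i2" "(\<Sum>i\<in>I. x i * c i) \<le> s * c i1 + (1 - s) * c i2"
    using two_point_support[OF I, of b c] by blast
  have \<gamma>_eq: "\<gamma> = s * b i1 + (1 - s) * b i2" and \<beta>_le: "\<beta> \<le> s * c i1 + (1 - s) * c i2"
    using i by (simp_all add: \<beta> \<gamma> dens_eq b_def c_def)
  have free: "\<not> (P i j \<and> Q i k \<and> R j k)" if "i \<in> I" "j \<in> J" "k \<in> K" "0 < x i" "0 < y j" "0 < z k" for i j k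
  proof
    assume "P i j \<and> Q i k \<and> R j k"
    define f where "f i j k = x i * y j * z k * (ind P i j * ind Q i k * ind R j k)" for i j k
    have nonneg: "0 \<le> f i j k" if "i \<in> I" "j \<in> J" "k \<in> K" for i j k
      using that I J K by (auto simp: prob_def f_def)
    have fin: "finite I" "finite J" "finite K" using I J K by (auto simp: prob_def)
    have "(\<Sum>i\<in>I. \<Sum>j\<in>J. \<Sum>k\<in>K. f i j k) = 0" using t by (simp only: tdens_def f_def)
    then have "(\<Sum>j\<in>J. \<Sum>k\<in>K. f i j k) = 0"
      using that fin nonneg by (subst (asm) sum_nonneg_eq_0_iff) (auto intro!: sum_nonneg)
    then have "(\<Sum>k\<in>K. f i j k) = 0"
      using that fin nonneg by (subst (asm) sum_nonneg_eq_0_iff) (auto intro!: sum_nonneg)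
    then have "f i j k = 0"
      using that fin nonneg by (subst (asm) sum_nonneg_eq_0_iff) auto
    then show False using that \<open>P i j \<and> Q i k \<and> R j k\<close> by (simp add: f_def)
  qed
  have main: False if h: "h1 \<in> I" "h2 \<in> I" "0 < x h1" "0 < x h2" "0 \<le> u" "u \<le> 1"
    "\<gamma> = u * b h1 + (1 - u) * b h2" "\<beta> \<le> u * c h1 + (1 - u) * c h2" "b h2 \<le> b h1" for h1 h2 u
  proof -
    define bb where "bb = (\<Sum>j\<in>J. y j * of_bool (P h1 j \<and> P h2 j))"
    define cc where "cc = (\<Sum>k\<in>K. z k * of_bool (Q h1 k \<and> Q h2 k))"
    have \<alpha>_le: "\<alpha> \<le> 1 - b h1 * c h1 - b h2 * c h2 + bb * cc"
      unfolding \<alpha> b_def c_def bb_def cc_def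
      by (rule dens_le_one_minus[OF J K]) (use free h in blast)
    have bounds: "0 \<le> bb" "bb \<le> b h1" "bb \<le> b h2" "0 \<le> cc" "cc \<le> c h1" "cc \<le> c h2"
      "b h1 \<le> 1" "c h1 \<le> 1" "b h2 \<le> 1" "c h2 \<le> 1"
      unfolding bb_def cc_def b_def c_def
      by (auto intro!: weighted_subset_bounds[OF J] weighted_subset_bounds[OF K])
    show False
    proof (cases "c h2 \<le> c h1")
      \<comment> \<open>One vertex has the larger neighbourhood on both sides, and
        \<open>\<beta> * \<gamma> \<le> b h1 * c h1 \<le> 1 - \<alpha>\<close>.\<close>
      case True
      have "bb * cc \<le> b h2 * c h2" using bounds by (intro mult_mono) auto
      moreover have "u * b h1 + (1 - u) * b h2 \<le> u * b h1 + (1 - u) * b h1"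
        "u * c h1 + (1 - u) * c h2 \<le> u * c h1 + (1 - u) * c h1"
        using True h by (simp_all add: mult_left_mono)
      then have "\<gamma> \<le> b h1" "\<beta> \<le> c h1" using h by (simp_all add: algebra_simps)
      then have "\<beta> * \<gamma> \<le> b h1 * c h1" using nn bounds by (subst mult.commute, intro mult_mono) auto
      ultimately show False using R \<alpha>_le by simp
    next
      \<comment> \<open>The sizes are oppositely ordered. Only upper bounds for
        \<open>\<alpha>\<close> and \<open>\<beta>\<close> are known, but the inequalities of the
        region are monotone, so they pass to \<open>\<alpha>'\<close> and
        \<open>\<beta>'\<close>.\<close>
      case False
      define \<beta>' where "\<beta>' = u * c h1 + (1 - u) * c h2"
      define \<alpha>' where "\<alpha>' = 1 - b h1 * c h1 - b h2 * c h2 + b h2 * c h1"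
      have "bb * cc \<le> b h2 * c h1" using bounds by (intro mult_mono) auto
      then have le: "\<alpha> \<le> \<alpha>'" "\<beta> \<le> \<beta>'" using \<alpha>_le h by (simp_all add: \<alpha>'_def \<beta>'_def)
      have "\<alpha> * \<beta> \<le> \<alpha>' * \<beta>'" "\<alpha> * \<gamma> \<le> \<alpha>' * \<gamma>" "\<beta> * \<gamma> \<le> \<beta>' * \<gamma>"
        using le nn by (auto intro!: mult_mono)
      then show False
        using triangle_free_real[of "b h2" "b h1" "c h1" "c h2" u \<gamma> \<beta>' \<alpha>'] h R le bounds False
        by (auto simp: \<alpha>'_def \<beta>'_def)
    qed
  qed
  show False
  proof (cases "b i2 \<le> b i1")
    case True
    then show False using main[of i1 i2 s] i \<gamma>_eq \<beta>_le by blast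
  next
    case False
    then show False using main[of i2 i1 "1 - s"] i \<gamma>_eq \<beta>_le by (simp add: add.commute)
  qed
qed

section \<open>Non-edges and the sign of \<open>Delta\<close>\<close>

lemma one_minus_dens_le:
  assumes "prob I x" "prob J y" "\<And>i j. i \<in> I \<Longrightarrow> j \<in> J \<Longrightarrow> \<not> P i j \<Longrightarrow> U i \<and> V j"
  shows "1 - dens I J x y (ind P) \<le> (\<Sum>i\<in>I. x i * of_bool (U i)) * (\<Sum>j\<in>J. y j * of_bool (V j))"
proof -
  have "1 - dens I J x y (ind P) = (\<Sum>i\<in>I. \<Sum>j\<in>J. x i * y j) - (\<Sum>i\<in>I. \<Sum>j\<in>J. x i * y j * ind P i j)"
    unfolding sum_product[symmetric] dens_def using assms by (simp add: prob_def)
  also have "\<dots> = (\<Sum>i\<in>I. \<Sum>j\<in>J. x i * y j - x i * y j * ind P i j)" by (simp only: sum_subtractf)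
  also have "\<dots> \<le> (\<Sum>i\<in>I. \<Sum>j\<in>J. (x i * of_bool (U i)) * (y j * of_bool (V j)))"
  proof (intro sum_mono)
    fix i j assume "i \<in> I" "j \<in> J"
    then show "x i * y j - x i * y j * ind P i j \<le> (x i * of_bool (U i)) * (y j * of_bool (V j))"
      using assms(1,2) assms(3)[of i j] by (cases "P i j") (auto simp: prob_def)
  qed
  finally show ?thesis by (simp only: sum_product)
qed

lemma sum_of_bool_not:
  assumes "prob I x"
  shows "(\<Sum>i\<in>I. x i * of_bool (\<not> U i)) = 1 - (\<Sum>i\<in>I. x i * of_bool (U i))"
proof -
  have "(\<Sum>i\<in>I. x i * of_bool (\<not> U i)) + (\<Sum>i\<in>I. x i * of_bool (U i)) = sum x I"
    unfolding sum.distrib[symmetric] by (intro sum.cong) auto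
  then show ?thesis using assms by (simp add: prob_def)
qed

lemma Delta_eq: "Delta \<alpha> \<beta> \<gamma> = (1 - (1 - \<alpha>) - (1 - \<beta>) - (1 - \<gamma>))\<^sup>2 - 4 * ((1 - \<alpha>) * (1 - \<beta>) * (1 - \<gamma>))"
  by (simp add: Delta_def power2_eq_square algebra_simps)

text \<open>When no vertex has non-neighbours in both other classes, the non-edges lie in three
  cyclically arranged rectangles of measures \<open>u * (1 - v)\<close>, \<open>v * (1 - s)\<close>
  and \<open>s * (1 - u)\<close>. With \<open>p = u * v * s\<close> and
  \<open>q = (1 - u) * (1 - v) * (1 - s)\<close> these measures have sum \<open>1 - p - q\<close>
  and product \<open>p * q\<close>, so \<open>Delta_eq\<close> gives at least
  \<open>(p - q)^2\<close>.\<close>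

lemma Delta_nonneg:
  assumes I: "prob I x" and J: "prob J y" and K: "prob K z"
    and full_I: "\<And>i. i \<in> I \<Longrightarrow> (\<forall>j\<in>J. P i j) \<or> (\<forall>k\<in>K. Q i k)"
    and full_J: "\<And>j. j \<in> J \<Longrightarrow> (\<forall>i\<in>I. P i j) \<or> (\<forall>k\<in>K. R j k)"
    and full_K: "\<And>k. k \<in> K \<Longrightarrow> (\<forall>i\<in>I. Q i k) \<or> (\<forall>j\<in>J. R j k)"
    and \<alpha>: "\<alpha> = dens J K y z (ind R)" and \<beta>: "\<beta> = dens I K x z (ind Q)" and \<gamma>: "\<gamma> = dens I J x y (ind P)"
    and le1: "\<alpha> \<le> 1" "\<beta> \<le> 1" "\<gamma> \<le> 1"
  shows "0 \<le> Delta \<alpha> \<beta> \<gamma>"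
proof -
  define u where "u = (\<Sum>i\<in>I. x i * of_bool (\<forall>k\<in>K. Q i k))"
  define v where "v = (\<Sum>j\<in>J. y j * of_bool (\<forall>i\<in>I. P i j))"
  define s where "s = (\<Sum>k\<in>K. z k * of_bool (\<forall>j\<in>J. R j k))"
  have bounds: "0 \<le> u" "u \<le> 1" "0 \<le> v" "v \<le> 1" "0 \<le> s" "s \<le> 1"
    unfolding u_def v_def s_def by (intro weighted_subset_bounds I J K)+
  have c: "1 - \<gamma> \<le> u * (1 - v)"
    unfolding \<gamma> u_def v_def sum_of_bool_not[OF J, symmetric]
    by (rule one_minus_dens_le[OF I J]) (use full_I full_J in blast)
  have a: "1 - \<alpha> \<le> v * (1 - s)"
    unfolding \<alpha> v_def s_def sum_of_bool_not[OF K, symmetric]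
    by (rule one_minus_dens_le[OF J K]) (use full_J full_K in blast)
  have "1 - \<beta> \<le> (1 - u) * s"
    unfolding \<beta> u_def s_def sum_of_bool_not[OF I, symmetric]
    by (rule one_minus_dens_le[OF I K]) (use full_I full_K in blast)
  then have b: "1 - \<beta> \<le> s * (1 - u)" by (simp add: mult.commute)
  define p where "p = u * v * s"
  define q where "q = (1 - u) * (1 - v) * (1 - s)"
  have pq: "0 \<le> p" "0 \<le> q" using bounds by (simp_all add: p_def q_def)
  have "1 - v * (1 - s) - s * (1 - u) - u * (1 - v) = p + q"
    by (simp add: p_def q_def algebra_simps)
  then have "p + q \<le> 1 - (1 - \<alpha>) - (1 - \<beta>) - (1 - \<gamma>)" using a b c by linarith
  then have "(p + q)\<^sup>2 \<le> (1 - (1 - \<alpha>) - (1 - \<beta>) - (1 - \<gamma>))\<^sup>2"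
    using pq by (intro power_mono) auto
  moreover have "(1 - \<alpha>) * (1 - \<beta>) * (1 - \<gamma>) \<le> (v * (1 - s)) * (s * (1 - u)) * (u * (1 - v))"
    using a b c le1 bounds by (intro mult_mono mult_nonneg_nonneg) auto
  then have "(1 - \<alpha>) * (1 - \<beta>) * (1 - \<gamma>) \<le> p * q" by (simp add: p_def q_def mult_ac)
  moreover have "(p + q)\<^sup>2 - 4 * (p * q) = (p - q)\<^sup>2" by (simp add: power2_eq_square algebra_simps)
  then have "4 * (p * q) \<le> (p + q)\<^sup>2" by (metis diff_ge_0_iff_ge zero_le_power2)
  ultimately show ?thesis unfolding Delta_eq by simp
qed

section \<open>The region and an upper bound for \<open>T_min\<close>\<close>

lemma R2_regionD:
  assumes "(\<alpha>, \<beta>, \<gamma>) \<in> R2_region"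
  shows "0 < \<alpha>" "0 < \<beta>" "0 < \<gamma>" "\<alpha> < 1" "\<beta> < 1" "\<gamma> < 1"
    "1 < \<alpha> * \<beta> + \<gamma>" "1 < \<alpha> * \<gamma> + \<beta>" "1 < \<beta> * \<gamma> + \<alpha>" "Delta \<alpha> \<beta> \<gamma> < 0"
proof -
  show R: "1 < \<alpha> * \<beta> + \<gamma>" "1 < \<alpha> * \<gamma> + \<beta>" "1 < \<beta> * \<gamma> + \<alpha>" and D: "Delta \<alpha> \<beta> \<gamma> < 0"
    using assms by (auto simp: R2_region_def R_region_def)
  have le: "0 \<le> \<alpha>" "0 \<le> \<beta>" "0 \<le> \<gamma>" "\<alpha> \<le> 1" "\<beta> \<le> 1" "\<gamma> \<le> 1"
    using assms by (auto simp: R2_region_def R_region_def)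
  \<comment> \<open>A density equal to 1 kills the product in \<open>Delta_eq\<close> and leaves a
    square.\<close>
  have "\<alpha> \<noteq> 1" "\<beta> \<noteq> 1" "\<gamma> \<noteq> 1" using D unfolding Delta_eq by (auto simp: not_less)
  then show "\<alpha> < 1" "\<beta> < 1" "\<gamma> < 1" using le by simp_all
  show "0 < \<alpha>" "0 < \<beta>" "0 < \<gamma>" using R le by (auto simp: less_le)
qed

lemma R2_region_swap:
  assumes "(\<alpha>, \<beta>, \<gamma>) \<in> R2_region"
  shows "(\<beta>, \<alpha>, \<gamma>) \<in> R2_region" "(\<alpha>, \<gamma>, \<beta>) \<in> R2_region"
  using assms by (auto simp: R2_region_def R_region_def Delta_def algebra_simps)

text \<open>The witness is \<open>K\<^sub>2\<^sub>,\<^sub>2\<^sub>,\<^sub>2\<close> minus a perfect matching meeting all three pairs of classes, with one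
  further fractional pair of density \<open>e\<close>; the bound \<open>\<alpha> + \<beta> \<gamma> - 1\<close> is its value at \<open>u = \<beta>\<close>.\<close>

lemma T_min_less:
  assumes "(\<alpha>, \<beta>, \<gamma>) \<in> R2_region"
  shows "T_min \<alpha> \<beta> \<gamma> < \<alpha> + \<beta> * \<gamma> - 1"
proof -
  note r = R2_regionD[OF assms]
  have "0 < (1 - \<gamma>) * (1 - \<beta>)" using r by simp
  \<comment> \<open>The first bound will make \<open>b < \<gamma>\<close>, and it lies below
    \<open>\<beta>\<close> because \<open>\<beta> * \<gamma> + \<alpha> > 1\<close>; the second
    leaves room for a fractional density \<open>e \<le> 1\<close>.\<close>
  then have "max ((1 - \<alpha>) / \<gamma>) (\<beta> - (1 - \<gamma>) * (1 - \<beta>)) < \<beta>" using r by (auto simp: field_simps)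
  then obtain u where "max ((1 - \<alpha>) / \<gamma>) (\<beta> - (1 - \<gamma>) * (1 - \<beta>)) < u" and u1: "u < \<beta>"
    using dense by blast
  then have u2: "1 - \<alpha> < \<gamma> * u" and u3: "\<beta> - u < (1 - \<gamma>) * (1 - \<beta>)" using r by (auto simp: field_simps)
  have "0 < \<gamma> * u" using u2 r by simp
  then have u0: "0 < u" using r by (simp add: zero_less_mult_iff)
  have "\<gamma> * u \<le> u" using u0 r by simp
  then have u4: "1 - \<alpha> < u" using u2 by simp
  \<comment> \<open>\<open>b\<close>, \<open>a\<close> and \<open>e\<close> solve the equations for
    \<open>\<alpha>\<close>, \<open>\<gamma>\<close> and \<open>\<beta>\<close>, in this
    order.\<close>
  define b where "b = (1 - \<alpha>) / u"
  define a where "a = (1 - \<gamma>) / (1 - b)"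
  define e where "e = (\<beta> - u) / (a * (1 - u))"
  have b: "0 < b" "b < 1" "b * u = 1 - \<alpha>" using u0 u4 r by (auto simp: b_def field_simps)
  have "b < \<gamma>" using u2 u0 by (simp add: b_def field_simps)
  then have a: "1 - \<gamma> \<le> a" "a < 1" "a * (1 - b) = 1 - \<gamma>" using b r by (auto simp: a_def field_simps)
  have "(1 - \<gamma>) * (1 - \<beta>) \<le> a * (1 - u)" using a r u1 by (intro mult_mono) auto
  then have au: "\<beta> - u < a * (1 - u)" using u3 by linarith
  have au0: "0 < a * (1 - u)" using a r u1 by simp
  have e: "0 \<le> e" "e \<le> 1" "a * (1 - u) * e = \<beta> - u"
    using au less_imp_neq[OF au0] au0 u1 unfolding e_def
    by (auto simp only: divide_le_eq_1_pos nonzero_mult_div_cancel_left times_divide_eq_right intro!: divide_nonneg_pos)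
  define x where "x i = (if i then 1 - a else a)" for i
  define y where "y j = (if j then 1 - b else b)" for j
  define z where "z k = (if k then u else 1 - u)" for k
  define p where "p i j = (of_bool (i \<or> \<not> j) :: real)" for i j
  define q where "q i k = (if k then 1 else if i then 0 else e)" for i k
  let ?R = "\<lambda>j k. j \<or> \<not> k"
  have "T_min (dens UNIV UNIV y z (ind ?R)) (dens UNIV UNIV x z q) (dens UNIV UNIV x y p)
      \<le> tdens UNIV UNIV UNIV x y z p q (ind ?R)"
    using a b e u0 u1 r
    by (intro T_min_le_tdens) (auto simp: prob_def UNIV_bool x_def y_def z_def p_def q_def)
  also have "dens UNIV UNIV y z (ind ?R) = \<alpha>"
    using b by (simp add: dens_def UNIV_bool y_def z_def algebra_simps)
  also have "dens UNIV UNIV x z q = \<beta>"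
    using e by (simp add: dens_def UNIV_bool x_def z_def q_def algebra_simps)
  also have "dens UNIV UNIV x y p = \<gamma>"
    using a by (simp add: dens_def UNIV_bool x_def y_def p_def algebra_simps)
  also have "tdens UNIV UNIV UNIV x y z p q (ind ?R) = (1 - a) * (1 - b) * u + b * (a * (1 - u) * e)"
    by (simp add: tdens_def UNIV_bool x_def y_def z_def p_def q_def algebra_simps)
  also have "\<dots> = u - b * u - (a * (1 - b)) * u + b * (\<beta> - u)"
    unfolding e by (simp add: algebra_simps)
  also have "\<dots> = \<gamma> * u + b * \<beta> - 2 * (1 - \<alpha>)" unfolding a using b by (simp add: algebra_simps)
  also have "\<dots> < \<alpha> + \<beta> * \<gamma> - 1"
  proof -
    \<comment> \<open>This product is exactly the gap between the two sides, because
      \<open>b * u = 1 - \<alpha>\<close>.\<close>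
    have "0 < (\<gamma> - b) * (\<beta> - u)" using \<open>b < \<gamma>\<close> u1 by simp
    then show ?thesis using b by (simp add: algebra_simps)
  qed
  finally show ?thesis .
qed

subsection \<open>Extremal configurations\<close>

definition extremal_config :: "real \<Rightarrow> real \<Rightarrow> real \<Rightarrow> 'i set \<Rightarrow> 'j set \<Rightarrow> 'k set \<Rightarrow>
    ('i \<Rightarrow> real) \<Rightarrow> ('j \<Rightarrow> real) \<Rightarrow> ('k \<Rightarrow> real) \<Rightarrow>
    ('i \<Rightarrow> 'j \<Rightarrow> bool) \<Rightarrow> ('i \<Rightarrow> 'k \<Rightarrow> bool) \<Rightarrow> ('j \<Rightarrow> 'k \<Rightarrow> bool) \<Rightarrow> bool" where
  "extremal_config \<alpha> \<beta> \<gamma> I J K x y z P Q R \<longleftrightarrow>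
    (\<alpha>, \<beta>, \<gamma>) \<in> R2_region \<and> prob I x \<and> prob J y \<and> prob K z \<and>
    dens J K y z (ind R) = \<alpha> \<and> dens I K x z (ind Q) = \<beta> \<and> dens I J x y (ind P) = \<gamma> \<and>
    tdens I J K x y z (ind P) (ind Q) (ind R) = T_min \<alpha> \<beta> \<gamma>"

lemma extremal_config_swap_AB:
  assumes "extremal_config \<alpha> \<beta> \<gamma> I J K x y z P Q R"
  shows "extremal_config \<beta> \<alpha> \<gamma> J I K y x z (\<lambda>j i. P i j) R Q"
  using assms R2_region_swap(1) dens_swap[of I J x y "ind P"]
    tdens_swap_AB[of I J K x y z "ind P" "ind Q" "ind R"] T_min_swap(1)[of \<beta> \<alpha> \<gamma>]
  unfolding extremal_config_def by auto

lemma extremal_config_swap_BC: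
  assumes "extremal_config \<alpha> \<beta> \<gamma> I J K x y z P Q R"
  shows "extremal_config \<alpha> \<gamma> \<beta> I K J x z y Q P (\<lambda>k j. R j k)"
  using assms R2_region_swap(2) dens_swap[of J K y z "ind R"]
    tdens_swap_BC[of I J K x y z "ind P" "ind Q" "ind R"] T_min_swap(2)[of \<alpha> \<gamma> \<beta>]
  unfolding extremal_config_def by auto

lemma T_min_pos:
  assumes "extremal_config \<alpha> \<beta> \<gamma> I J K x y z P Q R"
  shows "0 < T_min \<alpha> \<beta> \<gamma>"
proof -
  have "prob I x" "prob J y" "prob K z" using assms by (simp_all add: extremal_config_def)
  then have "0 \<le> tdens I J K x y z (ind P) (ind Q) (ind R)"
    unfolding tdens_def by (intro sum_nonneg mult_nonneg_nonneg) (auto simp: prob_def)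
  moreover have "tdens I J K x y z (ind P) (ind Q) (ind R) \<noteq> 0"
    using triangle_free_not_in_R[of I x J y K z P Q R] assms
    by (auto simp: extremal_config_def R2_region_def)
  ultimately show ?thesis using assms by (auto simp: extremal_config_def)
qed

section \<open>Uncrossing two vertices\<close>

definition uncrossed_set :: "'i set \<Rightarrow> ('i + bool) set" where
  "uncrossed_set I = Inl ` I \<union> range Inr"

definition uncrossed_weight :: "('i \<Rightarrow> real) \<Rightarrow> 'i \<Rightarrow> 'i \<Rightarrow> real \<Rightarrow> 'i + bool \<Rightarrow> real" where
  "uncrossed_weight x i1 i2 \<delta> s =
    (case s of Inl i \<Rightarrow> x i - (if i = i1 \<or> i = i2 then \<delta> else 0) | Inr _ \<Rightarrow> \<delta>)"

text \<open>\<open>c\<close> names the new vertex that receives the intersection. Using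
  \<open>True\<close> towards one class and \<open>False\<close> towards the other places the two
  intersections at different new vertices.\<close>

definition uncrossed_rel :: "'i \<Rightarrow> 'i \<Rightarrow> bool \<Rightarrow> ('i \<Rightarrow> 'j \<Rightarrow> bool) \<Rightarrow> 'i + bool \<Rightarrow> 'j \<Rightarrow> bool" where
  "uncrossed_rel i1 i2 c P s j =
    (case s of Inl i \<Rightarrow> P i j | Inr b \<Rightarrow> if b = c then P i1 j \<and> P i2 j else P i1 j \<or> P i2 j)"

lemma sum_uncrossed:
  assumes "finite I" "i1 \<in> I" "i2 \<in> I" "i1 \<noteq> i2"
  shows "(\<Sum>s\<in>uncrossed_set I. uncrossed_weight x i1 i2 \<delta> s * f s) =
    (\<Sum>i\<in>I. x i * f (Inl i)) - \<delta> * (f (Inl i1) + f (Inl i2) - f (Inr True) - f (Inr False))"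
proof -
  have "(\<Sum>s\<in>uncrossed_set I. uncrossed_weight x i1 i2 \<delta> s * f s) =
      (\<Sum>s\<in>Inl ` I. uncrossed_weight x i1 i2 \<delta> s * f s) + (\<Sum>s\<in>range Inr. uncrossed_weight x i1 i2 \<delta> s * f s)"
    unfolding uncrossed_set_def using assms(1) by (intro sum.union_disjoint) auto
  also have "(\<Sum>s\<in>range Inr. uncrossed_weight x i1 i2 \<delta> s * f s) = \<delta> * (f (Inr True) + f (Inr False))"
    by (simp add: uncrossed_weight_def UNIV_bool algebra_simps)
  also have "(\<Sum>s\<in>Inl ` I. uncrossed_weight x i1 i2 \<delta> s * f s) =
      (\<Sum>i\<in>I. x i * f (Inl i) - (if i = i1 then \<delta> * f (Inl i1) else 0) - (if i = i2 then \<delta> * f (Inl i2) else 0))"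
    unfolding sum.reindex[OF inj_Inl[THEN inj_on_subset, OF subset_UNIV]] using assms
    by (intro sum.cong) (auto simp: uncrossed_weight_def algebra_simps)
  also have "\<dots> = (\<Sum>i\<in>I. x i * f (Inl i)) - \<delta> * (f (Inl i1) + f (Inl i2))"
    using assms by (simp add: sum_subtractf sum.distrib algebra_simps)
  finally show ?thesis by (simp add: algebra_simps)
qed

text \<open>Moving weight \<open>\<delta>\<close> from two vertices with neighbourhoods \<open>(X\<^sub>1, Y\<^sub>1)\<close> and \<open>(X\<^sub>2, Y\<^sub>2)\<close> to
  vertices with neighbourhoods \<open>(X\<^sub>1 \<inter> X\<^sub>2, Y\<^sub>1 \<union> Y\<^sub>2)\<close> and \<open>(X\<^sub>1 \<union> X\<^sub>2, Y\<^sub>1 \<inter> Y\<^sub>2)\<close> keeps the edge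
  densities and destroys the triangles over \<open>(X\<^sub>1 - X\<^sub>2) \<times> (Y\<^sub>1 - Y\<^sub>2)\<close>.\<close>

lemma extremal_config_uncross:
  assumes ext: "extremal_config \<alpha> \<beta> \<gamma> I J K x y z P Q R"
    and i: "i1 \<in> I" "i2 \<in> I" "i1 \<noteq> i2" and \<delta>: "0 \<le> \<delta>" "\<delta> \<le> x i1" "\<delta> \<le> x i2"
  shows "extremal_config \<alpha> \<beta> \<gamma> (uncrossed_set I) J K (uncrossed_weight x i1 i2 \<delta>) y z
      (uncrossed_rel i1 i2 True P) (uncrossed_rel i1 i2 False Q) R"
    and "\<lbrakk>j \<in> J; k \<in> K; P i1 j; \<not> P i2 j; Q i1 k; \<not> Q i2 k; R j k\<rbrakk> \<Longrightarrow> \<delta> * (y j * z k) \<le> 0"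
proof -
  let ?I = "uncrossed_set I" and ?x = "uncrossed_weight x i1 i2 \<delta>"
    and ?P = "uncrossed_rel i1 i2 True P" and ?Q = "uncrossed_rel i1 i2 False Q"
  have prob: "prob I x" "prob J y" "prob K z" and fin: "finite I" "finite J" "finite K"
    using ext by (auto simp: extremal_config_def prob_def)
  note sum_eq = sum_uncrossed[OF fin(1) i, of x \<delta>]
  have prob': "prob ?I ?x"
    unfolding prob_def
  proof (intro conjI ballI)
    show "finite ?I" using fin by (simp add: uncrossed_set_def)
    show "0 \<le> ?x s" if "s \<in> ?I" for s
      using that prob \<delta> by (auto simp: uncrossed_set_def uncrossed_weight_def prob_def)
    show "sum ?x ?I = 1" using sum_eq[of "\<lambda>_. 1"] prob by (simp add: prob_def)
  qed
  have dens_IJ: "dens ?I J ?x y (ind ?P) = dens I J x y (ind P)"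
  proof -
    have "(\<Sum>j\<in>J. y j * ind ?P (Inl i1) j) + (\<Sum>j\<in>J. y j * ind ?P (Inl i2) j) =
        (\<Sum>j\<in>J. y j * ind ?P (Inr True) j) + (\<Sum>j\<in>J. y j * ind ?P (Inr False) j)"
      unfolding sum.distrib[symmetric] by (intro sum.cong) (auto simp: uncrossed_rel_def)
    then show ?thesis unfolding dens_eq sum_eq by (simp add: uncrossed_rel_def)
  qed
  have dens_IK: "dens ?I K ?x z (ind ?Q) = dens I K x z (ind Q)"
  proof -
    have "(\<Sum>k\<in>K. z k * ind ?Q (Inl i1) k) + (\<Sum>k\<in>K. z k * ind ?Q (Inl i2) k) =
        (\<Sum>k\<in>K. z k * ind ?Q (Inr True) k) + (\<Sum>k\<in>K. z k * ind ?Q (Inr False) k)"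
      unfolding sum.distrib[symmetric] by (intro sum.cong) (auto simp: uncrossed_rel_def)
    then show ?thesis unfolding dens_eq sum_eq by (simp add: uncrossed_rel_def)
  qed
  define f where "f s j k = y j * z k * (ind ?P s j * ind ?Q s k * ind R j k)" for s j k
  \<comment> \<open>The drop in triangle weight over the pair \<open>(j, k)\<close> per unit of
    \<open>\<delta>\<close>. It is never negative, while extremality forbids a positive total drop
    for \<open>\<delta> > 0\<close>; hence no single pair can show a gain.\<close>
  define d where "d j k = f (Inl i1) j k + f (Inl i2) j k - f (Inr True) j k - f (Inr False) j k" for j k
  define D where "D = (\<Sum>j\<in>J. \<Sum>k\<in>K. d j k)"
  have "tdens ?I J K ?x y z (ind ?P) (ind ?Q) (ind R) = tdens I J K x y z (ind P) (ind Q) (ind R) - \<delta> * D"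
    unfolding tdens_eq sum_eq D_def d_def f_def sum.distrib sum_subtractf by (simp add: uncrossed_rel_def)
  then have t': "tdens ?I J K ?x y z (ind ?P) (ind ?Q) (ind R) = T_min \<alpha> \<beta> \<gamma> - \<delta> * D"
    using ext by (simp add: extremal_config_def)
  have "T_min (dens J K y z (ind R)) (dens ?I K ?x z (ind ?Q)) (dens ?I J ?x y (ind ?P))
      \<le> tdens ?I J K ?x y z (ind ?P) (ind ?Q) (ind R)"
    using prob prob' by (intro T_min_le_tdens) auto
  then have \<delta>D: "\<delta> * D \<le> 0" using t' ext by (simp add: dens_IJ dens_IK extremal_config_def)
  have d_nonneg: "0 \<le> d j k" if "j \<in> J" "k \<in> K" for j k
    using that prob unfolding d_def f_def prob_def uncrossed_rel_def by (auto simp: of_bool_def)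
  then have "0 \<le> D" unfolding D_def by (auto intro!: sum_nonneg)
  then have "\<delta> * D = 0" using \<delta>D mult_nonneg_nonneg[OF \<delta>(1), of D] by linarith
  then show "extremal_config \<alpha> \<beta> \<gamma> ?I J K ?x y z ?P ?Q R"
    using ext prob' t' by (simp add: extremal_config_def dens_IJ dens_IK)
  assume jk: "j \<in> J" "k \<in> K" and cross: "P i1 j" "\<not> P i2 j" "Q i1 k" "\<not> Q i2 k" "R j k"
  have "y j * z k = d j k" using cross by (simp add: d_def f_def uncrossed_rel_def)
  also have "\<dots> \<le> (\<Sum>k\<in>K. d j k)" using jk fin d_nonneg by (intro member_le_sum) auto
  also have "\<dots> \<le> D" unfolding D_def using jk fin d_nonneg by (intro member_le_sum) (auto intro!: sum_nonneg)
  finally show "\<delta> * (y j * z k) \<le> 0" using \<delta>D \<delta>(1) by (meson mult_left_mono order_trans)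
qed

lemma no_crossing_edge:
  assumes "extremal_config \<alpha> \<beta> \<gamma> I J K x y z P Q R"
    and "i1 \<in> I" "i2 \<in> I" "j \<in> J" "k \<in> K" "0 < x i1" "0 < x i2" "0 < y j" "0 < z k"
    and "P i1 j" "\<not> P i2 j" "Q i1 k" "\<not> Q i2 k"
  shows "\<not> R j k"
proof
  assume "R j k"
  then have "min (x i1) (x i2) * (y j * z k) \<le> 0"
    using assms by (intro extremal_config_uncross(2)[OF assms(1-3)]) auto
  moreover have "0 < min (x i1) (x i2) * (y j * z k)" using assms by simp
  ultimately show False by simp
qed

text \<open>If the conclusion failed, then after uncrossing \<open>i1\<close> and \<open>i2\<close> the pair \<open>j\<close>, \<open>j'\<close> could be
  uncrossed with a gain.\<close>

lemma triangle_nbhd_mono: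
  assumes ext: "extremal_config \<alpha> \<beta> \<gamma> I J K x y z P Q R"
    and mem: "i1 \<in> I" "i2 \<in> I" "j \<in> J" "j' \<in> J" "k \<in> K"
    and pos: "0 < x i1" "0 < x i2" "0 < y j" "0 < y j'" "0 < z k"
    and tri: "P i1 j" "Q i1 k" "R j k" and "\<not> R j' k" "P i2 j"
  shows "P i2 j'"
proof (rule ccontr)
  assume not: "\<not> P i2 j'"
  show False
  proof (cases "i1 = i2")
    case True
    then show False
      using no_crossing_edge[OF extremal_config_swap_AB[OF ext], of j j' i1 k] assms not by blast
  next
    case False
    define \<delta> where "\<delta> = min (x i1) (x i2) / 2"
    have \<delta>: "0 < \<delta>" "\<delta> \<le> x i1" "\<delta> \<le> x i2" using pos by (auto simp: \<delta>_def)
    \<comment> \<open>The new vertex \<open>Inr True\<close> is adjacent to \<open>j\<close> but not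
      to \<open>j'\<close>, and it inherits \<open>k\<close> from \<open>i1\<close>; so
      \<open>j\<close> and \<open>j'\<close> cross at the edge from \<open>Inr True\<close> to
      \<open>k\<close>.\<close>
    have "\<not> uncrossed_rel i1 i2 False Q (Inr True) k"
      by (rule no_crossing_edge[OF extremal_config_swap_AB[OF extremal_config_uncross(1)[OF ext mem(1,2) False, of \<delta>]],
          of j j' "Inr True" k])
        (use \<delta> assms not in \<open>auto simp: uncrossed_set_def uncrossed_weight_def uncrossed_rel_def\<close>)
    then show False using tri by (simp add: uncrossed_rel_def)
  qed
qed

text \<open>Without a common neighbour of positive weight, adding the pair \<open>j\<close>,
  \<open>k\<close> creates no weighted triangle but raises \<open>\<alpha>\<close>. Scaling all
  adjacencies between these two classes by \<open>\<theta> < 1\<close> restores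
  \<open>\<alpha>\<close> and multiplies the triangle density by \<open>\<theta>\<close>, which
  contradicts \<open>T_min > 0\<close>.\<close>

lemma nonedge_common_neighbour:
  assumes ext: "extremal_config \<alpha> \<beta> \<gamma> I J K x y z P Q R"
    and jk: "j \<in> J" "k \<in> K" "0 < y j" "0 < z k" "\<not> R j k"
  shows "\<exists>i\<in>I. 0 < x i \<and> P i j \<and> Q i k"
proof (rule ccontr)
  assume none: "\<not> ?thesis"
  have prob: "prob I x" "prob J y" "prob K z" using ext by (auto simp: extremal_config_def)
  have fin: "finite J" "finite K" using prob by (auto simp: prob_def)
  have \<alpha>: "dens J K y z (ind R) = \<alpha>" "0 < \<alpha>" using ext R2_regionD by (auto simp: extremal_config_def)
  define \<theta> where "\<theta> = \<alpha> / (\<alpha> + y j * z k)"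
  define r where "r j' k' = \<theta> * of_bool (R j' k' \<or> j' = j \<and> k' = k)" for j' k'
  have yz: "0 < y j * z k" using jk by simp
  then have \<theta>: "0 \<le> \<theta>" "\<theta> < 1" "\<theta> * (\<alpha> + y j * z k) = \<alpha>" using \<alpha> by (auto simp: \<theta>_def field_simps)
  have common: "(\<Sum>i\<in>I. x i * (ind P i j * ind Q i k)) = 0"
    using none prob by (intro sum.neutral) (auto simp: prob_def less_le)
  have "dens J K y z r = \<theta> * (\<Sum>j'\<in>J. \<Sum>k'\<in>K. y j' * z k' * ind R j' k' + (if j' = j then if k' = k then y j * z k else 0 else 0))"
    unfolding dens_def sum_distrib_left using jk by (intro sum.cong) (auto simp: r_def algebra_simps)
  also have "\<dots> = \<theta> * (\<alpha> + (\<Sum>j'\<in>J. \<Sum>k'\<in>K. if j' = j then if k' = k then y j * z k else 0 else 0))"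
    unfolding sum.distrib \<alpha>(1)[symmetric] dens_def ..
  also have "(\<Sum>j'\<in>J. \<Sum>k'\<in>K. if j' = j then if k' = k then y j * z k else 0 else 0) = (\<Sum>j'\<in>J. if j' = j then y j * z k else 0)"
    using fin jk by (intro sum.cong) auto
  finally have dens_r: "dens J K y z r = \<alpha>" using fin jk \<theta> by simp
  have tdens_r: "tdens I J K x y z (ind P) (ind Q) r = \<theta> * tdens I J K x y z (ind P) (ind Q) (ind R)"
  proof -
    define c where "c j k = (\<Sum>i\<in>I. x i * (ind P i j * ind Q i k))" for j k
    have "tdens I J K x y z (ind P) (ind Q) r' = (\<Sum>j\<in>J. \<Sum>k\<in>K. y j * z k * r' j k * c j k)" for r'
      by (simp only: tdens_eq' c_def)
    moreover have "y j' * z k' * r j' k' * c j' k' = \<theta> * (y j' * z k' * ind R j' k' * c j' k')" for j' k'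
      using common by (cases "j' = j \<and> k' = k") (auto simp: r_def c_def)
    ultimately show ?thesis by (simp only: sum_distrib_left)
  qed
  \<comment> \<open>\<open>T_min_le_tdens\<close> accepts fractional kernels only at the first
    class, so \<open>J\<close> is moved to the front.\<close>
  have "T_min (dens I K x z (ind Q)) (dens J K y z r) (dens J I y x (\<lambda>j i. ind P i j))
      \<le> tdens J I K y x z (\<lambda>j i. ind P i j) r (ind Q)"
    using prob \<theta> by (intro T_min_le_tdens) (auto simp: r_def)
  then have "T_min \<alpha> \<beta> \<gamma> \<le> \<theta> * T_min \<alpha> \<beta> \<gamma>"
    unfolding dens_swap[of I J x y "ind P", symmetric] tdens_swap_AB[of I J K x y z "ind P" "ind Q" r, symmetric]
    using ext dens_r tdens_r T_min_swap(1)[of \<beta> \<alpha> \<gamma>] by (simp add: extremal_config_def)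
  then show False using T_min_pos[OF ext] \<theta>(2) by simp
qed

text \<open>Uncrossing with all of the weight of \<open>i1\<close> leaves \<open>i1\<close> with
  weight 0. The non-edge \<open>j\<close>, \<open>k\<close> still needs a common neighbour of
  positive weight. The vertex \<open>i2\<close> misses \<open>j\<close>, and each new vertex misses
  \<open>j\<close> or \<open>k\<close> through its intersection, so the neighbour is another old
  vertex.\<close>

lemma crossing_common_neighbour_aux:
  assumes ext: "extremal_config \<alpha> \<beta> \<gamma> I J K x y z P Q R"
    and mem: "i1 \<in> I" "i2 \<in> I" "j \<in> J" "k \<in> K" and pos: "0 < x i1" "x i1 \<le> x i2" "0 < y j" "0 < z k"
    and cross: "P i1 j" "\<not> P i2 j" "Q i1 k" "\<not> Q i2 k"
  shows "\<exists>i\<in>I. i \<noteq> i1 \<and> P i j \<and> Q i k"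
proof -
  have "\<not> R j k" using no_crossing_edge[OF ext, of i1 i2 j k] assms by auto
  then obtain s where "s \<in> uncrossed_set I" "0 < uncrossed_weight x i1 i2 (x i1) s"
    "uncrossed_rel i1 i2 True P s j" "uncrossed_rel i1 i2 False Q s k"
    using nonedge_common_neighbour[OF extremal_config_uncross(1)[OF ext, of i1 i2 "x i1"], of j k] assms by auto
  then show ?thesis
    using cross by (auto simp: uncrossed_set_def uncrossed_weight_def uncrossed_rel_def split: if_splits)
qed

text \<open>The disjunction reflects that either of \<open>i1\<close> and \<open>i2\<close> may be
  the lighter one, whose weight can be used up.\<close>

lemma crossing_common_neighbour:
  assumes ext: "extremal_config \<alpha> \<beta> \<gamma> I J K x y z P Q R"
    and mem: "i1 \<in> I" "i2 \<in> I" "j1 \<in> J" "j2 \<in> J" "k1 \<in> K" "k2 \<in> K"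
    and pos: "0 < x i1" "0 < x i2" "0 < y j1" "0 < y j2" "0 < z k1" "0 < z k2"
    and cross: "P i1 j1" "\<not> P i2 j1" "Q i1 k1" "\<not> Q i2 k1" "P i2 j2" "\<not> P i1 j2" "Q i2 k2" "\<not> Q i1 k2"
  shows "(\<exists>i\<in>I. i \<noteq> i1 \<and> P i j1 \<and> Q i k1) \<or> (\<exists>i\<in>I. i \<noteq> i2 \<and> P i j2 \<and> Q i k2)"
  using crossing_common_neighbour_aux[OF ext, of i1 i2 j1 k1] crossing_common_neighbour_aux[OF ext, of i2 i1 j2 k2] assms
  by linarith

text \<open>Neighbourhoods of sizes \<open>b i\<close> and \<open>c i\<close> span at least
  \<open>\<alpha> + b i * c i - 1\<close> in edge weight. If they are constant towards
  \<open>J\<close>, then \<open>b i = \<gamma>\<close> for all \<open>i\<close>, and averaging gives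
  \<open>T_min \<ge> \<alpha> + \<beta> * \<gamma> - 1\<close>, against
  \<open>T_min_less\<close>.\<close>

lemma nbhd_not_constant:
  assumes ext: "extremal_config \<alpha> \<beta> \<gamma> I J K x y z P Q R"
  shows "\<exists>i\<in>I. \<exists>i'\<in>I. \<exists>j\<in>J. P i j \<noteq> P i' j"
proof (rule ccontr)
  assume const: "\<not> ?thesis"
  have prob: "prob I x" "prob J y" "prob K z" and dens: "dens J K y z (ind R) = \<alpha>"
    "dens I K x z (ind Q) = \<beta>" "dens I J x y (ind P) = \<gamma>"
    using ext by (auto simp: extremal_config_def)
  define b where "b i = (\<Sum>j\<in>J. y j * ind P i j)" for i
  define c where "c i = (\<Sum>k\<in>K. z k * ind Q i k)" for i
  have "I \<noteq> {}" using prob(1) by (auto simp: prob_def)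
  then obtain i0 where i0: "i0 \<in> I" by blast
  have "P i j \<longleftrightarrow> P i0 j" if "i \<in> I" "j \<in> J" for i j using const that i0 by blast
  then have "b i = b i0" if "i \<in> I" for i unfolding b_def using that by (intro sum.cong) simp_all
  then have b: "b i = \<gamma>" if "i \<in> I" for i
    using that dens(3) prob(1) by (simp add: dens_eq b_def[symmetric] sum_distrib_right[symmetric] prob_def)
  have "b i * c i - 1 + \<alpha> \<le> (\<Sum>j\<in>J. \<Sum>k\<in>K. y j * z k * (ind P i j * ind Q i k * ind R j k))" for i
  proof -
    have "b i * c i - 1 + \<alpha> = b i * c i - sum y J * sum z K + \<alpha>" using prob by (simp add: prob_def)
    also have "\<dots> = (\<Sum>j\<in>J. \<Sum>k\<in>K. y j * ind P i j * (z k * ind Q i k) - y j * z k + y j * z k * ind R j k)"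
      unfolding b_def c_def dens(1)[symmetric] dens_def sum_product sum.distrib sum_subtractf ..
    also have "\<dots> \<le> (\<Sum>j\<in>J. \<Sum>k\<in>K. y j * z k * (ind P i j * ind Q i k * ind R j k))"
      using prob by (intro sum_mono) (auto simp: prob_def of_bool_def)
    finally show ?thesis .
  qed
  then have "(\<Sum>i\<in>I. x i * (b i * c i - 1 + \<alpha>)) \<le> tdens I J K x y z (ind P) (ind Q) (ind R)"
    unfolding tdens_eq using prob(1) by (intro sum_mono mult_left_mono) (auto simp: prob_def)
  then have "(\<Sum>i\<in>I. x i * (b i * c i - 1 + \<alpha>)) \<le> T_min \<alpha> \<beta> \<gamma>"
    using ext by (simp add: extremal_config_def)
  moreover have "(\<Sum>i\<in>I. x i * (b i * c i - 1 + \<alpha>)) = (\<Sum>i\<in>I. \<gamma> * (x i * c i) + (\<alpha> - 1) * x i)"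
    using b by (intro sum.cong) (auto simp: algebra_simps)
  also have "\<dots> = \<gamma> * \<beta> + (\<alpha> - 1)"
    using prob dens(2) by (simp add: sum.distrib sum_distrib_left[symmetric] dens_eq c_def[symmetric] prob_def)
  ultimately show False
    using T_min_less[of \<alpha> \<beta> \<gamma>] ext by (simp add: extremal_config_def mult.commute)
qed

lemma doubly_deficient_vertex:
  assumes "extremal_config \<alpha> \<beta> \<gamma> I J K x y z P Q R"
  shows "(\<exists>i\<in>I. (\<exists>j\<in>J. \<not> P i j) \<and> (\<exists>k\<in>K. \<not> Q i k)) \<or> (\<exists>j\<in>J. (\<exists>i\<in>I. \<not> P i j) \<and> (\<exists>k\<in>K. \<not> R j k)) \<or>
    (\<exists>k\<in>K. (\<exists>i\<in>I. \<not> Q i k) \<and> (\<exists>j\<in>J. \<not> R j k))"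
proof (rule ccontr)
  assume no: "\<not> ?thesis"
  have "(\<alpha>, \<beta>, \<gamma>) \<in> R2_region" using assms by (simp add: extremal_config_def)
  note r = R2_regionD[OF this]
  have "0 \<le> Delta \<alpha> \<beta> \<gamma>"
  proof (rule Delta_nonneg[of I x J y K z P Q R])
    show "(\<forall>j\<in>J. P i j) \<or> (\<forall>k\<in>K. Q i k)" if "i \<in> I" for i using no that by blast
    show "(\<forall>i\<in>I. P i j) \<or> (\<forall>k\<in>K. R j k)" if "j \<in> J" for j using no that by blast
    show "(\<forall>i\<in>I. Q i k) \<or> (\<forall>j\<in>J. R j k)" if "k \<in> K" for k using no that by blast
  qed (use assms r in \<open>simp_all add: extremal_config_def\<close>)
  then show False using r by simp
qed

lemma triangle_exists:
  assumes "extremal_config \<alpha> \<beta> \<gamma> I J K x y z P Q R"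
  shows "\<exists>i\<in>I. \<exists>j\<in>J. \<exists>k\<in>K. P i j \<and> Q i k \<and> R j k"
proof (rule ccontr)
  assume "\<not> ?thesis"
  then have "tdens I J K x y z (ind P) (ind Q) (ind R) = 0" unfolding tdens_def by (intro sum.neutral ballI) auto
  then show False using T_min_pos[OF assms] assms by (simp add: extremal_config_def)
qed

section \<open>Vertex-minimal configurations: positive weights, class sizes and merging\<close>

definition minimal_config :: "real \<Rightarrow> real \<Rightarrow> real \<Rightarrow> 'i set \<Rightarrow> 'j set \<Rightarrow> 'k set \<Rightarrow>
    ('i \<Rightarrow> real) \<Rightarrow> ('j \<Rightarrow> real) \<Rightarrow> ('k \<Rightarrow> real) \<Rightarrow>
    ('i \<Rightarrow> 'j \<Rightarrow> bool) \<Rightarrow> ('i \<Rightarrow> 'k \<Rightarrow> bool) \<Rightarrow> ('j \<Rightarrow> 'k \<Rightarrow> bool) \<Rightarrow> bool" where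
  "minimal_config \<alpha> \<beta> \<gamma> I J K x y z P Q R \<longleftrightarrow> extremal_config \<alpha> \<beta> \<gamma> I J K x y z P Q R \<and>
    (\<forall>(G :: nat tripartition_graph) w. (G, w) \<in> Tri \<alpha> \<beta> \<gamma> \<longrightarrow> triangle_density (G, w) = T_min \<alpha> \<beta> \<gamma> \<longrightarrow>
      card I + card J + card K \<le> card (verts G))"

lemma minimal_config_swap_AB:
  assumes "minimal_config \<alpha> \<beta> \<gamma> I J K x y z P Q R"
  shows "minimal_config \<beta> \<alpha> \<gamma> J I K y x z (\<lambda>j i. P i j) R Q"
  unfolding minimal_config_def
proof (intro conjI allI impI)
  show "extremal_config \<beta> \<alpha> \<gamma> J I K y x z (\<lambda>j i. P i j) R Q"
    using assms extremal_config_swap_AB by (auto simp: minimal_config_def)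
  fix G :: "nat tripartition_graph" and w
  assume G: "(G, w) \<in> Tri \<beta> \<alpha> \<gamma>" "triangle_density (G, w) = T_min \<beta> \<alpha> \<gamma>"
  then have "tripartite G" by (simp add: Tri_def weighted_tripartite_def)
  then have "card I + card J + card K \<le> card (verts (swap_AB G))"
    using assms Tri_swap(1)[OF G(1)] G(2) triangle_density_swap(1)[of G w] T_min_swap(1)[of \<beta> \<alpha> \<gamma>]
    by (simp add: minimal_config_def)
  then show "card J + card I + card K \<le> card (verts G)" by (simp add: verts_swap)
qed

lemma minimal_config_swap_BC:
  assumes "minimal_config \<alpha> \<beta> \<gamma> I J K x y z P Q R"
  shows "minimal_config \<alpha> \<gamma> \<beta> I K J x z y Q P (\<lambda>k j. R j k)"
  unfolding minimal_config_def
proof (intro conjI allI impI)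
  show "extremal_config \<alpha> \<gamma> \<beta> I K J x z y Q P (\<lambda>k j. R j k)"
    using assms extremal_config_swap_BC by (auto simp: minimal_config_def)
  fix G :: "nat tripartition_graph" and w
  assume G: "(G, w) \<in> Tri \<alpha> \<gamma> \<beta>" "triangle_density (G, w) = T_min \<alpha> \<gamma> \<beta>"
  then have "tripartite G" by (simp add: Tri_def weighted_tripartite_def)
  then have "card I + card J + card K \<le> card (verts (swap_BC G))"
    using assms Tri_swap(2)[OF G(1)] G(2) triangle_density_swap(2)[of G w] T_min_swap(2)[of \<alpha> \<gamma> \<beta>]
    by (simp add: minimal_config_def)
  then show "card I + card K + card J \<le> card (verts G)" by (simp add: verts_swap)
qed

text \<open>However large \<open>I'\<close> is, \<open>realise_fractional\<close> rebuilds it with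
  at most three vertices. The resulting graph attains \<open>T_min\<close>, so minimality applies to
  it.\<close>

lemma minimal_config_card_le:
  assumes min: "minimal_config \<alpha> \<beta> \<gamma> I J K x y z P Q R"
    and prob: "prob I' x'" "prob J' y'" "prob K' z'"
    and p: "\<And>i j. i \<in> I' \<Longrightarrow> j \<in> J' \<Longrightarrow> 0 \<le> p i j \<and> p i j \<le> 1"
    and q: "\<And>i k. i \<in> I' \<Longrightarrow> k \<in> K' \<Longrightarrow> 0 \<le> q i k \<and> q i k \<le> 1"
    and dens: "dens J' K' y' z' (ind R') = \<alpha>" "dens I' K' x' z' q = \<beta>" "dens I' J' x' y' p = \<gamma>"
    and t: "tdens I' J' K' x' y' z' p q (ind R') \<le> T_min \<alpha> \<beta> \<gamma>"
  shows "card I + card J + card K \<le> 3 + card J' + card K'"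
proof -
  obtain G :: "nat tripartition_graph" and w where G: "(G, w) \<in> Tri \<alpha> \<beta> \<gamma>"
    "triangle_density (G, w) \<le> tdens I' J' K' x' y' z' p q (ind R')" "card (verts G) \<le> 3 + card J' + card K'"
    using realise_fractional[where p = p and q = q and R = R', OF prob p q] unfolding dens by blast
  have "triangle_density (G, w) = T_min \<alpha> \<beta> \<gamma>"
    using G(2) t T_min_le_triangle_density[OF G(1)] by simp
  then have "card I + card J + card K \<le> card (verts G)" using min G(1) unfolding minimal_config_def by blast
  then show ?thesis using G(3) by simp
qed

text \<open>The configuration competes with itself, only its first class being rebuilt.\<close>

lemma minimal_config_card_le_3:
  assumes "minimal_config \<alpha> \<beta> \<gamma> I J K x y z P Q R"
  shows "card I \<le> 3"
  using minimal_config_card_le[OF assms, of I x J y K z "ind P" "ind Q" R] assms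
  by (simp add: minimal_config_def extremal_config_def)

lemma minimal_config_pos:
  assumes min: "minimal_config \<alpha> \<beta> \<gamma> I J K x y z P Q R" and i: "i \<in> I"
  shows "0 < x i"
proof (rule ccontr)
  assume "\<not> 0 < x i"
  moreover have prob: "prob I x" "prob J y" "prob K z" using min by (auto simp: minimal_config_def extremal_config_def)
  ultimately have xi: "x i = 0" using i by (force simp: prob_def)
  have fin: "finite I" using prob by (simp add: prob_def)
  have drop: "(\<Sum>l\<in>I - {i}. x l * f l) = (\<Sum>l\<in>I. x l * f l)" for f
    using sum.remove[OF fin i, of "\<lambda>l. x l * f l"] xi by simp
  have "prob (I - {i}) x" using prob(1) drop[of "\<lambda>_. 1"] by (simp add: prob_def)
  then obtain G :: "nat tripartition_graph" and w where G:
    "(G, w) \<in> Tri (dens J K y z (ind R)) (dens (I - {i}) K x z (ind Q)) (dens (I - {i}) J x y (ind P))"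
    "triangle_density (G, w) = tdens (I - {i}) J K x y z (ind P) (ind Q) (ind R)"
    "card (verts G) = card (I - {i}) + card J + card K"
    using realise[OF _ prob(2,3), of "I - {i}" x R Q P] by blast
  then have "(G, w) \<in> Tri \<alpha> \<beta> \<gamma>" "triangle_density (G, w) = T_min \<alpha> \<beta> \<gamma>"
    using min by (simp_all add: dens_eq[of "I - {i}"] tdens_eq[of "I - {i}"] drop)
      (simp_all add: dens_eq[symmetric] tdens_eq[symmetric] minimal_config_def extremal_config_def)
  then have "card I + card J + card K \<le> card (I - {i}) + card J + card K"
    using min unfolding minimal_config_def G(3)[symmetric] by blast
  then show False using i fin card_Diff1_less[of I i] by simp
qed

definition row_of :: "'k set \<Rightarrow> ('j \<Rightarrow> 'k \<Rightarrow> bool) \<Rightarrow> 'j \<Rightarrow> 'k set" where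
  "row_of K R j = {k \<in> K. R j k}"

definition col_of :: "'j set \<Rightarrow> ('j \<Rightarrow> 'k \<Rightarrow> bool) \<Rightarrow> 'k \<Rightarrow> 'j set" where
  "col_of J R k = {j \<in> J. R j k}"

text \<open>Vertices of the second class with equal neighbourhoods in the third one can be merged, at the
  price of fractional adjacencies to the first class; likewise with the roles of the second and
  third class exchanged.\<close>

lemma minimal_config_rows_cols:
  assumes min: "minimal_config \<alpha> \<beta> \<gamma> I J K x y z P Q R"
  shows "card I + card J + card K \<le> 3 + card (row_of K R ` J) + card (col_of J R ` K)"
proof -
  let ?f = "row_of K R" and ?g = "col_of J R"
  have ext: "extremal_config \<alpha> \<beta> \<gamma> I J K x y z P Q R" using min by (simp add: minimal_config_def)
  then have prob: "prob I x" "prob J y" "prob K z" by (auto simp: extremal_config_def)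
  then have fin: "finite J" "finite K" and nn: "\<And>j. j \<in> J \<Longrightarrow> 0 \<le> y j" "\<And>k. k \<in> K \<Longrightarrow> 0 \<le> z k"
    by (auto simp: prob_def)
  have posJ: "0 < y j" if "j \<in> J" for j using minimal_config_pos[OF minimal_config_swap_AB[OF min] that] .
  have posK: "0 < z k" if "k \<in> K" for k
    using minimal_config_pos[OF minimal_config_swap_AB[OF minimal_config_swap_BC[OF min]] that] .
  define y' where "y' X = (\<Sum>j\<in>{j \<in> J. ?f j = X}. y j)" for X
  define z' where "z' Y = (\<Sum>k\<in>{k \<in> K. ?g k = Y}. z k)" for Y
  \<comment> \<open>The adjacency of a merged vertex is the weighted average over its fibre.\<close>
  define p where "p i X = (\<Sum>j\<in>{j \<in> J. ?f j = X}. y j * ind P i j) / y' X" for i X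
  define q where "q i Y = (\<Sum>k\<in>{k \<in> K. ?g k = Y}. z k * ind Q i k) / z' Y" for i Y
  define R' where "R' X Y \<longleftrightarrow> (\<exists>j\<in>J. \<exists>k\<in>K. ?f j = X \<and> ?g k = Y \<and> R j k)" for X Y
  \<comment> \<open>The relation is constant on fibres: equal rows allow \<open>j1\<close> to be
    replaced by \<open>j\<close>, and equal columns then allow \<open>k1\<close> to be replaced by
    \<open>k\<close>.\<close>
  have R': "R' (?f j) (?g k) \<longleftrightarrow> R j k" if "j \<in> J" "k \<in> K" for j k
  proof
    assume "R' (?f j) (?g k)"
    then obtain j1 k1 where jk1: "j1 \<in> J" "k1 \<in> K" "?f j1 = ?f j" "?g k1 = ?g k" "R j1 k1"
      by (auto simp: R'_def)
    have "k1 \<in> row_of K R j1" using jk1(2,5) by (simp add: row_of_def)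
    then have "R j k1" unfolding jk1(3) by (simp add: row_of_def)
    then have "j \<in> col_of J R k1" using that by (simp add: col_of_def)
    then show "R j k" unfolding jk1(4) by (simp add: col_of_def)
  qed (use that in \<open>auto simp: R'_def\<close>)
  have y'_pos: "0 < y' X" if "X \<in> ?f ` J" for X
    unfolding y'_def using that fin posJ by (intro sum_pos) auto
  have z'_pos: "0 < z' Y" if "Y \<in> ?g ` K" for Y
    unfolding z'_def using that fin posK by (intro sum_pos) auto
  have sumJ: "(\<Sum>X\<in>?f ` J. \<Sum>j\<in>{j \<in> J. ?f j = X}. a j) = sum a J" for a :: "'b \<Rightarrow> real"
    using fin sum.image_gen[of J a ?f] by simp
  have sumK: "(\<Sum>Y\<in>?g ` K. \<Sum>k\<in>{k \<in> K. ?g k = Y}. a k) = sum a K" for a :: "'c \<Rightarrow> real"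
    using fin sum.image_gen[of K a ?g] by simp
  \<comment> \<open>Used twice: with the plain weights for \<open>\<alpha>\<close>, and with the
    weights multiplied by the adjacencies to \<open>i\<close> for the triangles at \<open>i\<close>.
    Because \<open>R\<close> is constant on fibres, averaging \<open>P\<close> and \<open>Q\<close>
    separately keeps the triangle density.\<close>
  have fibres: "(\<Sum>X\<in>?f ` J. \<Sum>Y\<in>?g ` K. (\<Sum>j\<in>{j \<in> J. ?f j = X}. a j) * (\<Sum>k\<in>{k \<in> K. ?g k = Y}. b k) * ind R' X Y) =
      (\<Sum>j\<in>J. \<Sum>k\<in>K. a j * b k * ind R j k)" for a :: "'b \<Rightarrow> real" and b :: "'c \<Rightarrow> real"
  proof -
    have "(\<Sum>X\<in>?f ` J. \<Sum>Y\<in>?g ` K. (\<Sum>j\<in>{j \<in> J. ?f j = X}. a j) * (\<Sum>k\<in>{k \<in> K. ?g k = Y}. b k) * ind R' X Y) =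
        (\<Sum>X\<in>?f ` J. \<Sum>Y\<in>?g ` K. \<Sum>j\<in>{j \<in> J. ?f j = X}. \<Sum>k\<in>{k \<in> K. ?g k = Y}. a j * b k * ind R j k)"
    proof (intro sum.cong refl)
      fix X Y assume "X \<in> ?f ` J" "Y \<in> ?g ` K"
      have "(\<Sum>j\<in>{j \<in> J. ?f j = X}. a j) * (\<Sum>k\<in>{k \<in> K. ?g k = Y}. b k) * ind R' X Y =
          (\<Sum>j\<in>{j \<in> J. ?f j = X}. \<Sum>k\<in>{k \<in> K. ?g k = Y}. a j * b k * ind R' X Y)"
        unfolding sum_product by (simp only: sum_distrib_right)
      also have "\<dots> = (\<Sum>j\<in>{j \<in> J. ?f j = X}. \<Sum>k\<in>{k \<in> K. ?g k = Y}. a j * b k * ind R j k)"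
        by (intro sum.cong refl) (auto simp: R')
      finally show "(\<Sum>j\<in>{j \<in> J. ?f j = X}. a j) * (\<Sum>k\<in>{k \<in> K. ?g k = Y}. b k) * ind R' X Y =
          (\<Sum>j\<in>{j \<in> J. ?f j = X}. \<Sum>k\<in>{k \<in> K. ?g k = Y}. a j * b k * ind R j k)" .
    qed
    also have "\<dots> = (\<Sum>X\<in>?f ` J. \<Sum>j\<in>{j \<in> J. ?f j = X}. \<Sum>Y\<in>?g ` K. \<Sum>k\<in>{k \<in> K. ?g k = Y}. a j * b k * ind R j k)"
      by (intro sum.cong refl sum.swap)
    finally show ?thesis unfolding sumJ sumK .
  qed
  have yp: "y' X * p i X = (\<Sum>j\<in>{j \<in> J. ?f j = X}. y j * ind P i j)" if "X \<in> ?f ` J" for i X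
    using y'_pos[OF that] by (simp add: p_def)
  have zq: "z' Y * q i Y = (\<Sum>k\<in>{k \<in> K. ?g k = Y}. z k * ind Q i k)" if "Y \<in> ?g ` K" for i Y
    using z'_pos[OF that] by (simp add: q_def)
  show ?thesis
  proof (rule minimal_config_card_le[OF min, of I x _ y' _ z' p q R'])
    show "prob I x" by (fact prob(1))
    show "prob (?f ` J) y'" "prob (?g ` K) z'"
      using prob fin sumJ[of y] sumK[of z] y'_pos z'_pos by (auto simp: prob_def y'_def[symmetric] z'_def[symmetric] less_imp_le)
    show "0 \<le> p i X \<and> p i X \<le> 1" if "X \<in> ?f ` J" for i X
    proof -
      have "(\<Sum>j\<in>{j \<in> J. ?f j = X}. y j * ind P i j) \<le> y' X"
        unfolding y'_def using nn by (intro sum_mono) (auto simp: of_bool_def)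
      then show ?thesis using y'_pos[OF that] nn by (auto simp: p_def intro!: divide_nonneg_pos sum_nonneg)
    qed
    show "0 \<le> q i Y \<and> q i Y \<le> 1" if "Y \<in> ?g ` K" for i Y
    proof -
      have "(\<Sum>k\<in>{k \<in> K. ?g k = Y}. z k * ind Q i k) \<le> z' Y"
        unfolding z'_def using nn by (intro sum_mono) (auto simp: of_bool_def)
      then show ?thesis using z'_pos[OF that] nn by (auto simp: q_def intro!: divide_nonneg_pos sum_nonneg)
    qed
    show "dens (?f ` J) (?g ` K) y' z' (ind R') = \<alpha>"
      using fibres[of y z] ext by (simp add: dens_def y'_def z'_def extremal_config_def)
    show "dens I (?g ` K) x z' q = \<beta>"
      using ext by (simp add: dens_eq zq sumK extremal_config_def)
    show "dens I (?f ` J) x y' p = \<gamma>"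
      using ext by (simp add: dens_eq yp sumJ extremal_config_def)
    have "(\<Sum>X\<in>?f ` J. \<Sum>Y\<in>?g ` K. y' X * z' Y * (p i X * q i Y * ind R' X Y)) =
        (\<Sum>j\<in>J. \<Sum>k\<in>K. y j * z k * (ind P i j * ind Q i k * ind R j k))" for i
    proof -
      have "(\<Sum>X\<in>?f ` J. \<Sum>Y\<in>?g ` K. y' X * z' Y * (p i X * q i Y * ind R' X Y)) =
          (\<Sum>X\<in>?f ` J. \<Sum>Y\<in>?g ` K. (y' X * p i X) * (z' Y * q i Y) * ind R' X Y)"
        by (simp add: mult_ac)
      also have "\<dots> = (\<Sum>j\<in>J. \<Sum>k\<in>K. (y j * ind P i j) * (z k * ind Q i k) * ind R j k)"
        unfolding fibres[symmetric] by (intro sum.cong refl) (simp add: yp zq)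
      finally show ?thesis by (simp add: mult_ac)
    qed
    then show "tdens I (?f ` J) (?g ` K) x y' z' p q (ind R') \<le> T_min \<alpha> \<beta> \<gamma>"
      using ext by (simp add: tdens_eq extremal_config_def)
  qed
qed

text \<open>In \<open>minimal_config_rows_cols\<close> a class \<open>I\<close> of size 3 leaves no
  room for a merger; size 2 leaves room for one lost vertex in total, so at least one side is
  injective.\<close>

lemma minimal_config_inj:
  assumes "minimal_config \<alpha> \<beta> \<gamma> I J K x y z P Q R"
  shows "card I = 3 \<Longrightarrow> inj_on (row_of K R) J \<and> inj_on (col_of J R) K"
    and "card I = 2 \<Longrightarrow> inj_on (row_of K R) J \<or> inj_on (col_of J R) K"
proof -
  have fin: "finite J" "finite K" using assms by (auto simp: minimal_config_def extremal_config_def prob_def)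
  have le: "card (row_of K R ` J) \<le> card J" "card (col_of J R ` K) \<le> card K" using fin by (auto intro: card_image_le)
  note c = minimal_config_rows_cols[OF assms]
  show "inj_on (row_of K R) J \<and> inj_on (col_of J R) K" if "card I = 3"
    using le c that fin by (auto intro!: eq_card_imp_inj_on)
  show "inj_on (row_of K R) J \<or> inj_on (col_of J R) K" if "card I = 2"
  proof -
    have "card (row_of K R ` J) = card J \<or> card (col_of J R ` K) = card K" using le c that by linarith
    then show ?thesis
      using eq_card_imp_inj_on[OF fin(1), of "row_of K R"] eq_card_imp_inj_on[OF fin(2), of "col_of J R"] by blast
  qed
qed

subsection \<open>Combinatorial classification\<close>

text \<open>The six clauses are \<open>triangle_nbhd_mono\<close> for the six ways of assigning its
  roles to the three classes.\<close>

definition triangle_mono :: "'i set \<Rightarrow> 'j set \<Rightarrow> 'k set \<Rightarrow>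
    ('i \<Rightarrow> 'j \<Rightarrow> bool) \<Rightarrow> ('i \<Rightarrow> 'k \<Rightarrow> bool) \<Rightarrow> ('j \<Rightarrow> 'k \<Rightarrow> bool) \<Rightarrow> bool" where
  "triangle_mono I J K P Q R \<longleftrightarrow> (\<forall>i\<in>I. \<forall>j\<in>J. \<forall>k\<in>K. P i j \<longrightarrow> Q i k \<longrightarrow> R j k \<longrightarrow>
    (\<forall>j'\<in>J. \<forall>l\<in>K. \<not> P i j' \<longrightarrow> R j l \<longrightarrow> R j' l) \<and>
    (\<forall>i'\<in>I. \<forall>l\<in>K. \<not> P i' j \<longrightarrow> Q i l \<longrightarrow> Q i' l) \<and>
    (\<forall>k'\<in>K. \<forall>l\<in>J. \<not> Q i k' \<longrightarrow> R l k \<longrightarrow> R l k') \<and>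
    (\<forall>i'\<in>I. \<forall>l\<in>J. \<not> Q i' k \<longrightarrow> P i l \<longrightarrow> P i' l) \<and>
    (\<forall>k'\<in>K. \<forall>l\<in>I. \<not> R j k' \<longrightarrow> Q l k \<longrightarrow> Q l k') \<and>
    (\<forall>j'\<in>J. \<forall>l\<in>I. \<not> R j' k \<longrightarrow> P l j \<longrightarrow> P l j'))"

definition common_nbrs :: "'i set \<Rightarrow> 'j set \<Rightarrow> 'k set \<Rightarrow>
    ('i \<Rightarrow> 'j \<Rightarrow> bool) \<Rightarrow> ('i \<Rightarrow> 'k \<Rightarrow> bool) \<Rightarrow> ('j \<Rightarrow> 'k \<Rightarrow> bool) \<Rightarrow> bool" where
  "common_nbrs I J K P Q R \<longleftrightarrow>
    (\<forall>i\<in>I. \<forall>j\<in>J. P i j \<or> (\<exists>k\<in>K. Q i k \<and> R j k)) \<and>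
    (\<forall>i\<in>I. \<forall>k\<in>K. Q i k \<or> (\<exists>j\<in>J. P i j \<and> R j k)) \<and>
    (\<forall>j\<in>J. \<forall>k\<in>K. R j k \<or> (\<exists>i\<in>I. P i j \<and> Q i k))"

definition doubly_deficient :: "'i set \<Rightarrow> 'j set \<Rightarrow> 'k set \<Rightarrow>
    ('i \<Rightarrow> 'j \<Rightarrow> bool) \<Rightarrow> ('i \<Rightarrow> 'k \<Rightarrow> bool) \<Rightarrow> ('j \<Rightarrow> 'k \<Rightarrow> bool) \<Rightarrow> bool" where
  "doubly_deficient I J K P Q R \<longleftrightarrow>
    (\<exists>i\<in>I. (\<exists>j\<in>J. \<not> P i j) \<and> (\<exists>k\<in>K. \<not> Q i k)) \<or> (\<exists>j\<in>J. (\<exists>i\<in>I. \<not> P i j) \<and> (\<exists>k\<in>K. \<not> R j k)) \<or>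
    (\<exists>k\<in>K. (\<exists>i\<in>I. \<not> Q i k) \<and> (\<exists>j\<in>J. \<not> R j k))"

definition differ :: "'j \<Rightarrow> 'j \<Rightarrow> 'k set \<Rightarrow> ('j \<Rightarrow> 'k \<Rightarrow> bool) \<Rightarrow> bool" where
  "differ j1 j2 K R \<longleftrightarrow> (\<exists>k\<in>K. R j1 k \<noteq> R j2 k)"

definition differ3 :: "'j \<Rightarrow> 'j \<Rightarrow> 'j \<Rightarrow> 'k set \<Rightarrow> ('j \<Rightarrow> 'k \<Rightarrow> bool) \<Rightarrow> bool" where
  "differ3 j1 j2 j3 K R \<longleftrightarrow> differ j1 j2 K R \<and> differ j1 j3 K R \<and> differ j2 j3 K R"

text \<open>In a class of three, the vertex provided by \<open>crossing_common_neighbour\<close>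
  must be \<open>i3\<close>, since each of \<open>i1\<close> and \<open>i2\<close> misses the
  relevant vertices of the other.\<close>

definition crossing_common :: "'i \<Rightarrow> 'i \<Rightarrow> 'i \<Rightarrow> 'j set \<Rightarrow> 'k set \<Rightarrow>
    ('i \<Rightarrow> 'j \<Rightarrow> bool) \<Rightarrow> ('i \<Rightarrow> 'k \<Rightarrow> bool) \<Rightarrow> bool" where
  "crossing_common i1 i2 i3 J K P Q \<longleftrightarrow> (\<forall>j1\<in>J. \<forall>j2\<in>J. \<forall>k1\<in>K. \<forall>k2\<in>K.
    P i1 j1 \<longrightarrow> \<not> P i2 j1 \<longrightarrow> Q i1 k1 \<longrightarrow> \<not> Q i2 k1 \<longrightarrow> P i2 j2 \<longrightarrow> \<not> P i1 j2 \<longrightarrow> Q i2 k2 \<longrightarrow> \<not> Q i1 k2 \<longrightarrow>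
    P i3 j1 \<and> Q i3 k1 \<or> P i3 j2 \<and> Q i3 k2)"

text \<open>Patterns take three separate relations, so that one pattern serves for every assignment
  of the classes of the target graph to \<open>I\<close>, \<open>J\<close> and
  \<open>K\<close>.\<close>

definition H7_pattern where
  "H7_pattern P Q R a1 a2 b1 b2 c1 c2 c3 \<longleftrightarrow>
    P a1 b1 \<and> P a1 b2 \<and> \<not> P a2 b1 \<and> P a2 b2 \<and>
    Q a1 c1 \<and> \<not> Q a1 c2 \<and> \<not> Q a1 c3 \<and> Q a2 c1 \<and> Q a2 c2 \<and> Q a2 c3 \<and>
    R b1 c1 \<and> R b1 c2 \<and> R b1 c3 \<and> \<not> R b2 c1 \<and> \<not> R b2 c2 \<and> R b2 c3"

definition H7'_pattern where
  "H7'_pattern P Q R a1 a2 b1 b2 b3 c1 c2 \<longleftrightarrow>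
    P a1 b1 \<and> P a1 b2 \<and> P a1 b3 \<and> \<not> P a2 b1 \<and> P a2 b2 \<and> P a2 b3 \<and>
    Q a1 c1 \<and> \<not> Q a1 c2 \<and> Q a2 c1 \<and> Q a2 c2 \<and>
    R b1 c1 \<and> R b1 c2 \<and> \<not> R b2 c1 \<and> R b2 c2 \<and> \<not> R b3 c1 \<and> \<not> R b3 c2"

definition H9_pattern where
  "H9_pattern P Q R a1 a2 a3 b1 b2 b3 c1 c2 c3 \<longleftrightarrow>
    P a1 b1 \<and> P a1 b2 \<and> P a1 b3 \<and> \<not> P a2 b1 \<and> P a2 b2 \<and> \<not> P a2 b3 \<and> \<not> P a3 b1 \<and> P a3 b2 \<and> P a3 b3 \<and>
    Q a1 c1 \<and> \<not> Q a1 c2 \<and> \<not> Q a1 c3 \<and> Q a2 c1 \<and> Q a2 c2 \<and> Q a2 c3 \<and> Q a3 c1 \<and> Q a3 c2 \<and> \<not> Q a3 c3 \<and>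
    R b1 c1 \<and> R b1 c2 \<and> R b1 c3 \<and> \<not> R b2 c1 \<and> \<not> R b2 c2 \<and> R b2 c3 \<and> \<not> R b3 c1 \<and> R b3 c2 \<and> R b3 c3"

text \<open>Three further graphs survive the combinatorial conditions; they are excluded because their
  triangle density violates one of the upper bounds on \<open>T_min\<close>.\<close>

definition spurious1 where
  "spurious1 P Q R a1 a2 b1 b2 c1 c2 c3 \<longleftrightarrow>
    \<not> P a1 b1 \<and> \<not> P a1 b2 \<and> \<not> P a2 b1 \<and> P a2 b2 \<and>
    Q a1 c1 \<and> Q a1 c2 \<and> Q a1 c3 \<and> \<not> Q a2 c1 \<and> Q a2 c2 \<and> Q a2 c3 \<and>
    R b1 c1 \<and> R b1 c2 \<and> R b1 c3 \<and> R b2 c1 \<and> \<not> R b2 c2 \<and> R b2 c3"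

definition spurious2 where
  "spurious2 P Q R a1 a2 b1 b2 c1 c2 c3 \<longleftrightarrow>
    \<not> P a1 b1 \<and> P a1 b2 \<and> P a2 b1 \<and> P a2 b2 \<and>
    \<not> Q a1 c1 \<and> Q a1 c2 \<and> Q a1 c3 \<and> \<not> Q a2 c1 \<and> \<not> Q a2 c2 \<and> \<not> Q a2 c3 \<and>
    R b1 c1 \<and> R b1 c2 \<and> R b1 c3 \<and> R b2 c1 \<and> \<not> R b2 c2 \<and> R b2 c3"

definition spurious3 where
  "spurious3 P Q R a1 a2 b1 b2 c1 c2 c3 \<longleftrightarrow>
    \<not> P a1 b1 \<and> P a1 b2 \<and> P a2 b1 \<and> P a2 b2 \<and>
    \<not> Q a1 c1 \<and> Q a1 c2 \<and> Q a1 c3 \<and> \<not> Q a2 c1 \<and> \<not> Q a2 c2 \<and> Q a2 c3 \<and>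
    R b1 c1 \<and> R b1 c2 \<and> R b1 c3 \<and> R b2 c1 \<and> \<not> R b2 c2 \<and> \<not> R b2 c3"

text \<open>Over listed classes these rules expand all bounded quantifiers, which leaves goals that
  are propositional in the adjacencies. Below, \<open>a1\<close>, \<open>b1\<close>,
  \<open>c1\<close> is always a triangle; naming it breaks most of the symmetry.\<close>

lemmas config_expand = triangle_mono_def common_nbrs_def doubly_deficient_def differ3_def differ_def
  crossing_common_def H7_pattern_def H7'_pattern_def H9_pattern_def spurious1_def spurious2_def spurious3_def
  ball_simps bex_simps ball_empty bex_empty prod.case

lemma no_222:
  fixes a1 a2 :: 'i and b1 b2 :: 'j and c1 c2 :: 'k
    and I J K
  defines "I \<equiv> {a1, a2}" and "J \<equiv> {b1, b2}" and "K \<equiv> {c1, c2}"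
  assumes "triangle_mono I J K P Q R" "common_nbrs I J K P Q R" "doubly_deficient I J K P Q R"
    and "P a1 b1" "Q a1 c1" "R b1 c1"
    and "differ a1 a2 J P" "differ a1 a2 K Q" "differ b1 b2 I (\<lambda>b a. P a b)" "differ b1 b2 K R"
      "differ c1 c2 I (\<lambda>c a. Q a c)" "differ c1 c2 J (\<lambda>c b. R b c)"
  shows False
  using assms(4-) unfolding I_def J_def K_def config_expand by sat

lemma no_233:
  fixes a1 a2 :: 'i and b1 b2 b3 :: 'j and c1 c2 c3 :: 'k
    and I J K
  defines "I \<equiv> {a1, a2}" and "J \<equiv> {b1, b2, b3}" and "K \<equiv> {c1, c2, c3}"
  assumes "triangle_mono I J K P Q R" "common_nbrs I J K P Q R"
    and "P a1 b1" "Q a1 c1" "R b1 c1"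
    and "differ a1 a2 J P" "differ3 b1 b2 b3 I (\<lambda>b a. P a b)" "differ a1 a2 K Q"
      "differ3 c1 c2 c3 I (\<lambda>c a. Q a c)" "differ3 b1 b2 b3 K R \<or> differ3 c1 c2 c3 J (\<lambda>c b. R b c)"
  shows False
  using assms(4-) unfolding I_def J_def K_def config_expand by sat

text \<open>\<open>H7\<close> and \<open>H7'\<close> each contain exactly two triangles, and their
  disjuncts come in pairs according to which of the two is \<open>a1\<close>, \<open>b1\<close>,
  \<open>c1\<close>. The pair \<open>(u, v)\<close> orders the remaining vertices of the class of
  size three; \<open>H7'\<close> appears twice since either class of size two can play its first
  class.\<close>

lemma classification_223:
  fixes a1 a2 :: 'i and b1 b2 :: 'j and c1 c2 c3 :: 'k
    and I J K
  defines "I \<equiv> {a1, a2}" and "J \<equiv> {b1, b2}" and "K \<equiv> {c1, c2, c3}"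
  assumes "triangle_mono I J K P Q R" "common_nbrs I J K P Q R" "doubly_deficient I J K P Q R"
    and "P a1 b1" "Q a1 c1" "R b1 c1"
    and "differ a1 a2 J P" "differ b1 b2 I (\<lambda>b a. P a b)"
      "differ a1 a2 K Q" "differ c1 c2 I (\<lambda>c a. Q a c) \<or> differ c1 c3 I (\<lambda>c a. Q a c)"
      "differ b1 b2 K R" "differ c1 c2 J (\<lambda>c b. R b c) \<or> differ c1 c3 J (\<lambda>c b. R b c)"
  shows "\<exists>(u, v) \<in> {(c2, c3), (c3, c2)}.
    H7_pattern P Q R a1 a2 b1 b2 c1 u v \<or> H7_pattern P Q R a2 a1 b2 b1 u v c1 \<or>
    H7'_pattern Q P (\<lambda>c b. R b c) a1 a2 c1 u v b1 b2 \<or> H7'_pattern Q P (\<lambda>c b. R b c) a2 a1 u c1 v b2 b1 \<or>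
    H7'_pattern R (\<lambda>b a. P a b) (\<lambda>c a. Q a c) b1 b2 c1 u v a1 a2 \<or>
    H7'_pattern R (\<lambda>b a. P a b) (\<lambda>c a. Q a c) b2 b1 u c1 v a2 a1 \<or>
    spurious1 P Q R a2 a1 b2 b1 u v c1 \<or>
    spurious2 P Q R a1 a2 b2 b1 u v c1 \<or> spurious2 (\<lambda>b a. P a b) R Q b1 b2 a2 a1 u v c1 \<or>
    spurious3 P Q R a2 a1 b1 b2 u v c1 \<or> spurious3 (\<lambda>b a. P a b) R Q b2 b1 a1 a2 u v c1"
  using assms(4-) unfolding I_def J_def K_def config_expand by sat

text \<open>\<open>H9\<close> contains exactly three triangles; the three disjuncts identify
  \<open>a1\<close>, \<open>b1\<close>, \<open>c1\<close> with one of them.\<close>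

lemma classification_333:
  fixes a1 a2 a3 :: 'i and b1 b2 b3 :: 'j and c1 c2 c3 :: 'k
    and I J K
  defines "I \<equiv> {a1, a2, a3}" and "J \<equiv> {b1, b2, b3}" and "K \<equiv> {c1, c2, c3}"
  assumes "triangle_mono I J K P Q R" "common_nbrs I J K P Q R"
    and "P a1 b1" "Q a1 c1" "R b1 c1"
    and "differ3 a1 a2 a3 J P" "differ3 a1 a2 a3 K Q" "differ3 b1 b2 b3 I (\<lambda>b a. P a b)" "differ3 b1 b2 b3 K R"
      "differ3 c1 c2 c3 I (\<lambda>c a. Q a c)" "differ3 c1 c2 c3 J (\<lambda>c b. R b c)"
    and "crossing_common a1 a2 a3 J K P Q" "crossing_common a1 a3 a2 J K P Q" "crossing_common a2 a3 a1 J K P Q"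
  shows "\<exists>(s, s') \<in> {(a2, a3), (a3, a2)}. \<exists>(t, t') \<in> {(b2, b3), (b3, b2)}. \<exists>(u, u') \<in> {(c2, c3), (c3, c2)}.
    H9_pattern P Q R a1 s s' b1 t t' c1 u u' \<or> H9_pattern P Q R s s' a1 t t' b1 u c1 u' \<or>
    H9_pattern P Q R s a1 s' t b1 t' u u' c1"
  using assms(4-) unfolding I_def J_def K_def config_expand by sat

subsection \<open>Minimal configurations\<close>

lemma T_min_less_perms:
  assumes "(\<alpha>, \<beta>, \<gamma>) \<in> R2_region"
  shows "T_min \<alpha> \<beta> \<gamma> < \<alpha> + \<beta> * \<gamma> - 1" "T_min \<alpha> \<beta> \<gamma> < \<beta> + \<alpha> * \<gamma> - 1" "T_min \<alpha> \<beta> \<gamma> < \<gamma> + \<alpha> * \<beta> - 1"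
  using T_min_less[OF assms] T_min_less[OF R2_region_swap(1)[OF assms]]
    T_min_less[OF R2_region_swap(1)[OF R2_region_swap(2)[OF assms]]]
    T_min_swap(1)[of \<beta> \<alpha> \<gamma>] T_min_swap(1)[of \<gamma> \<alpha> \<beta>] T_min_swap(2)[of \<alpha> \<gamma> \<beta>]
  by simp_all

text \<open>The two bounds amount to \<open>z2 < x2 * z1\<close> and \<open>z1 < y2 * z2\<close>,
  which is absurd for factors at most 1.\<close>

lemma spurious1_real:
  fixes x2 y2 z1 z2 z3 :: real
  assumes "0 \<le> x2" "x2 \<le> 1" "0 \<le> y2" "y2 \<le> 1" "0 \<le> z1" "0 \<le> z2" "z1 + z2 + z3 = 1"
    and \<alpha>: "\<alpha> = 1 - y2 * z2" and \<beta>: "\<beta> = 1 - x2 * z1" and \<gamma>: "\<gamma> = x2 * y2"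
    and V: "x2 * y2 * z3 < \<alpha> + \<beta> * \<gamma> - 1" "x2 * y2 * z3 < \<beta> + \<alpha> * \<gamma> - 1"
  shows False
proof -
  have z3: "z3 = 1 - z1 - z2" using assms by simp
  have "(1 - x2) * (y2 * (z2 - x2 * z1)) < 0" "(1 - y2) * (x2 * (z1 - y2 * z2)) < 0"
    using V unfolding \<alpha> \<beta> \<gamma> z3 by (simp_all add: algebra_simps)
  then have "z2 < x2 * z1" "z1 < y2 * z2" using assms by (auto simp: mult_less_0_iff)
  moreover have "x2 * z1 \<le> z1" "y2 * z2 \<le> z2" using assms by (simp_all add: mult_left_le_one_le)
  ultimately show False by simp
qed

text \<open>The two bounds amount to \<open>1 - \<alpha> < \<beta> * y\<close> and
  \<open>y < 1 - \<alpha>\<close>, which is absurd since \<open>\<beta> \<le> 1\<close>. The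
  parameters fit both remaining graphs: \<open>u\<close> is \<open>x a1\<close> for the second and
  \<open>1 - z c1\<close> for the third, there with \<open>\<alpha>\<close> and
  \<open>\<gamma>\<close> exchanged.\<close>

lemma spurious2_real:
  fixes u y \<beta> :: real
  assumes "u \<le> 1" "0 \<le> y" "\<beta> \<le> u" "\<beta> \<le> 1"
    and t: "t = \<beta> - \<beta> * y - u * (1 - \<alpha>)" and \<gamma>: "\<gamma> = 1 - u * y"
    and V: "t < \<alpha> + \<beta> * \<gamma> - 1" "t < \<gamma> + \<alpha> * \<beta> - 1"
  shows False
proof -
  have "(1 - u) * (1 - \<alpha> - \<beta> * y) < 0" "(u - \<beta>) * (y - (1 - \<alpha>)) < 0"
    using V unfolding t \<gamma> by (simp_all add: algebra_simps)
  then have "1 - \<alpha> < \<beta> * y" "y < 1 - \<alpha>" using assms by (auto simp: mult_less_0_iff)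
  moreover have "\<beta> * y \<le> y" using assms mult_right_mono[of \<beta> 1 y] by simp
  ultimately show False by simp
qed

lemma not_spurious:
  assumes ext: "extremal_config \<alpha> \<beta> \<gamma> {a1, a2} {b1, b2} {c1, c2, c3} x y z P Q R"
    and "a1 \<noteq> a2" "b1 \<noteq> b2" "distinct [c1, c2, c3]"
  shows "\<not> spurious1 P Q R a1 a2 b1 b2 c1 c2 c3" "\<not> spurious2 P Q R a1 a2 b1 b2 c1 c2 c3"
    "\<not> spurious3 P Q R a1 a2 b1 b2 c1 c2 c3"
proof -
  have sums: "x a1 + x a2 = 1" "y b1 + y b2 = 1" "z c1 + z c2 + z c3 = 1"
    and nn: "0 \<le> x a1" "0 \<le> x a2" "0 \<le> y b1" "0 \<le> y b2" "0 \<le> z c1" "0 \<le> z c2" "0 \<le> z c3"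
    using assms by (auto simp: extremal_config_def prob_def)
  have x1: "x a1 = 1 - x a2" and y1: "y b1 = 1 - y b2" and z1: "z c1 = 1 - z c2 - z c3" using sums by auto
  have "(\<alpha>, \<beta>, \<gamma>) \<in> R2_region" using ext by (simp add: extremal_config_def)
  note V = T_min_less_perms[OF this]
  have \<alpha>: "\<alpha> = dens {b1, b2} {c1, c2, c3} y z (ind R)" and \<beta>: "\<beta> = dens {a1, a2} {c1, c2, c3} x z (ind Q)"
    and \<gamma>: "\<gamma> = dens {a1, a2} {b1, b2} x y (ind P)"
    and t: "T_min \<alpha> \<beta> \<gamma> = tdens {a1, a2} {b1, b2} {c1, c2, c3} x y z (ind P) (ind Q) (ind R)"
    using ext by (auto simp: extremal_config_def)
  have le: "x a2 \<le> 1" "y b2 \<le> 1" "x a1 \<le> 1" "y b1 \<le> 1" using sums nn by auto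
  show "\<not> spurious1 P Q R a1 a2 b1 b2 c1 c2 c3"
  proof
    assume s: "spurious1 P Q R a1 a2 b1 b2 c1 c2 c3"
    have "\<alpha> = 1 - y b2 * z c2" "\<beta> = 1 - x a2 * z c1" "\<gamma> = x a2 * y b2" "T_min \<alpha> \<beta> \<gamma> = x a2 * y b2 * z c3"
      unfolding t unfolding \<alpha> \<beta> \<gamma> using s assms(2-4)
      by (simp_all add: spurious1_def dens_def tdens_def x1 y1 z1) (simp_all add: algebra_simps)
    then show False using spurious1_real[of "x a2" "y b2" "z c1" "z c2" "z c3"] nn le sums V by simp
  qed
  show "\<not> spurious2 P Q R a1 a2 b1 b2 c1 c2 c3"
  proof
    assume s: "spurious2 P Q R a1 a2 b1 b2 c1 c2 c3"
    have \<alpha>': "\<alpha> = 1 - y b2 * z c2" and \<beta>': "\<beta> = x a1 * (z c2 + z c3)" and \<gamma>': "\<gamma> = 1 - x a1 * y b1"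
      and t': "T_min \<alpha> \<beta> \<gamma> = x a1 * y b2 * z c3"
      unfolding t unfolding \<alpha> \<beta> \<gamma> using s assms(2-4)
      by (simp_all add: spurious2_def dens_def tdens_def x1 y1 z1) (simp_all add: algebra_simps)
    have "T_min \<alpha> \<beta> \<gamma> = \<beta> - \<beta> * y b1 - x a1 * (1 - \<alpha>)"
      unfolding t' unfolding \<alpha>' \<beta>' y1 by (simp add: algebra_simps)
    moreover have "\<beta> \<le> x a1" unfolding \<beta>' using nn sums by (intro mult_right_le_one_le) auto
    ultimately show False using spurious2_real[of "x a1" "y b1" \<beta> "T_min \<alpha> \<beta> \<gamma>" \<alpha> \<gamma>] nn le V \<gamma>' by simp
  qed
  show "\<not> spurious3 P Q R a1 a2 b1 b2 c1 c2 c3"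
  proof
    assume s: "spurious3 P Q R a1 a2 b1 b2 c1 c2 c3"
    have \<alpha>': "\<alpha> = 1 - (1 - z c1) * y b2" and \<beta>': "\<beta> = 1 - z c1 - x a2 * z c2" and \<gamma>': "\<gamma> = 1 - x a1 * y b1"
      and t': "T_min \<alpha> \<beta> \<gamma> = x a2 * y b1 * z c3"
      unfolding t unfolding \<alpha> \<beta> \<gamma> using s assms(2-4)
      by (simp_all add: spurious3_def dens_def tdens_def x1 y1 z1) (simp_all add: algebra_simps)
    have "T_min \<alpha> \<beta> \<gamma> = \<beta> - \<beta> * y b2 - (1 - z c1) * (1 - \<gamma>)"
      unfolding t' unfolding \<gamma>' \<beta>' x1 y1 z1 by (simp add: algebra_simps)
    moreover have "\<beta> \<le> 1 - z c1" unfolding \<beta>' using nn by simp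
    ultimately show False
      using spurious2_real[of "1 - z c1" "y b2" \<beta> "T_min \<alpha> \<beta> \<gamma>" \<gamma> \<alpha>] nn le V \<alpha>' by (simp add: mult.commute)
  qed
qed

lemma minimal_config_triangle_mono:
  assumes min: "minimal_config \<alpha> \<beta> \<gamma> I J K x y z P Q R"
  shows "triangle_mono I J K P Q R"
proof -
  have ext: "extremal_config \<alpha> \<beta> \<gamma> I J K x y z P Q R" using min by (simp add: minimal_config_def)
  have I: "0 < x i" if "i \<in> I" for i using minimal_config_pos[OF min that] .
  have J: "0 < y j" if "j \<in> J" for j using minimal_config_pos[OF minimal_config_swap_AB[OF min] that] .
  have K: "0 < z k" if "k \<in> K" for k
    using minimal_config_pos[OF minimal_config_swap_AB[OF minimal_config_swap_BC[OF min]] that] .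
  note AB = extremal_config_swap_AB and BC = extremal_config_swap_BC
  show ?thesis
    unfolding triangle_mono_def
  proof (intro ballI impI conjI)
    fix i j k assume m: "i \<in> I" "j \<in> J" "k \<in> K" and t: "P i j" "Q i k" "R j k"
    show "R j' l" if "j' \<in> J" "l \<in> K" "\<not> P i j'" "R j l" for j' l
      using triangle_nbhd_mono[OF BC[OF AB[OF BC[OF ext]]], of k l j j' i] that m t I J K by blast
    show "Q i' l" if "i' \<in> I" "l \<in> K" "\<not> P i' j" "Q i l" for i' l
      using triangle_nbhd_mono[OF AB[OF BC[OF ext]], of k l i i' j] that m t I J K by blast
    show "R l k'" if "k' \<in> K" "l \<in> J" "\<not> Q i k'" "R l k" for k' l
      using triangle_nbhd_mono[OF BC[OF AB[OF ext]], of j l k k' i] that m t I J K by blast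
    show "P i' l" if "i' \<in> I" "l \<in> J" "\<not> Q i' k" "P i l" for i' l
      using triangle_nbhd_mono[OF AB[OF ext], of j l i i' k] that m t I J K by blast
    show "Q l k'" if "k' \<in> K" "l \<in> I" "\<not> R j k'" "Q l k" for k' l
      using triangle_nbhd_mono[OF BC[OF ext], of i l k k' j] that m t I J K by blast
    show "P l j'" if "j' \<in> J" "l \<in> I" "\<not> R j' k" "P l j" for j' l
      using triangle_nbhd_mono[OF ext, of i l j j' k] that m t I J K by blast
  qed
qed

lemma minimal_config_common_nbrs:
  assumes min: "minimal_config \<alpha> \<beta> \<gamma> I J K x y z P Q R"
  shows "common_nbrs I J K P Q R"
proof -
  have ext: "extremal_config \<alpha> \<beta> \<gamma> I J K x y z P Q R" using min by (simp add: minimal_config_def)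
  have I: "0 < x i" if "i \<in> I" for i using minimal_config_pos[OF min that] .
  have J: "0 < y j" if "j \<in> J" for j using minimal_config_pos[OF minimal_config_swap_AB[OF min] that] .
  have K: "0 < z k" if "k \<in> K" for k
    using minimal_config_pos[OF minimal_config_swap_AB[OF minimal_config_swap_BC[OF min]] that] .
  show ?thesis
    unfolding common_nbrs_def
    using nonedge_common_neighbour[OF ext] nonedge_common_neighbour[OF extremal_config_swap_AB[OF ext]]
      nonedge_common_neighbour[OF extremal_config_swap_AB[OF extremal_config_swap_BC[OF ext]]] I J K
    by meson
qed

lemma minimal_config_differ:
  assumes "minimal_config \<alpha> \<beta> \<gamma> {a1, a2} J K x y z P Q R"
  shows "differ a1 a2 J P" "differ a1 a2 K Q"
proof -
  have ext: "extremal_config \<alpha> \<beta> \<gamma> {a1, a2} J K x y z P Q R" using assms by (simp add: minimal_config_def)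
  show "differ a1 a2 J P" "differ a1 a2 K Q"
    unfolding differ_def
    using nbhd_not_constant[OF ext] nbhd_not_constant[OF extremal_config_swap_BC[OF ext]] by blast+
qed

lemma minimal_config_differ_or:
  assumes "minimal_config \<alpha> \<beta> \<gamma> {a1, a2, a3} J K x y z P Q R"
  shows "differ a1 a2 J P \<or> differ a1 a3 J P" "differ a1 a2 K Q \<or> differ a1 a3 K Q"
proof -
  have ext: "extremal_config \<alpha> \<beta> \<gamma> {a1, a2, a3} J K x y z P Q R" using assms by (simp add: minimal_config_def)
  show "differ a1 a2 J P \<or> differ a1 a3 J P" "differ a1 a2 K Q \<or> differ a1 a3 K Q"
    unfolding differ_def
    using nbhd_not_constant[OF ext] nbhd_not_constant[OF extremal_config_swap_BC[OF ext]] by blast+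
qed

lemma minimal_config_card_ge_2:
  assumes "minimal_config \<alpha> \<beta> \<gamma> I J K x y z P Q R"
  shows "2 \<le> card I"
proof -
  have ext: "extremal_config \<alpha> \<beta> \<gamma> I J K x y z P Q R" using assms by (simp add: minimal_config_def)
  obtain i i' where "i \<in> I" "i' \<in> I" "i \<noteq> i'" using nbhd_not_constant[OF ext] by blast
  then have "card {i, i'} \<le> card I" using ext by (intro card_mono) (auto simp: extremal_config_def prob_def)
  then show ?thesis using \<open>i \<noteq> i'\<close> by simp
qed

lemma inj_row_of_differ3:
  assumes "distinct [b1, b2, b3]" "inj_on (row_of K R) {b1, b2, b3}"
  shows "differ3 b1 b2 b3 K R"
proof -
  have "differ j j' K R" if "j \<in> {b1, b2, b3}" "j' \<in> {b1, b2, b3}" "j \<noteq> j'" for j j'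
    using inj_onD[OF assms(2), of j j'] that unfolding differ_def row_of_def by blast
  then show ?thesis using assms(1) by (simp add: differ3_def)
qed

lemma inj_col_of_differ3:
  assumes "distinct [c1, c2, c3]" "inj_on (col_of J R) {c1, c2, c3}"
  shows "differ3 c1 c2 c3 J (\<lambda>c b. R b c)"
  using inj_row_of_differ3[OF assms(1), of J "\<lambda>c b. R b c"] assms(2) by (simp add: row_of_def col_of_def)

lemma card2_label:
  assumes "card S = 2" "a \<in> S"
  obtains b where "S = {a, b}" "a \<noteq> b"
  using assms by (auto simp: card_2_iff)

lemma card3_label:
  assumes "card S = 3" "a \<in> S"
  obtains b c where "S = {a, b, c}" "distinct [a, b, c]"
  using assms by (auto simp: card_3_iff)

lemma no_minimal_config_222:
  assumes min: "minimal_config \<alpha> \<beta> \<gamma> I J K x y z P Q R" and card: "card I = 2" "card J = 2" "card K = 2"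
  shows False
proof -
  have ext: "extremal_config \<alpha> \<beta> \<gamma> I J K x y z P Q R" using min by (simp add: minimal_config_def)
  obtain a1 b1 c1 where t: "a1 \<in> I" "b1 \<in> J" "c1 \<in> K" "P a1 b1" "Q a1 c1" "R b1 c1"
    using triangle_exists[OF ext] by blast
  obtain a2 b2 c2 where S: "I = {a1, a2}" "J = {b1, b2}" "K = {c1, c2}"
    using card card2_label t by metis
  note min' = min[unfolded S]
  note d = doubly_deficient_vertex[OF ext, folded doubly_deficient_def]
  show False
    using no_222[OF minimal_config_triangle_mono[OF min'] minimal_config_common_nbrs[OF min'] d[unfolded S] t(4-6)]
      minimal_config_differ[OF min'] minimal_config_differ[OF minimal_config_swap_AB[OF min']]
      minimal_config_differ[OF minimal_config_swap_AB[OF minimal_config_swap_BC[OF min']]]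
    by blast
qed

lemma no_minimal_config_233:
  assumes min: "minimal_config \<alpha> \<beta> \<gamma> I J K x y z P Q R" and card: "card I = 2" "card J = 3" "card K = 3"
  shows False
proof -
  have ext: "extremal_config \<alpha> \<beta> \<gamma> I J K x y z P Q R" using min by (simp add: minimal_config_def)
  obtain a1 b1 c1 where t: "a1 \<in> I" "b1 \<in> J" "c1 \<in> K" "P a1 b1" "Q a1 c1" "R b1 c1"
    using triangle_exists[OF ext] by blast
  obtain a2 where I: "I = {a1, a2}" using card(1) card2_label t(1) by metis
  obtain b2 b3 where J: "J = {b1, b2, b3}" "distinct [b1, b2, b3]" using card(2) t(2) by (rule card3_label)
  obtain c2 c3 where K: "K = {c1, c2, c3}" "distinct [c1, c2, c3]" using card(3) t(3) by (rule card3_label)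
  note min' = min[unfolded I J(1) K(1)]
  have "inj_on (row_of {c1, c2, c3} R) {b1, b2, b3} \<or> inj_on (col_of {b1, b2, b3} R) {c1, c2, c3}"
    using minimal_config_inj(2)[OF min] card by (simp only: J(1) K(1))
  moreover have "inj_on (col_of {a1, a2} Q) {c1, c2, c3}"
    using minimal_config_inj(1)[OF minimal_config_swap_AB[OF min]] card by (simp only: I K(1))
  moreover have "inj_on (col_of {a1, a2} P) {b1, b2, b3}"
    using minimal_config_inj(1)[OF minimal_config_swap_AB[OF minimal_config_swap_BC[OF min]]] card by (simp only: I J(1))
  ultimately have "differ3 b1 b2 b3 {c1, c2, c3} R \<or> differ3 c1 c2 c3 {b1, b2, b3} (\<lambda>c b. R b c)"
    "differ3 c1 c2 c3 {a1, a2} (\<lambda>c a. Q a c)" "differ3 b1 b2 b3 {a1, a2} (\<lambda>b a. P a b)"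
    using inj_row_of_differ3[OF J(2), of "{c1, c2, c3}" R] inj_col_of_differ3[OF K(2), of "{b1, b2, b3}" R]
      inj_col_of_differ3[OF K(2), of "{a1, a2}" Q] inj_col_of_differ3[OF J(2), of "{a1, a2}" P]
    by argo+
  then show False
    using no_233[OF minimal_config_triangle_mono[OF min'] minimal_config_common_nbrs[OF min'] t(4-6)]
      minimal_config_differ[OF min']
    by argo
qed

lemma minimal_config_223:
  assumes min: "minimal_config \<alpha> \<beta> \<gamma> I J K x y z P Q R" and card: "card I = 2" "card J = 2" "card K = 3"
  obtains a1 a2 b1 b2 c1 c2 c3 where "I = {a1, a2}" "J = {b1, b2}" "K = {c1, c2, c3}"
    "distinct [a1, a2]" "distinct [b1, b2]" "distinct [c1, c2, c3]"
    "H7_pattern P Q R a1 a2 b1 b2 c1 c2 c3 \<or> H7'_pattern Q P (\<lambda>c b. R b c) a1 a2 c1 c2 c3 b1 b2 \<or>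
      H7'_pattern R (\<lambda>b a. P a b) (\<lambda>c a. Q a c) b1 b2 c1 c2 c3 a1 a2"
proof -
  have ext: "extremal_config \<alpha> \<beta> \<gamma> I J K x y z P Q R" using min by (simp add: minimal_config_def)
  obtain a1 b1 c1 where t: "a1 \<in> I" "b1 \<in> J" "c1 \<in> K" "P a1 b1" "Q a1 c1" "R b1 c1"
    using triangle_exists[OF ext] by blast
  obtain a2 where I: "I = {a1, a2}" "a1 \<noteq> a2" using card(1) t(1) by (rule card2_label)
  obtain b2 where J: "J = {b1, b2}" "b1 \<noteq> b2" using card(2) t(2) by (rule card2_label)
  obtain c2 c3 where K: "K = {c1, c2, c3}" "distinct [c1, c2, c3]" using card(3) t(3) by (rule card3_label)
  note min' = min[unfolded I(1) J(1) K(1)]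
  note d = doubly_deficient_vertex[OF ext, folded doubly_deficient_def, unfolded I(1) J(1) K(1)]
  obtain u v where uv: "(u, v) \<in> {(c2, c3), (c3, c2)}"
    and pat: "H7_pattern P Q R a1 a2 b1 b2 c1 u v \<or> H7_pattern P Q R a2 a1 b2 b1 u v c1 \<or>
    H7'_pattern Q P (\<lambda>c b. R b c) a1 a2 c1 u v b1 b2 \<or> H7'_pattern Q P (\<lambda>c b. R b c) a2 a1 u c1 v b2 b1 \<or>
    H7'_pattern R (\<lambda>b a. P a b) (\<lambda>c a. Q a c) b1 b2 c1 u v a1 a2 \<or>
    H7'_pattern R (\<lambda>b a. P a b) (\<lambda>c a. Q a c) b2 b1 u c1 v a2 a1 \<or>
    spurious1 P Q R a2 a1 b2 b1 u v c1 \<or>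
    spurious2 P Q R a1 a2 b2 b1 u v c1 \<or> spurious2 (\<lambda>b a. P a b) R Q b1 b2 a2 a1 u v c1 \<or>
    spurious3 P Q R a2 a1 b1 b2 u v c1 \<or> spurious3 (\<lambda>b a. P a b) R Q b2 b1 a1 a2 u v c1"
    using classification_223[OF minimal_config_triangle_mono[OF min'] minimal_config_common_nbrs[OF min'] d t(4-6)
      minimal_config_differ(1)[OF min'] minimal_config_differ(1)[OF minimal_config_swap_AB[OF min']]
      minimal_config_differ(2)[OF min']
      minimal_config_differ_or(1)[OF minimal_config_swap_AB[OF minimal_config_swap_BC[OF min']]]
      minimal_config_differ(2)[OF minimal_config_swap_AB[OF min']]
      minimal_config_differ_or(2)[OF minimal_config_swap_AB[OF minimal_config_swap_BC[OF min']]]]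
    by blast
  have S: "{a1, a2} = I" "{a2, a1} = I" "{b1, b2} = J" "{b2, b1} = J" "{u, v, c1} = K" "{c1, u, v} = K" "{u, c1, v} = K"
    using I J K uv by auto
  have dist: "a1 \<noteq> a2" "a2 \<noteq> a1" "b1 \<noteq> b2" "b2 \<noteq> b1" "distinct [u, v, c1]" "distinct [c1, u, v]" "distinct [u, c1, v]"
    using I J K uv by auto
  \<comment> \<open>\<open>spurious2\<close> and \<open>spurious3\<close> also have to be excluded
    with the first two classes exchanged.\<close>
  note ext' = extremal_config_swap_AB[OF ext]
  have "\<not> spurious1 P Q R a2 a1 b2 b1 u v c1" "\<not> spurious2 P Q R a1 a2 b2 b1 u v c1"
    "\<not> spurious2 (\<lambda>b a. P a b) R Q b1 b2 a2 a1 u v c1" "\<not> spurious3 P Q R a2 a1 b1 b2 u v c1"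
    "\<not> spurious3 (\<lambda>b a. P a b) R Q b2 b1 a1 a2 u v c1"
    using not_spurious[of \<alpha> \<beta> \<gamma> _ _ _ _ u v c1 x y z P Q R] not_spurious[of \<beta> \<alpha> \<gamma> _ _ _ _ u v c1 y x z "\<lambda>b a. P a b" R Q]
      ext ext' dist unfolding S by (metis S)+
  then consider "H7_pattern P Q R a1 a2 b1 b2 c1 u v" | "H7_pattern P Q R a2 a1 b2 b1 u v c1"
    | "H7'_pattern Q P (\<lambda>c b. R b c) a1 a2 c1 u v b1 b2" | "H7'_pattern Q P (\<lambda>c b. R b c) a2 a1 u c1 v b2 b1"
    | "H7'_pattern R (\<lambda>b a. P a b) (\<lambda>c a. Q a c) b1 b2 c1 u v a1 a2"
    | "H7'_pattern R (\<lambda>b a. P a b) (\<lambda>c a. Q a c) b2 b1 u c1 v a2 a1"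
    using pat by blast
  then show thesis
  proof cases
    case 1 then show thesis using that[of a1 a2 b1 b2 c1 u v] S dist by simp
  next
    case 2 then show thesis using that[of a2 a1 b2 b1 u v c1] S dist by simp
  next
    case 3 then show thesis using that[of a1 a2 b1 b2 c1 u v] S dist by simp
  next
    case 4 then show thesis using that[of a2 a1 b2 b1 u c1 v] S dist by simp
  next
    case 5 then show thesis using that[of a1 a2 b1 b2 c1 u v] S dist by simp
  next
    case 6 then show thesis using that[of a2 a1 b2 b1 u c1 v] S dist by simp
  qed
qed

lemma minimal_config_crossing_common:
  assumes min: "minimal_config \<alpha> \<beta> \<gamma> {i1, i2, i3} J K x y z P Q R"
  shows "crossing_common i1 i2 i3 J K P Q"
  unfolding crossing_common_def
proof (intro ballI impI)
  have ext: "extremal_config \<alpha> \<beta> \<gamma> {i1, i2, i3} J K x y z P Q R" using min by (simp add: minimal_config_def)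
  have I: "0 < x i" if "i \<in> {i1, i2, i3}" for i using minimal_config_pos[OF min that] .
  have J: "0 < y j" if "j \<in> J" for j using minimal_config_pos[OF minimal_config_swap_AB[OF min] that] .
  have K: "0 < z k" if "k \<in> K" for k
    using minimal_config_pos[OF minimal_config_swap_AB[OF minimal_config_swap_BC[OF min]] that] .
  fix j1 j2 k1 k2
  assume "j1 \<in> J" "j2 \<in> J" "k1 \<in> K" "k2 \<in> K" "P i1 j1" "\<not> P i2 j1" "Q i1 k1" "\<not> Q i2 k1"
    "P i2 j2" "\<not> P i1 j2" "Q i2 k2" "\<not> Q i1 k2"
  then show "P i3 j1 \<and> Q i3 k1 \<or> P i3 j2 \<and> Q i3 k2"
    using crossing_common_neighbour[OF ext, of i1 i2 j1 j2 k1 k2] I J K by auto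
qed

lemma minimal_config_333:
  assumes min: "minimal_config \<alpha> \<beta> \<gamma> I J K x y z P Q R" and card: "card I = 3" "card J = 3" "card K = 3"
  obtains a1 a2 a3 b1 b2 b3 c1 c2 c3 where "I = {a1, a2, a3}" "J = {b1, b2, b3}" "K = {c1, c2, c3}"
    "distinct [a1, a2, a3]" "distinct [b1, b2, b3]" "distinct [c1, c2, c3]"
    "H9_pattern P Q R a1 a2 a3 b1 b2 b3 c1 c2 c3"
proof -
  have ext: "extremal_config \<alpha> \<beta> \<gamma> I J K x y z P Q R" using min by (simp add: minimal_config_def)
  obtain a1 b1 c1 where t: "a1 \<in> I" "b1 \<in> J" "c1 \<in> K" "P a1 b1" "Q a1 c1" "R b1 c1"
    using triangle_exists[OF ext] by blast
  obtain a2 a3 where I: "I = {a1, a2, a3}" "distinct [a1, a2, a3]" using card(1) t(1) by (rule card3_label)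
  obtain b2 b3 where J: "J = {b1, b2, b3}" "distinct [b1, b2, b3]" using card(2) t(2) by (rule card3_label)
  obtain c2 c3 where K: "K = {c1, c2, c3}" "distinct [c1, c2, c3]" using card(3) t(3) by (rule card3_label)
  note min' = min[unfolded I(1) J(1) K(1)]
  have R: "differ3 b1 b2 b3 K R" "differ3 c1 c2 c3 J (\<lambda>c b. R b c)"
    using minimal_config_inj(1)[OF min card(1)] inj_row_of_differ3[OF J(2), of K R]
      inj_col_of_differ3[OF K(2), of J R]
    by (simp_all only: J(1)[symmetric] K(1)[symmetric])
  have Q: "differ3 a1 a2 a3 K Q" "differ3 c1 c2 c3 I (\<lambda>c a. Q a c)"
    using minimal_config_inj(1)[OF minimal_config_swap_AB[OF min] card(2)] inj_row_of_differ3[OF I(2), of K Q]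
      inj_col_of_differ3[OF K(2), of I Q]
    by (simp_all only: I(1)[symmetric] K(1)[symmetric])
  have P: "differ3 a1 a2 a3 J P" "differ3 b1 b2 b3 I (\<lambda>b a. P a b)"
    using minimal_config_inj(1)[OF minimal_config_swap_AB[OF minimal_config_swap_BC[OF min]] card(3)]
      inj_row_of_differ3[OF I(2), of J P] inj_col_of_differ3[OF J(2), of I P]
    by (simp_all only: I(1)[symmetric] J(1)[symmetric] row_of_def col_of_def)
  have perm: "{a1, a3, a2} = {a1, a2, a3}" "{a2, a3, a1} = {a1, a2, a3}" by auto
  have "crossing_common a1 a2 a3 J K P Q" "crossing_common a1 a3 a2 J K P Q" "crossing_common a2 a3 a1 J K P Q"
    using minimal_config_crossing_common[of \<alpha> \<beta> \<gamma> a1 a2 a3 J K] minimal_config_crossing_common[of \<alpha> \<beta> \<gamma> a1 a3 a2 J K]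
      minimal_config_crossing_common[of \<alpha> \<beta> \<gamma> a2 a3 a1 J K] min unfolding perm I(1) by blast+
  note cc = this[unfolded J(1) K(1)]
  obtain s s' v v' u u' where vars: "(s, s') \<in> {(a2, a3), (a3, a2)}" "(v, v') \<in> {(b2, b3), (b3, b2)}" "(u, u') \<in> {(c2, c3), (c3, c2)}"
    and pat: "H9_pattern P Q R a1 s s' b1 v v' c1 u u' \<or> H9_pattern P Q R s s' a1 v v' b1 u c1 u' \<or>
      H9_pattern P Q R s a1 s' v b1 v' u u' c1"
    using classification_333[OF minimal_config_triangle_mono[OF min'] minimal_config_common_nbrs[OF min'] t(4-6)
      P(1)[unfolded J(1)] Q(1)[unfolded K(1)] P(2)[unfolded I(1)] R(1)[unfolded K(1)] Q(2)[unfolded I(1)] R(2)[unfolded J(1)] cc]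
    by blast
  have S: "I = {a1, s, s'}" "I = {s, s', a1}" "I = {s, a1, s'}" "J = {b1, v, v'}" "J = {v, v', b1}" "J = {v, b1, v'}"
    "K = {c1, u, u'}" "K = {u, c1, u'}" "K = {u, u', c1}"
    using I(1) J(1) K(1) vars by auto
  have dist: "distinct [a1, s, s']" "distinct [s, s', a1]" "distinct [s, a1, s']" "distinct [b1, v, v']" "distinct [v, v', b1]"
    "distinct [v, b1, v']" "distinct [c1, u, u']" "distinct [u, c1, u']" "distinct [u, u', c1]"
    using I(2) J(2) K(2) vars by auto
  from pat show thesis
    using that[of a1 s s' b1 v v' c1 u u'] that[of s s' a1 v v' b1 u c1 u'] that[of s a1 s' v b1 v' u u' c1] S dist by blast
qed

subsection \<open>Isomorphisms\<close>

text \<open>The classes of \<open>G\<close> may be listed in any order, because a strong isomorphism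
  only has to send classes onto classes. This is what permits sorting them by size.\<close>

lemma strongly_isomorphicI:
  assumes cls: "{cls_A G, cls_B G, cls_C G} = {X, Y, Z}"
    and indG: "independent (edges G) X" "independent (edges G) Y" "independent (edges G) Z"
    and indH: "independent (edges H) (cls_A H)" "independent (edges H) (cls_B H)" "independent (edges H) (cls_C H)"
    and disjH: "cls_A H \<inter> cls_B H = {}" "cls_A H \<inter> cls_C H = {}" "cls_B H \<inter> cls_C H = {}"
    and f: "bij_betw f X (cls_A H)" "bij_betw f Y (cls_B H)" "bij_betw f Z (cls_C H)"
    and XY: "\<And>u v. u \<in> X \<Longrightarrow> v \<in> Y \<Longrightarrow> adj G u v \<longleftrightarrow> adj H (f u) (f v)"
    and XZ: "\<And>u v. u \<in> X \<Longrightarrow> v \<in> Z \<Longrightarrow> adj G u v \<longleftrightarrow> adj H (f u) (f v)"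
    and YZ: "\<And>u v. u \<in> Y \<Longrightarrow> v \<in> Z \<Longrightarrow> adj G u v \<longleftrightarrow> adj H (f u) (f v)"
  shows "strongly_isomorphic G H"
proof -
  have "verts G = \<Union>{cls_A G, cls_B G, cls_C G}" by (auto simp: verts_def)
  then have verts: "verts G = X \<union> Y \<union> Z" unfolding cls by auto
  have im: "f ` X = cls_A H" "f ` Y = cls_B H" "f ` Z = cls_C H" using f by (auto simp: bij_betw_def)
  have "bij_betw f (X \<union> Y \<union> Z) (cls_A H \<union> cls_B H \<union> cls_C H)"
    using f disjH by (intro bij_betw_combine) auto
  moreover have "adj G u v \<longleftrightarrow> adj H (f u) (f v)" if uv: "u \<in> X \<union> Y \<union> Z" "v \<in> X \<union> Y \<union> Z" for u v
  proof -
    have same: "adj G u v \<longleftrightarrow> adj H (f u) (f v)"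
      if "u \<in> W" "v \<in> W" "independent (edges G) W" "f ` W = W'" "independent (edges H) W'" for W W'
      using that unfolding independent_def by blast
    have comm: "adj G u v \<longleftrightarrow> adj G v u" "adj H (f u) (f v) \<longleftrightarrow> adj H (f v) (f u)" by (simp_all add: insert_commute)
    consider "u \<in> X" "v \<in> X" | "u \<in> Y" "v \<in> Y" | "u \<in> Z" "v \<in> Z" | "u \<in> X" "v \<in> Y" | "u \<in> X" "v \<in> Z"
      | "u \<in> Y" "v \<in> Z" | "v \<in> X" "u \<in> Y" | "v \<in> X" "u \<in> Z" | "v \<in> Y" "u \<in> Z"
      using uv by blast
    then show ?thesis
      by cases (use same im indG indH in blast, use same im indG indH in blast, use same im indG indH in blast,
        use XY XZ YZ comm in blast, use XY XZ YZ comm in blast, use XY XZ YZ comm in blast,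
        use XY XZ YZ comm in blast, use XY XZ YZ comm in blast, use XY XZ YZ comm in blast)
  qed
  moreover have "\<forall>W\<in>{X, Y, Z}. f ` W \<in> {cls_A H, cls_B H, cls_C H}" using im by auto
  ultimately show ?thesis
    unfolding strongly_isomorphic_def verts cls verts_def[of H] by blast
qed

lemma H_graphs_valid:
  "independent (edges H7) (cls_A H7)" "independent (edges H7) (cls_B H7)" "independent (edges H7) (cls_C H7)"
  "cls_A H7 \<inter> cls_B H7 = {}" "cls_A H7 \<inter> cls_C H7 = {}" "cls_B H7 \<inter> cls_C H7 = {}"
  "independent (edges H7') (cls_A H7')" "independent (edges H7') (cls_B H7')" "independent (edges H7') (cls_C H7')"
  "cls_A H7' \<inter> cls_B H7' = {}" "cls_A H7' \<inter> cls_C H7' = {}" "cls_B H7' \<inter> cls_C H7' = {}"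
  "independent (edges H9) (cls_A H9)" "independent (edges H9) (cls_B H9)" "independent (edges H9) (cls_C H9)"
  "cls_A H9 \<inter> cls_B H9 = {}" "cls_A H9 \<inter> cls_C H9 = {}" "cls_B H9 \<inter> cls_C H9 = {}"
  by (auto simp: H7_def H7'_def H9_def complete_minus_def complete_tripartite_edges_def independent_def doubleton_eq_iff)

lemma adj_complete_minus:
  "a \<in> A \<Longrightarrow> b \<in> B \<Longrightarrow> adj (complete_minus A B C M) a b \<longleftrightarrow> {a, b} \<notin> M"
  "a \<in> A \<Longrightarrow> c \<in> C \<Longrightarrow> adj (complete_minus A B C M) a c \<longleftrightarrow> {a, c} \<notin> M"
  "b \<in> B \<Longrightarrow> c \<in> C \<Longrightarrow> adj (complete_minus A B C M) b c \<longleftrightarrow> {b, c} \<notin> M"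
  by (auto simp: complete_minus_def complete_tripartite_edges_def)

lemma strongly_isomorphic_H7:
  assumes "{cls_A G, cls_B G, cls_C G} = {X, Y, Z}"
    and "independent (edges G) X" "independent (edges G) Y" "independent (edges G) Z"
    and "X \<inter> Y = {}" "X \<inter> Z = {}" "Y \<inter> Z = {}"
    and S: "X = {a1, a2}" "Y = {b1, b2}" "Z = {c1, c2, c3}" "distinct [a1, a2]" "distinct [b1, b2]" "distinct [c1, c2, c3]"
    and pat: "H7_pattern (adj G) (adj G) (adj G) a1 a2 b1 b2 c1 c2 c3"
  shows "strongly_isomorphic G H7"
proof -
  define f where "f v = (if v = a1 then VA 1 else if v = a2 then VA 2 else if v = b1 then VB 1 else
    if v = b2 then VB 2 else if v = c1 then VC 1 else if v = c2 then VC 2 else VC 3)" for v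
  have "distinct [a1, a2, b1, b2, c1, c2, c3]" using assms by auto
  then have f: "f a1 = VA 1" "f a2 = VA 2" "f b1 = VB 1" "f b2 = VB 2" "f c1 = VC 1" "f c2 = VC 2" "f c3 = VC 3"
    by (auto simp: f_def)
  show ?thesis
  proof (rule strongly_isomorphicI[OF assms(1-4) H_graphs_valid(1-6)])
    show "bij_betw f X (cls_A H7)" "bij_betw f Y (cls_B H7)" "bij_betw f Z (cls_C H7)"
      using S by (auto simp: bij_betw_def f H7_def complete_minus_def)
    show "adj G u v \<longleftrightarrow> adj H7 (f u) (f v)" if "u \<in> X" "v \<in> Y" for u v
      using that pat unfolding S H7_def H7_pattern_def by (auto simp: f adj_complete_minus doubleton_eq_iff)
    show "adj G u v \<longleftrightarrow> adj H7 (f u) (f v)" if "u \<in> X" "v \<in> Z" for u v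
      using that pat unfolding S H7_def H7_pattern_def by (auto simp: f adj_complete_minus doubleton_eq_iff)
    show "adj G u v \<longleftrightarrow> adj H7 (f u) (f v)" if "u \<in> Y" "v \<in> Z" for u v
      using that pat unfolding S H7_def H7_pattern_def by (auto simp: f adj_complete_minus doubleton_eq_iff)
  qed
qed

lemma strongly_isomorphic_H7':
  assumes "{cls_A G, cls_B G, cls_C G} = {X, Y, Z}"
    and "independent (edges G) X" "independent (edges G) Y" "independent (edges G) Z"
    and "X \<inter> Y = {}" "X \<inter> Z = {}" "Y \<inter> Z = {}"
    and S: "X = {a1, a2}" "Y = {b1, b2, b3}" "Z = {c1, c2}" "distinct [a1, a2]" "distinct [b1, b2, b3]" "distinct [c1, c2]"
    and pat: "H7'_pattern (adj G) (adj G) (adj G) a1 a2 b1 b2 b3 c1 c2"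
  shows "strongly_isomorphic G H7'"
proof -
  define f where "f v = (if v = a1 then VA 1 else if v = a2 then VA 2 else if v = b1 then VB 1 else
    if v = b2 then VB 2 else if v = b3 then VB 3 else if v = c1 then VC 1 else VC 2)" for v
  have "distinct [a1, a2, b1, b2, b3, c1, c2]" using assms by auto
  then have f: "f a1 = VA 1" "f a2 = VA 2" "f b1 = VB 1" "f b2 = VB 2" "f b3 = VB 3" "f c1 = VC 1" "f c2 = VC 2"
    by (auto simp: f_def)
  show ?thesis
  proof (rule strongly_isomorphicI[OF assms(1-4) H_graphs_valid(7-12)])
    show "bij_betw f X (cls_A H7')" "bij_betw f Y (cls_B H7')" "bij_betw f Z (cls_C H7')"
      using S by (auto simp: bij_betw_def f H7'_def complete_minus_def)
    show "adj G u v \<longleftrightarrow> adj H7' (f u) (f v)" if "u \<in> X" "v \<in> Y" for u v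
      using that pat unfolding S H7'_def H7'_pattern_def by (auto simp: f adj_complete_minus doubleton_eq_iff)
    show "adj G u v \<longleftrightarrow> adj H7' (f u) (f v)" if "u \<in> X" "v \<in> Z" for u v
      using that pat unfolding S H7'_def H7'_pattern_def by (auto simp: f adj_complete_minus doubleton_eq_iff)
    show "adj G u v \<longleftrightarrow> adj H7' (f u) (f v)" if "u \<in> Y" "v \<in> Z" for u v
      using that pat unfolding S H7'_def H7'_pattern_def by (auto simp: f adj_complete_minus doubleton_eq_iff)
  qed
qed

lemma strongly_isomorphic_H9:
  assumes "{cls_A G, cls_B G, cls_C G} = {X, Y, Z}"
    and "independent (edges G) X" "independent (edges G) Y" "independent (edges G) Z"
    and "X \<inter> Y = {}" "X \<inter> Z = {}" "Y \<inter> Z = {}"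
    and S: "X = {a1, a2, a3}" "Y = {b1, b2, b3}" "Z = {c1, c2, c3}"
      "distinct [a1, a2, a3]" "distinct [b1, b2, b3]" "distinct [c1, c2, c3]"
    and pat: "H9_pattern (adj G) (adj G) (adj G) a1 a2 a3 b1 b2 b3 c1 c2 c3"
  shows "strongly_isomorphic G H9"
proof -
  define f where "f v = (if v = a1 then VA 1 else if v = a2 then VA 2 else if v = a3 then VA 3 else
    if v = b1 then VB 1 else if v = b2 then VB 2 else if v = b3 then VB 3 else
    if v = c1 then VC 1 else if v = c2 then VC 2 else VC 3)" for v
  have "distinct [a1, a2, a3, b1, b2, b3, c1, c2, c3]" using assms by auto
  then have f: "f a1 = VA 1" "f a2 = VA 2" "f a3 = VA 3" "f b1 = VB 1" "f b2 = VB 2" "f b3 = VB 3"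
    "f c1 = VC 1" "f c2 = VC 2" "f c3 = VC 3"
    by (auto simp: f_def)
  show ?thesis
  proof (rule strongly_isomorphicI[OF assms(1-4) H_graphs_valid(13-18)])
    show "bij_betw f X (cls_A H9)" "bij_betw f Y (cls_B H9)" "bij_betw f Z (cls_C H9)"
      using S by (auto simp: bij_betw_def f H9_def complete_minus_def)
    show "adj G u v \<longleftrightarrow> adj H9 (f u) (f v)" if "u \<in> X" "v \<in> Y" for u v
      using that pat unfolding S H9_def H9_pattern_def by (auto simp: f adj_complete_minus doubleton_eq_iff)
    show "adj G u v \<longleftrightarrow> adj H9 (f u) (f v)" if "u \<in> X" "v \<in> Z" for u v
      using that pat unfolding S H9_def H9_pattern_def by (auto simp: f adj_complete_minus doubleton_eq_iff)
    show "adj G u v \<longleftrightarrow> adj H9 (f u) (f v)" if "u \<in> Y" "v \<in> Z" for u v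
      using that pat unfolding S H9_def H9_pattern_def by (auto simp: f adj_complete_minus doubleton_eq_iff)
  qed
qed

text \<open>Class sizes are 2 or 3, so sorting leaves four size patterns, two of which are
  impossible.\<close>

lemma classification_sorted:
  assumes min: "minimal_config \<alpha> \<beta> \<gamma> X Y Z w w w (adj G) (adj G) (adj G)"
    and cls: "{cls_A G, cls_B G, cls_C G} = {X, Y, Z}"
    and ind: "independent (edges G) X" "independent (edges G) Y" "independent (edges G) Z"
    and disj: "X \<inter> Y = {}" "X \<inter> Z = {}" "Y \<inter> Z = {}"
    and le: "card X \<le> card Y" "card Y \<le> card Z"
  shows "strongly_isomorphic G H7 \<or> strongly_isomorphic G H7' \<or> strongly_isomorphic G H9"
proof -
  have sym: "(\<lambda>u v. adj G v u) = adj G" by (simp add: insert_commute)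
  have "2 \<le> card X" "card Z \<le> 3"
    using minimal_config_card_ge_2[OF min]
      minimal_config_card_le_3[OF minimal_config_swap_AB[OF minimal_config_swap_BC[OF min]]] by auto
  then consider "card X = 2" "card Y = 2" "card Z = 2" | "card X = 2" "card Y = 2" "card Z = 3"
    | "card X = 2" "card Y = 3" "card Z = 3" | "card X = 3" "card Y = 3" "card Z = 3"
    using le by linarith
  then show ?thesis
  proof cases
    case 1 then show ?thesis using no_minimal_config_222[OF min] by blast
  next
    case 2
    then obtain a1 a2 b1 b2 c1 c2 c3 where S: "X = {a1, a2}" "Y = {b1, b2}" "Z = {c1, c2, c3}"
      and dist: "distinct [a1, a2]" "distinct [b1, b2]" "distinct [c1, c2, c3]"
      and pat: "H7_pattern (adj G) (adj G) (adj G) a1 a2 b1 b2 c1 c2 c3 \<or>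
        H7'_pattern (adj G) (adj G) (adj G) a1 a2 c1 c2 c3 b1 b2 \<or>
        H7'_pattern (adj G) (adj G) (adj G) b1 b2 c1 c2 c3 a1 a2"
      by (rule minimal_config_223[OF min, unfolded sym])
    have cls': "{cls_A G, cls_B G, cls_C G} = {X, Z, Y}" "{cls_A G, cls_B G, cls_C G} = {Y, Z, X}"
      using cls by auto
    have disj': "Y \<inter> X = {}" "Z \<inter> X = {}" "Z \<inter> Y = {}" using disj by auto
    from pat show ?thesis
      using strongly_isomorphic_H7[OF cls ind disj S dist]
        strongly_isomorphic_H7'[OF cls'(1) ind(1,3,2) disj(2,1) disj'(3) S(1,3,2) dist(1,3,2)]
        strongly_isomorphic_H7'[OF cls'(2) ind(2,3,1) disj(3) disj'(1,2) S(2,3,1) dist(2,3,1)]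
      by argo
  next
    case 3 then show ?thesis using no_minimal_config_233[OF min] by blast
  next
    case 4
    then obtain a1 a2 a3 b1 b2 b3 c1 c2 c3 where S: "X = {a1, a2, a3}" "Y = {b1, b2, b3}" "Z = {c1, c2, c3}"
      and dist: "distinct [a1, a2, a3]" "distinct [b1, b2, b3]" "distinct [c1, c2, c3]"
      and pat: "H9_pattern (adj G) (adj G) (adj G) a1 a2 a3 b1 b2 b3 c1 c2 c3"
      by (rule minimal_config_333[OF min])
    show ?thesis using strongly_isomorphic_H9[OF cls ind disj S dist pat] by blast
  qed
qed

theorem theorem4:
  fixes \<alpha> \<beta> \<gamma> :: real
    and G :: "'a tripartition_graph"
    and w :: "'a \<Rightarrow> real"
  assumes "(\<alpha>, \<beta>, \<gamma>) \<in> R2_region"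
    and "(G, w) \<in> Tri \<alpha> \<beta> \<gamma>"
    and "extremal \<alpha> \<beta> \<gamma> (G, w)"
    and "vertex_minimal \<alpha> \<beta> \<gamma> (G, w)"
  shows "strongly_isomorphic G H7 \<or> strongly_isomorphic G H7' \<or> strongly_isomorphic G H9"
proof -
  let ?A = "cls_A G" and ?B = "cls_B G" and ?C = "cls_C G"
  have tri: "tripartite G" and w: "\<And>v. v \<in> verts G \<Longrightarrow> 0 \<le> w v"
    and sums: "sum w ?A = 1" "sum w ?B = 1" "sum w ?C = 1"
    using assms(2) by (auto simp: Tri_def weighted_tripartite_def)
  have disj: "?A \<inter> ?B = {}" "?A \<inter> ?C = {}" "?B \<inter> ?C = {}"
    and ind: "independent (edges G) ?A" "independent (edges G) ?B" "independent (edges G) ?C"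
    using tri by (auto simp: tripartite_def)
  note fin = tripartite_finite[OF tri]
  have card: "card (verts G) = card ?A + card ?B + card ?C"
    unfolding verts_def using fin disj by (simp add: card_Un_disjoint Int_Un_distrib2)
  have t: "triangle_density (G, w) = T_min \<alpha> \<beta> \<gamma>" using assms(3) by (simp add: extremal_def)
  have "extremal_config \<alpha> \<beta> \<gamma> ?A ?B ?C w w w (adj G) (adj G) (adj G)"
    unfolding extremal_config_def prob_def
    using assms(1,2) fin w sums t triangle_density_eq_tdens[OF tri, of w] densities_eq_dens[OF tri, of w]
    by (auto simp: Tri_def verts_def)
  then have ABC: "minimal_config \<alpha> \<beta> \<gamma> ?A ?B ?C w w w (adj G) (adj G) (adj G)"
    using assms(4) card t by (force simp: minimal_config_def vertex_minimal_def not_less)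
  \<comment> \<open>All three relations are the symmetric adjacency of \<open>G\<close>, so
    permuting the classes of the configuration leaves them unchanged.\<close>
  have sym: "(\<lambda>u v. adj G v u) = adj G" by (simp add: insert_commute)
  note AB = minimal_config_swap_AB[where P = "adj G", unfolded sym]
    and BC = minimal_config_swap_BC[where R = "adj G", unfolded sym]
  note disj' = disj disj[unfolded Int_commute[of ?A] Int_commute[of ?B ?C]]
  \<comment> \<open>The six possible orders of the class sizes; the two transpositions
    \<open>AB\<close> and \<open>BC\<close> generate every permutation that is needed.\<close>
  consider "card ?A \<le> card ?B" "card ?B \<le> card ?C" | "card ?A \<le> card ?C" "card ?C \<le> card ?B"
    | "card ?B \<le> card ?A" "card ?A \<le> card ?C" | "card ?B \<le> card ?C" "card ?C \<le> card ?A"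
    | "card ?C \<le> card ?A" "card ?A \<le> card ?B" | "card ?C \<le> card ?B" "card ?B \<le> card ?A"
    by linarith
  then show ?thesis
  proof cases
    case 1 show ?thesis by (rule classification_sorted[OF ABC]) (use 1 ind disj' in auto)
  next
    case 2 show ?thesis by (rule classification_sorted[OF BC[OF ABC]]) (use 2 ind disj' in auto)
  next
    case 3 show ?thesis by (rule classification_sorted[OF AB[OF ABC]]) (use 3 ind disj' in auto)
  next
    case 4 show ?thesis by (rule classification_sorted[OF BC[OF AB[OF ABC]]]) (use 4 ind disj' in auto)
  next
    case 5 show ?thesis by (rule classification_sorted[OF AB[OF BC[OF ABC]]]) (use 5 ind disj' in auto)
  next
    case 6 show ?thesis by (rule classification_sorted[OF AB[OF BC[OF AB[OF ABC]]]]) (use 6 ind disj' in auto)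
  qed
qed

end
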